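(* Let $k$ be a commutative ring and let $(A,C)_\psi$ be an entwining structure over $k$ with $A$ a finitely generated projective $k$-module. If there exists a normalised cointegral map in $(A,C)_\psi$, then any morphism in $\mathbf{M}_A^C(\psi)$ which has a section (resp. retraction) in $\mathbf{M}^C$ has a section (resp. retraction) in $\mathbf{M}_A^C(\psi)$.
   Context: Conventions: $k$ is a commutative ring; algebras are unital $k$-algebras, coalgebras are counital $k$-coalgebras; $\otimes=\otimes_k$, $A^*=\mathrm{Hom}_k(A,k)$; an identity map is denoted by the name of the module; $V\otimes k$ and $k\otimes V$ are identified with $V$. $\mathbf{M}^C$ is the category of right $C$-comodules; $\mu$ is the product of $A$, $1_A$ its unit (also as a map $k\to A$), $\Delta,\epsilon$ the coproduct and counit of $C$. Coactions are written $\rho^M(m)=m_{(0)}\otimes m_{(1)}$. An entwining structure $(A,C)_\psi$ consists of a $k$-algebra $A$, a $k$-coalgebra $C$ and a $k$-linear map $\psi:C\otimes A\to A\otimes C$, written $\psi(c\otimes a)=a_\alpha\otimes c^\alpha$ (summation understood), such that $\psi\circ(C\otimes\mu)=(\mu\otimes C)\circ(A\otimes\psi)\circ(\psi\otimes A)$, $\psi(c\otimes 1_A)=1_A\otimes c$, $(A\otimes\Delta)\circ\psi=(\psi\otimes C)\circ(C\otimes\psi)\circ(\Delta\otimes A)$, $(A\otimes\epsilon)\circ\psi=\epsilon\otimes A$. An $(A,C)_\psi$-module is a right $A$-module, right $C$-comodule $M$ with $\rho^M(m\cdot a)=m_{(0)}\cdot a_\alpha\otimes m_{(1)}{}^\alpha$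 for all $a\in A$, $m\in M$. Morphisms are right $A$-linear, right $C$-colinear maps; the category is $\mathbf{M}_A^C(\psi)$. For $A$ finitely generated projective over $k$, $\mathrm{coev}_A:k\to A\otimes A^*$ is $\kappa\mapsto\kappa\sum_{i\in I}a_i\otimes a_i^*$, where $\{a_i,a_i^*\}_{i\in I}$ is a (finite) dual basis of $A$. A normalised cointegral map in $(A,C)_\psi$ is a $k$-linear map $\phi:A^*\otimes C\to A$ such that (1) $(A\otimes\psi)\circ(\psi\otimes\phi)\circ(C\otimes\mathrm{coev}_A\otimes C)\circ\Delta=(A\otimes\phi\otimes C)\circ(\mathrm{coev}_A\otimes\Delta)$ as maps $C\to A\otimes A\otimes C$; (2) $(A\otimes\mu)\circ(A\otimes\phi\otimes A)\circ(\mathrm{coev}_A\otimes C\otimes A)=(\mu\otimes\phi)\circ(A\otimes\mathrm{coev}_A\otimes C)\circ\psi$ as maps $C\otimes A\to A\otimes A$; (3) $\mu\circ(A\otimes\phi)\circ(\mathrm{coev}_A\otimes C)=1_A\circ\epsilon$ as maps $C\to A$. A section of $f:N\to M$ is a morphism $g:M\to N$ with $f\circ g=\mathrm{id}_M$; a retraction of $f$ is a morphism $g:M\to N$ with $g\circ f=\mathrm{id}_N$. *)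

theory Defs
  imports "HOL-Algebra.Module" "HOL-Algebra.AbelCoset"
begin

text \<open>
  Modules over a commutative ring \<open>k\<close> are those of \<^theory>\<open>HOL-Algebra.Module\<close>. The fields
  \<open>mult\<close> and \<open>one\<close> of a module record are only meaningful when the module is an algebra; they are
  left \<open>undefined\<close> in the constructions below. Maps are compared on carriers only.
\<close>

section \<open>Linear maps, free modules, projectivity\<close>

definition lin ::
  "('k, 'r) ring_scheme \<Rightarrow> ('k, 'm, 'x) module_scheme \<Rightarrow> ('k, 'n, 'y) module_scheme \<Rightarrow> ('m \<Rightarrow> 'n) set"
  where "lin k M N = {f \<in> carrier M \<rightarrow> carrier N.
     (\<forall>x\<in>carrier M. \<forall>y\<in>carrier M. f (x \<oplus>\<^bsub>M\<^esub> y) = f x \<oplus>\<^bsub>N\<^esub> f y) \<and>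
     (\<forall>r\<in>carrier k. \<forall>x\<in>carrier M. f (r \<odot>\<^bsub>M\<^esub> x) = r \<odot>\<^bsub>N\<^esub> f x)}"

definition self_module :: "('k, 'r) ring_scheme \<Rightarrow> ('k, 'k) module"
  where "self_module k = \<lparr>carrier = carrier k, mult = mult k, one = one k,
     zero = zero k, add = add k, smult = mult k\<rparr>"

definition dual :: "('k, 'r) ring_scheme \<Rightarrow> ('k, 'm, 'x) module_scheme \<Rightarrow> ('k, 'm \<Rightarrow> 'k) module"
  where "dual k M = \<lparr>carrier = lin k M (self_module k) \<inter> extensional (carrier M),
     mult = undefined, one = undefined,
     zero = (\<lambda>x\<in>carrier M. \<zero>\<^bsub>k\<^esub>),
     add = (\<lambda>f g. \<lambda>x\<in>carrier M. f x \<oplus>\<^bsub>k\<^esub> g x),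
     smult = (\<lambda>r f. \<lambda>x\<in>carrier M. r \<otimes>\<^bsub>k\<^esub> f x)\<rparr>"

definition module_span :: "('k, 'r) ring_scheme \<Rightarrow> ('k, 'm, 'x) module_scheme \<Rightarrow> 'm set \<Rightarrow> 'm set"
  where "module_span k M S = \<Inter>{H. submodule H k M \<and> S \<subseteq> H}"

definition quotient_module ::
  "('k, 'm, 'x) module_scheme \<Rightarrow> 'm set \<Rightarrow> ('k, 'm set) module"
  where "quotient_module M H = \<lparr>carrier = a_rcosets\<^bsub>M\<^esub> H,
     mult = undefined, one = undefined,
     zero = H, add = set_add M, smult = (\<lambda>r X. \<Union>x\<in>X. H +>\<^bsub>M\<^esub> (r \<odot>\<^bsub>M\<^esub> x))\<rparr>"

definition free_module :: "('k, 'r) ring_scheme \<Rightarrow> 'i set \<Rightarrow> ('k, 'i \<Rightarrow> 'k) module"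
  where "free_module k I = \<lparr>carrier =
       {u. range u \<subseteq> carrier k \<and> finite {i. u i \<noteq> \<zero>\<^bsub>k\<^esub>} \<and> {i. u i \<noteq> \<zero>\<^bsub>k\<^esub>} \<subseteq> I},
     mult = undefined, one = undefined,
     zero = (\<lambda>i. \<zero>\<^bsub>k\<^esub>), add = (\<lambda>u v i. u i \<oplus>\<^bsub>k\<^esub> v i), smult = (\<lambda>r u i. r \<otimes>\<^bsub>k\<^esub> u i)\<rparr>"

definition free_gen :: "('k, 'r) ring_scheme \<Rightarrow> 'i \<Rightarrow> 'i \<Rightarrow> 'k"
  where "free_gen k i = (\<lambda>j. if j = i then \<one>\<^bsub>k\<^esub> else \<zero>\<^bsub>k\<^esub>)"

definition finitely_generated :: "('k, 'r) ring_scheme \<Rightarrow> ('k, 'm, 'x) module_scheme \<Rightarrow> bool"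
  where "finitely_generated k M \<longleftrightarrow>
     (\<exists>S. finite S \<and> S \<subseteq> carrier M \<and> module_span k M S = carrier M)"

text \<open>
  Direct summand of a free module. Taking the basis inside the type of \<open>M\<close> is no restriction: a
  projective module is a direct summand of the free module on its own carrier.
\<close>
definition projective :: "('k, 'r) ring_scheme \<Rightarrow> ('k, 'm, 'x) module_scheme \<Rightarrow> bool"
  where "projective k M \<longleftrightarrow>
     (\<exists>(I :: 'm set) i p. i \<in> lin k M (free_module k I) \<and> p \<in> lin k (free_module k I) M \<and>
        (\<forall>x\<in>carrier M. p (i x) = x))"

section \<open>Tensor products\<close>

definition tensor_relations ::
  "('k, 'r) ring_scheme \<Rightarrow> ('k, 'm, 'x) module_scheme \<Rightarrow> ('k, 'n, 'y) module_scheme \<Rightarrow> ('m \<times> 'n \<Rightarrow> 'k) set"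
  where "tensor_relations k M N =
    (let F = free_module k (carrier M \<times> carrier N); e = free_gen k in
      {e (x \<oplus>\<^bsub>M\<^esub> x', y) \<ominus>\<^bsub>F\<^esub> (e (x, y) \<oplus>\<^bsub>F\<^esub> e (x', y)) | x x' y.
         x \<in> carrier M \<and> x' \<in> carrier M \<and> y \<in> carrier N} \<union>
      {e (x, y \<oplus>\<^bsub>N\<^esub> y') \<ominus>\<^bsub>F\<^esub> (e (x, y) \<oplus>\<^bsub>F\<^esub> e (x, y')) | x y y'.
         x \<in> carrier M \<and> y \<in> carrier N \<and> y' \<in> carrier N} \<union>
      {e (r \<odot>\<^bsub>M\<^esub> x, y) \<ominus>\<^bsub>F\<^esub> (r \<odot>\<^bsub>F\<^esub> e (x, y)) | r x y.
         r \<in> carrier k \<and> x \<in> carrier M \<and> y \<in> carrier N} \<union>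
      {e (x, r \<odot>\<^bsub>N\<^esub> y) \<ominus>\<^bsub>F\<^esub> (r \<odot>\<^bsub>F\<^esub> e (x, y)) | r x y.
         r \<in> carrier k \<and> x \<in> carrier M \<and> y \<in> carrier N})"

definition tensor_kernel ::
  "('k, 'r) ring_scheme \<Rightarrow> ('k, 'm, 'x) module_scheme \<Rightarrow> ('k, 'n, 'y) module_scheme \<Rightarrow> ('m \<times> 'n \<Rightarrow> 'k) set"
  where "tensor_kernel k M N =
    module_span k (free_module k (carrier M \<times> carrier N)) (tensor_relations k M N)"

definition tensor ::
  "('k, 'm, 'x) module_scheme \<Rightarrow> ('k, 'r) ring_scheme \<Rightarrow> ('k, 'n, 'y) module_scheme
     \<Rightarrow> ('k, ('m \<times> 'n \<Rightarrow> 'k) set) module"  (\<open>_ \<Otimes>\<^bsub>_\<^esub> _\<close> [71, 0, 70] 70)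
  where "M \<Otimes>\<^bsub>k\<^esub> N =
    quotient_module (free_module k (carrier M \<times> carrier N)) (tensor_kernel k M N)"

definition tens ::
  "('k, 'r) ring_scheme \<Rightarrow> ('k, 'm, 'x) module_scheme \<Rightarrow> ('k, 'n, 'y) module_scheme
     \<Rightarrow> 'm \<Rightarrow> 'n \<Rightarrow> ('m \<times> 'n \<Rightarrow> 'k) set"
  where "tens k M N x y =
    tensor_kernel k M N +>\<^bsub>free_module k (carrier M \<times> carrier N)\<^esub> free_gen k (x, y)"

text \<open>
  The linear map out of a tensor product into \<open>P\<close> induced by a bilinear map \<open>f\<close>. The
  choice of representative of the class \<open>t\<close> does not matter, as \<open>f\<close> respects the relations.
\<close>
definition tlift ::
  "('k, 'r) ring_scheme \<Rightarrow> ('k, 'p, 'z) module_scheme \<Rightarrow> ('m \<Rightarrow> 'n \<Rightarrow> 'p) \<Rightarrow> ('m \<times> 'n \<Rightarrow> 'k) set \<Rightarrow> 'p"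
  where "tlift k P f t = (let u = (SOME u. u \<in> t) in
     \<Oplus>\<^bsub>P\<^esub>z\<in>{z. u z \<noteq> \<zero>\<^bsub>k\<^esub>}. u z \<odot>\<^bsub>P\<^esub> f (fst z) (snd z))"

text \<open>\<open>tmap k P Q f g\<close> is \<open>f \<otimes> g\<close>, where \<open>P\<close> and \<open>Q\<close> are the codomains of \<open>f\<close> and \<open>g\<close>.\<close>
definition tmap ::
  "('k, 'r) ring_scheme \<Rightarrow> ('k, 'p, 'x) module_scheme \<Rightarrow> ('k, 'q, 'y) module_scheme
     \<Rightarrow> ('m \<Rightarrow> 'p) \<Rightarrow> ('n \<Rightarrow> 'q) \<Rightarrow> ('m \<times> 'n \<Rightarrow> 'k) set \<Rightarrow> ('p \<times> 'q \<Rightarrow> 'k) set"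
  where "tmap k P Q f g = tlift k (P \<Otimes>\<^bsub>k\<^esub> Q) (\<lambda>x y. tens k P Q (f x) (g y))"

text \<open>\<open>(x \<otimes> y) \<otimes> z \<mapsto> x \<otimes> (y \<otimes> z)\<close> and its inverse.\<close>
definition tassoc where
  "tassoc k M N P = tlift k (M \<Otimes>\<^bsub>k\<^esub> (N \<Otimes>\<^bsub>k\<^esub> P))
     (\<lambda>s z. tlift k (M \<Otimes>\<^bsub>k\<^esub> (N \<Otimes>\<^bsub>k\<^esub> P)) (\<lambda>x y. tens k M (N \<Otimes>\<^bsub>k\<^esub> P) x (tens k N P y z)) s)"

definition tassoc_inv where
  "tassoc_inv k M N P = tlift k ((M \<Otimes>\<^bsub>k\<^esub> N) \<Otimes>\<^bsub>k\<^esub> P)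
     (\<lambda>x s. tlift k ((M \<Otimes>\<^bsub>k\<^esub> N) \<Otimes>\<^bsub>k\<^esub> P) (\<lambda>y z. tens k (M \<Otimes>\<^bsub>k\<^esub> N) P (tens k M N x y) z) s)"

text \<open>\<open>k \<otimes> M \<rightarrow> M\<close>, \<open>M \<otimes> k \<rightarrow> M\<close>, and the inverse \<open>M \<rightarrow> k \<otimes> M\<close> of the first.\<close>
definition tunit_l where "tunit_l k M = tlift k M (\<lambda>r x. r \<odot>\<^bsub>M\<^esub> x)"
definition tunit_r where "tunit_r k M = tlift k M (\<lambda>x r. r \<odot>\<^bsub>M\<^esub> x)"
definition tunit_l_inv where "tunit_l_inv k M x = tens k (self_module k) M \<one>\<^bsub>k\<^esub> x"

section \<open>Coevaluation\<close>

definition dual_basis ::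
  "('k, 'r) ring_scheme \<Rightarrow> ('k, 'm, 'x) module_scheme \<Rightarrow> nat \<Rightarrow> (nat \<Rightarrow> 'm) \<Rightarrow> (nat \<Rightarrow> 'm \<Rightarrow> 'k) \<Rightarrow> bool"
  where "dual_basis k M n a a' \<longleftrightarrow>
     (\<forall>i<n. a i \<in> carrier M \<and> a' i \<in> carrier (dual k M)) \<and>
     (\<forall>x\<in>carrier M. x = (\<Oplus>\<^bsub>M\<^esub>i\<in>{..<n}. a' i x \<odot>\<^bsub>M\<^esub> a i))"

text \<open>The value does not depend on the dual basis that is chosen.\<close>
definition coev ::
  "('k, 'r) ring_scheme \<Rightarrow> ('k, 'm, 'x) module_scheme \<Rightarrow> 'k \<Rightarrow> ('m \<times> ('m \<Rightarrow> 'k) \<Rightarrow> 'k) set"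
  where "coev k M r = (let (n, a, a') = (SOME (n, a, a'). dual_basis k M n a a') in
     r \<odot>\<^bsub>M \<Otimes>\<^bsub>k\<^esub> dual k M\<^esub>
       (\<Oplus>\<^bsub>M \<Otimes>\<^bsub>k\<^esub> dual k M\<^esub>i\<in>{..<n}. tens k M (dual k M) (a i) (a' i)))"

section \<open>Algebras, coalgebras, comodules\<close>

text \<open>\<^locale>\<open>algebra\<close> of the library requires commutativity.\<close>
locale unital_algebra = module k A + ring A
  for k :: "('k, 'r) ring_scheme" and A :: "('k, 'a, 'x) module_scheme" +
  assumes smult_mult_l: "\<lbrakk>r \<in> carrier k; x \<in> carrier A; y \<in> carrier A\<rbrakk> \<Longrightarrow>
      (r \<odot>\<^bsub>A\<^esub> x) \<otimes>\<^bsub>A\<^esub> y = r \<odot>\<^bsub>A\<^esub> (x \<otimes>\<^bsub>A\<^esub> y)"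
    and smult_mult_r: "\<lbrakk>r \<in> carrier k; x \<in> carrier A; y \<in> carrier A\<rbrakk> \<Longrightarrow>
      x \<otimes>\<^bsub>A\<^esub> (r \<odot>\<^bsub>A\<^esub> y) = r \<odot>\<^bsub>A\<^esub> (x \<otimes>\<^bsub>A\<^esub> y)"

definition product_map where "product_map k A = tlift k A (mult A)"

locale coalgebra = module k C
  for k :: "('k, 'r) ring_scheme" and C :: "('k, 'c, 'x) module_scheme" +
  fixes \<Delta> :: "'c \<Rightarrow> ('c \<times> 'c \<Rightarrow> 'k) set" and \<epsilon> :: "'c \<Rightarrow> 'k"
  assumes coproduct_lin: "\<Delta> \<in> lin k C (C \<Otimes>\<^bsub>k\<^esub> C)"
    and counit_lin: "\<epsilon> \<in> lin k C (self_module k)"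
    and coassoc: "c \<in> carrier C \<Longrightarrow>
      tassoc k C C C (tmap k (C \<Otimes>\<^bsub>k\<^esub> C) C \<Delta> id (\<Delta> c)) = tmap k C (C \<Otimes>\<^bsub>k\<^esub> C) id \<Delta> (\<Delta> c)"
    and counit_l: "c \<in> carrier C \<Longrightarrow> tunit_l k C (tmap k (self_module k) C \<epsilon> id (\<Delta> c)) = c"
    and counit_r: "c \<in> carrier C \<Longrightarrow> tunit_r k C (tmap k C (self_module k) id \<epsilon> (\<Delta> c)) = c"

locale right_comodule = coalgebra k C \<Delta> \<epsilon> + M: module k M
  for k :: "('k, 'r) ring_scheme" and C :: "('k, 'c, 'x) module_scheme" and \<Delta> \<epsilon>
    and M :: "('k, 'm, 'y) module_scheme" +
  fixes \<rho> :: "'m \<Rightarrow> ('m \<times> 'c \<Rightarrow> 'k) set"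
  assumes coaction_lin: "\<rho> \<in> lin k M (M \<Otimes>\<^bsub>k\<^esub> C)"
    and coaction_coassoc: "x \<in> carrier M \<Longrightarrow>
      tassoc k M C C (tmap k (M \<Otimes>\<^bsub>k\<^esub> C) C \<rho> id (\<rho> x)) = tmap k M (C \<Otimes>\<^bsub>k\<^esub> C) id \<Delta> (\<rho> x)"
    and coaction_counit: "x \<in> carrier M \<Longrightarrow>
      tunit_r k M (tmap k M (self_module k) id \<epsilon> (\<rho> x)) = x"

definition comodule_hom where
  "comodule_hom k C M \<rho>\<^sub>M N \<rho>\<^sub>N =
     {f \<in> lin k M N. \<forall>x\<in>carrier M. \<rho>\<^sub>N (f x) = tmap k N C f id (\<rho>\<^sub>M x)}"

text \<open>Right modules over the algebra \<open>A\<close>; \<open>act x a\<close> is \<open>x \<cdot> a\<close>.\<close>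
locale right_module = unital_algebra k A + M: module k M
  for k :: "('k, 'r) ring_scheme" and A :: "('k, 'a, 'x) module_scheme"
    and M :: "('k, 'm, 'y) module_scheme" +
  fixes act :: "'m \<Rightarrow> 'a \<Rightarrow> 'm"
  assumes act_lin_l: "a \<in> carrier A \<Longrightarrow> (\<lambda>x. act x a) \<in> lin k M M"
    and act_lin_r: "x \<in> carrier M \<Longrightarrow> act x \<in> lin k A M"
    and act_mult: "\<lbrakk>x \<in> carrier M; a \<in> carrier A; b \<in> carrier A\<rbrakk> \<Longrightarrow>
      act (act x a) b = act x (a \<otimes>\<^bsub>A\<^esub> b)"
    and act_one: "x \<in> carrier M \<Longrightarrow> act x \<one>\<^bsub>A\<^esub> = x"

definition right_module_hom where
  "right_module_hom k A M act\<^sub>M N act\<^sub>N =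
     {f \<in> lin k M N. \<forall>x\<in>carrier M. \<forall>a\<in>carrier A. f (act\<^sub>M x a) = act\<^sub>N (f x) a}"

section \<open>Entwining structures\<close>

locale entwining_structure = unital_algebra k A + coalgebra k C \<Delta> \<epsilon>
  for k :: "('k, 'r) ring_scheme" and A :: "('k, 'a, 'x) module_scheme"
    and C :: "('k, 'c, 'y) module_scheme" and \<Delta> \<epsilon> +
  fixes \<psi> :: "('c \<times> 'a \<Rightarrow> 'k) set \<Rightarrow> ('a \<times> 'c \<Rightarrow> 'k) set"
  assumes entwining_lin: "\<psi> \<in> lin k (C \<Otimes>\<^bsub>k\<^esub> A) (A \<Otimes>\<^bsub>k\<^esub> C)"
    and entwining_mult: "s \<in> carrier (C \<Otimes>\<^bsub>k\<^esub> (A \<Otimes>\<^bsub>k\<^esub> A)) \<Longrightarrow>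
      (\<psi> \<circ> tmap k C A id (product_map k A)) s =
      (tmap k A C (product_map k A) id \<circ> tassoc_inv k A A C \<circ> tmap k A (A \<Otimes>\<^bsub>k\<^esub> C) id \<psi> \<circ>
        tassoc k A C A \<circ> tmap k (A \<Otimes>\<^bsub>k\<^esub> C) A \<psi> id \<circ> tassoc_inv k C A A) s"
    and entwining_one: "c \<in> carrier C \<Longrightarrow> \<psi> (tens k C A c \<one>\<^bsub>A\<^esub>) = tens k A C \<one>\<^bsub>A\<^esub> c"
    and entwining_coproduct: "t \<in> carrier (C \<Otimes>\<^bsub>k\<^esub> A) \<Longrightarrow>
      (tmap k A (C \<Otimes>\<^bsub>k\<^esub> C) id \<Delta> \<circ> \<psi>) t =
      (tassoc k A C C \<circ> tmap k (A \<Otimes>\<^bsub>k\<^esub> C) C \<psi> id \<circ> tassoc_inv k C A C \<circ>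
        tmap k C (A \<Otimes>\<^bsub>k\<^esub> C) id \<psi> \<circ> tassoc k C C A \<circ> tmap k (C \<Otimes>\<^bsub>k\<^esub> C) A \<Delta> id) t"
    and entwining_counit: "t \<in> carrier (C \<Otimes>\<^bsub>k\<^esub> A) \<Longrightarrow>
      (tunit_r k A \<circ> tmap k A (self_module k) id \<epsilon> \<circ> \<psi>) t =
      (tunit_l k A \<circ> tmap k (self_module k) A \<epsilon> id) t"

locale entwined_module = entwining_structure k A C \<Delta> \<epsilon> \<psi> +
    right_module k A M act + right_comodule k C \<Delta> \<epsilon> M \<rho>
  for k :: "('k, 'r) ring_scheme" and A :: "('k, 'a, 'x) module_scheme"
    and C :: "('k, 'c, 'y) module_scheme" and \<Delta> \<epsilon> \<psi>
    and M :: "('k, 'm, 'z) module_scheme" and act \<rho> +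
  assumes compatible: "\<lbrakk>x \<in> carrier M; a \<in> carrier A\<rbrakk> \<Longrightarrow>
      \<rho> (act x a) =
      (tmap k M C (tlift k M act) id \<circ> tassoc_inv k M A C \<circ> tmap k M (A \<Otimes>\<^bsub>k\<^esub> C) id \<psi> \<circ>
        tassoc k M C A) (tens k (M \<Otimes>\<^bsub>k\<^esub> C) A (\<rho> x) a)"

definition entwined_hom where
  "entwined_hom k A C M act\<^sub>M \<rho>\<^sub>M N act\<^sub>N \<rho>\<^sub>N =
     right_module_hom k A M act\<^sub>M N act\<^sub>N \<inter> comodule_hom k C M \<rho>\<^sub>M N \<rho>\<^sub>N"

section \<open>Normalised cointegral maps\<close>

text \<open>\<open>coev_tensor k A V\<close> is \<open>coev\<^sub>A \<otimes> V\<close> on \<open>V = k \<otimes> V\<close>, with values in \<open>A \<otimes> (A\<^sup>* \<otimes> V)\<close>.\<close>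
definition coev_tensor where
  "coev_tensor k A V = tassoc k A (dual k A) V \<circ>
     tmap k (A \<Otimes>\<^bsub>k\<^esub> dual k A) V (coev k A) id \<circ> tunit_l_inv k V"

definition normalised_cointegral ::
  "('k, 'r) ring_scheme \<Rightarrow> ('k, 'a, 'x) module_scheme \<Rightarrow> ('k, 'c, 'y) module_scheme
     \<Rightarrow> ('c \<Rightarrow> ('c \<times> 'c \<Rightarrow> 'k) set) \<Rightarrow> ('c \<Rightarrow> 'k)
     \<Rightarrow> (('c \<times> 'a \<Rightarrow> 'k) set \<Rightarrow> ('a \<times> 'c \<Rightarrow> 'k) set)
     \<Rightarrow> ((('a \<Rightarrow> 'k) \<times> 'c \<Rightarrow> 'k) set \<Rightarrow> 'a) \<Rightarrow> bool"
  where "normalised_cointegral k A C \<Delta> \<epsilon> \<psi> \<phi> \<longleftrightarrow>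
     \<phi> \<in> lin k (dual k A \<Otimes>\<^bsub>k\<^esub> C) A \<and>
     (\<forall>c\<in>carrier C.
        (tmap k A (A \<Otimes>\<^bsub>k\<^esub> C) id \<psi> \<circ> tassoc k A C A \<circ> tmap k (A \<Otimes>\<^bsub>k\<^esub> C) A \<psi> \<phi> \<circ>
          tassoc_inv k C A (dual k A \<Otimes>\<^bsub>k\<^esub> C) \<circ>
          tmap k C (A \<Otimes>\<^bsub>k\<^esub> (dual k A \<Otimes>\<^bsub>k\<^esub> C)) id (coev_tensor k A C) \<circ> \<Delta>) c =
        (tmap k A (A \<Otimes>\<^bsub>k\<^esub> C) id (tmap k A C \<phi> id \<circ> tassoc_inv k (dual k A) C C) \<circ>
          coev_tensor k A (C \<Otimes>\<^bsub>k\<^esub> C) \<circ> \<Delta>) c) \<and>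
     (\<forall>t\<in>carrier (C \<Otimes>\<^bsub>k\<^esub> A).
        (tmap k A A id (product_map k A \<circ> tmap k A A \<phi> id \<circ> tassoc_inv k (dual k A) C A) \<circ>
          coev_tensor k A (C \<Otimes>\<^bsub>k\<^esub> A)) t =
        (tmap k A A (product_map k A) \<phi> \<circ> tassoc_inv k A A (dual k A \<Otimes>\<^bsub>k\<^esub> C) \<circ>
          tmap k A (A \<Otimes>\<^bsub>k\<^esub> (dual k A \<Otimes>\<^bsub>k\<^esub> C)) id (coev_tensor k A C) \<circ> \<psi>) t) \<and>
     (\<forall>c\<in>carrier C.
        (product_map k A \<circ> tmap k A A id \<phi> \<circ> coev_tensor k A C) c = \<epsilon> c \<odot>\<^bsub>A\<^esub> \<one>\<^bsub>A\<^esub>)"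

end

theory Submission
  imports Defs
begin

text \<open>
  Maschke-type averaging. Through \<open>coev\<close>, a cointegral map \<open>\<phi>\<close> amounts to elements
  \<open>\<theta>(c) = \<Sum>\<^sub>i a\<^sub>i \<otimes> \<phi>(a\<^sub>i\<^sup>* \<otimes> c)\<close> of \<open>A \<otimes> A\<close> that behave like a separability idempotent relative
  to \<open>\<psi>\<close>: \<open>\<theta>(c) \<cdot> b = b\<^sub>\<alpha> \<cdot> \<theta>(c\<^sup>\<alpha>)\<close>, \<open>\<theta>\<close> is colinear, and multiplying the two legs of \<open>\<theta>(c)\<close>
  gives \<open>\<epsilon>(c) 1\<close>. A colinear map \<open>g : M \<rightarrow> N\<close> is averaged to
  \<open>x \<mapsto> \<Sum>\<^sub>i g (x\<^sub>0 \<cdot> a\<^sub>i) \<cdot> \<phi>(a\<^sub>i\<^sup>* \<otimes> x\<^sub>1)\<close>. The first two properties make the average \<open>A\<close>-linear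
  and \<open>C\<close>-colinear, and the third shows that averaging keeps sections and retractions of a morphism.
\<close>

section \<open>Linear and bilinear maps\<close>

text \<open>A coaction \<open>\<rho>\<^sub>M x\<close> is a coset in a quotient, not a sum with
  named components, so Sweedler calculations become comparisons of linear maps on pure tensors: an
  identity about \<open>\<rho>\<^sub>M x\<close> is proved for an arbitrary \<open>s\<close> in M
  \<otimes> C and specialised at the end. The obstacle is the colinearity condition on \<phi>, which
  is given on the elements \<Delta>(c) and not on pure tensors of C \<otimes> C. Its two sides are
  therefore kept as linear maps on all of C \<otimes> C and exchanged only behind \<Delta>. Such a
  \<Delta> is produced from (\<rho> \<otimes> C) \<circ> \<rho> by coassociativity of M, and the
  same law read backwards removes it after the exchange. Finite generation and projectivity of A
  supply the finite dual basis that makes \<theta>(c) a finite sum. The average is built from g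
  alone; the morphism that g splits enters only when the normalisation is applied.\<close>

lemma linI:
  assumes "\<And>x. x \<in> carrier M \<Longrightarrow> f x \<in> carrier N"
    and "\<And>x y. x \<in> carrier M \<Longrightarrow> y \<in> carrier M \<Longrightarrow> f (x \<oplus>\<^bsub>M\<^esub> y) = f x \<oplus>\<^bsub>N\<^esub> f y"
    and "\<And>r x. r \<in> carrier k \<Longrightarrow> x \<in> carrier M \<Longrightarrow> f (r \<odot>\<^bsub>M\<^esub> x) = r \<odot>\<^bsub>N\<^esub> f x"
  shows "f \<in> lin k M N"
  using assms by (auto simp: lin_def)

lemma linD:
  assumes "f \<in> lin k M N"
  shows lin_closed: "x \<in> carrier M \<Longrightarrow> f x \<in> carrier N"
    and lin_add: "x \<in> carrier M \<Longrightarrow> y \<in> carrier M \<Longrightarrow> f (x \<oplus>\<^bsub>M\<^esub> y) = f x \<oplus>\<^bsub>N\<^esub> f y"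
    and lin_smult: "r \<in> carrier k \<Longrightarrow> x \<in> carrier M \<Longrightarrow> f (r \<odot>\<^bsub>M\<^esub> x) = r \<odot>\<^bsub>N\<^esub> f x"
  using assms by (auto simp: lin_def)

text \<open>In a module, sums and multiples of carrier elements stay in the carrier, so linearity
  sees only the values there. This allows a function to be traded for its restriction, or for a
  formula that is valid on the carrier alone.\<close>

lemma lin_cong:
  assumes "module k M" "\<And>x. x \<in> carrier M \<Longrightarrow> f x = g x"
  shows "f \<in> lin k M N \<longleftrightarrow> g \<in> lin k M N"
proof -
  interpret M: module k M by fact
  show ?thesis using assms(2) by (auto simp: lin_def Pi_iff)
qed

lemma lin_id: "id \<in> lin k M M"
  by (rule linI) auto

lemma lin_comp: "f \<in> lin k M N \<Longrightarrow> g \<in> lin k N P \<Longrightarrow> (\<lambda>x. g (f x)) \<in> lin k M P"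
  by (rule linI) (auto simp: lin_closed lin_add lin_smult)

lemma lin_zero:
  assumes "module k M" "module k N" "f \<in> lin k M N"
  shows "f \<zero>\<^bsub>M\<^esub> = \<zero>\<^bsub>N\<^esub>"
proof -
  interpret M: module k M by fact
  interpret N: module k N by fact
  have "f \<zero>\<^bsub>M\<^esub> = f (\<zero>\<^bsub>k\<^esub> \<odot>\<^bsub>M\<^esub> \<zero>\<^bsub>M\<^esub>)" by simp
  also have "\<dots> = \<zero>\<^bsub>k\<^esub> \<odot>\<^bsub>N\<^esub> f \<zero>\<^bsub>M\<^esub>" by (rule lin_smult[OF assms(3)]) auto
  finally show ?thesis using lin_closed[OF assms(3)] by simp
qed

lemma lin_a_inv:
  assumes "module k M" "module k N" "f \<in> lin k M N" "x \<in> carrier M"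
  shows "f (\<ominus>\<^bsub>M\<^esub> x) = \<ominus>\<^bsub>N\<^esub> f x"
proof -
  interpret M: module k M by fact
  interpret N: module k N by fact
  have "f (\<ominus>\<^bsub>M\<^esub> x) \<oplus>\<^bsub>N\<^esub> f x = f (\<ominus>\<^bsub>M\<^esub> x \<oplus>\<^bsub>M\<^esub> x)"
    using assms(4) by (simp add: lin_add[OF assms(3)])
  also have "\<dots> = \<zero>\<^bsub>N\<^esub>"
    using assms(4) lin_zero[OF assms(1-3)] by (simp add: M.l_neg)
  finally show ?thesis
    using assms(4) lin_closed[OF assms(3)] by (simp add: N.minus_equality)
qed

lemma lin_minus:
  assumes "module k M" "module k N" "f \<in> lin k M N" "x \<in> carrier M" "y \<in> carrier M"
  shows "f (x \<ominus>\<^bsub>M\<^esub> y) = f x \<ominus>\<^bsub>N\<^esub> f y"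
proof -
  interpret M: module k M by fact
  show ?thesis using assms(4,5)
    by (simp add: a_minus_def lin_add[OF assms(3)] lin_a_inv[OF assms(1-3)])
qed

lemma lin_finsum:
  assumes "module k M" "module k N" "f \<in> lin k M N" "finite S" "g \<in> S \<rightarrow> carrier M"
  shows "f (\<Oplus>\<^bsub>M\<^esub>i\<in>S. g i) = (\<Oplus>\<^bsub>N\<^esub>i\<in>S. f (g i))"
proof -
  interpret M: module k M by fact
  interpret N: module k N by fact
  show ?thesis
    using assms(4,5)
  proof (induction S rule: finite_induct)
    case empty
    show ?case using lin_zero[OF assms(1-3)] by simp
  next
    case (insert i S)
    then show ?case
      using lin_closed[OF assms(3)] lin_add[OF assms(3)] by (simp add: Pi_iff)
  qed
qed

lemma lin_finsum_fun:
  assumes "module k M" "module k N" "finite S" "\<And>i. i \<in> S \<Longrightarrow> f i \<in> lin k M N"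
  shows "(\<lambda>x. \<Oplus>\<^bsub>N\<^esub>i\<in>S. f i x) \<in> lin k M N"
proof -
  interpret M: module k M by fact
  interpret N: module k N by fact
  note l = linD[OF assms(4)]
  show ?thesis
  proof (rule linI)
    fix x assume x: "x \<in> carrier M"
    then show "(\<Oplus>\<^bsub>N\<^esub>i\<in>S. f i x) \<in> carrier N" using l by auto
    fix r assume "r \<in> carrier k"
    with x show "(\<Oplus>\<^bsub>N\<^esub>i\<in>S. f i (r \<odot>\<^bsub>M\<^esub> x)) = r \<odot>\<^bsub>N\<^esub> (\<Oplus>\<^bsub>N\<^esub>i\<in>S. f i x)"
      using l by (subst N.finsum_smult_ldistr[OF assms(3)]) (auto intro!: N.finsum_cong')
  next
    fix x y assume xy: "x \<in> carrier M" "y \<in> carrier M"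
    have "(\<Oplus>\<^bsub>N\<^esub>i\<in>S. f i (x \<oplus>\<^bsub>M\<^esub> y)) = (\<Oplus>\<^bsub>N\<^esub>i\<in>S. f i x \<oplus>\<^bsub>N\<^esub> f i y)"
      using l xy by (intro N.finsum_cong') auto
    also have "\<dots> = (\<Oplus>\<^bsub>N\<^esub>i\<in>S. f i x) \<oplus>\<^bsub>N\<^esub> (\<Oplus>\<^bsub>N\<^esub>i\<in>S. f i y)"
      using l xy by (intro N.finsum_addf) auto
    finally show "(\<Oplus>\<^bsub>N\<^esub>i\<in>S. f i (x \<oplus>\<^bsub>M\<^esub> y)) = (\<Oplus>\<^bsub>N\<^esub>i\<in>S. f i x) \<oplus>\<^bsub>N\<^esub> (\<Oplus>\<^bsub>N\<^esub>i\<in>S. f i y)" .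
  qed
qed

section \<open>Bilinear maps, curried so that fixing either argument leaves a linear map\<close>

definition bilin ::
  "('k, 'r) ring_scheme \<Rightarrow> ('k, 'm, 'x) module_scheme \<Rightarrow> ('k, 'n, 'y) module_scheme
     \<Rightarrow> ('k, 'p, 'z) module_scheme \<Rightarrow> ('m \<Rightarrow> 'n \<Rightarrow> 'p) set"
  where "bilin k M N P = {f. (\<forall>x\<in>carrier M. f x \<in> lin k N P) \<and>
     (\<forall>y\<in>carrier N. (\<lambda>x. f x y) \<in> lin k M P)}"

lemma bilinI:
  assumes "\<And>x. x \<in> carrier M \<Longrightarrow> f x \<in> lin k N P"
    and "\<And>y. y \<in> carrier N \<Longrightarrow> (\<lambda>x. f x y) \<in> lin k M P"
  shows "f \<in> bilin k M N P"
  using assms by (auto simp: bilin_def)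

lemma bilinD:
  assumes "f \<in> bilin k M N P"
  shows bilin_lin_r: "x \<in> carrier M \<Longrightarrow> f x \<in> lin k N P"
    and bilin_lin_l: "y \<in> carrier N \<Longrightarrow> (\<lambda>x. f x y) \<in> lin k M P"
    and bilin_closed: "x \<in> carrier M \<Longrightarrow> y \<in> carrier N \<Longrightarrow> f x y \<in> carrier P"
  using assms by (auto simp: bilin_def lin_def)

text \<open>Commutativity of k is what makes multiplication by a fixed scalar linear. Both orders of
  the arguments occur: the first in \<open>coev\<close>, the second in the identification of M
  \<otimes> k with M.\<close>

lemma bilin_smult:
  assumes "module k M"
  shows "(\<lambda>r x. r \<odot>\<^bsub>M\<^esub> x) \<in> bilin k (self_module k) M M"
    and "(\<lambda>x r. r \<odot>\<^bsub>M\<^esub> x) \<in> bilin k M (self_module k) M"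
proof -
  interpret M: module k M by fact
  show "(\<lambda>r x. r \<odot>\<^bsub>M\<^esub> x) \<in> bilin k (self_module k) M M"
    and "(\<lambda>x r. r \<odot>\<^bsub>M\<^esub> x) \<in> bilin k M (self_module k) M"
    by (auto intro!: bilinI linI simp: self_module_def M.smult_r_distr M.smult_l_distr
        M.smult_assoc1[symmetric] M.m_comm)
qed

section \<open>The base ring as a module, and dual modules\<close>

lemma self_module_module:
  assumes "cring k"
  shows "module k (self_module k)"
proof -
  interpret cring k by fact
  show ?thesis
  proof (rule moduleI)
    show "abelian_group (self_module k)"
    proof (rule abelian_groupI)
      fix x assume "x \<in> carrier (self_module k)"
      then show "\<exists>y\<in>carrier (self_module k). y \<oplus>\<^bsub>self_module k\<^esub> x = \<zero>\<^bsub>self_module k\<^esub>"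
        using l_neg by (auto simp: self_module_def intro!: bexI[of _ "\<ominus>\<^bsub>k\<^esub> x"])
    qed (auto simp: self_module_def a_ac)
  qed (auto simp: self_module_def l_distr r_distr m_assoc intro: assms)
qed

text \<open>Functionals are extensional, so equality on the carrier is equality. Every pointwise
  operation has to restrict its result again; \<open>dualI\<close> lets closure be checked on the
  formula before restriction.\<close>

lemma dual_module:
  assumes "module k M"
  shows "module k (dual k M)"
proof -
  interpret M: module k M by fact
  note s = self_module_def
  have dualI: "(\<lambda>x\<in>carrier M. h x) \<in> carrier (dual k M)" if "h \<in> lin k M (self_module k)" for h
    using that by (simp add: dual_def lin_cong[OF assms, of "restrict h (carrier M)" h])
  have dualD: "h \<in> lin k M (self_module k)" "h \<in> extensional (carrier M)"
    if "h \<in> carrier (dual k M)" for h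
    using that by (auto simp: dual_def)
  have dc: "h x \<in> carrier k" if "h \<in> carrier (dual k M)" "x \<in> carrier M" for h x
    using lin_closed[OF dualD(1), OF that] by (simp add: s)
  have da: "h (x \<oplus>\<^bsub>M\<^esub> y) = h x \<oplus>\<^bsub>k\<^esub> h y"
    if "h \<in> carrier (dual k M)" "x \<in> carrier M" "y \<in> carrier M" for h x y
    using lin_add[OF dualD(1), OF that] by (simp add: s)
  have ds: "h (r \<odot>\<^bsub>M\<^esub> x) = r \<otimes>\<^bsub>k\<^esub> h x"
    if "h \<in> carrier (dual k M)" "x \<in> carrier M" "r \<in> carrier k" for h x r
    using lin_smult[OF dualD(1), OF that(1,3,2)] by (simp add: s)
  have eqI: "g = h" if "g \<in> extensional (carrier M)" "h \<in> extensional (carrier M)"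
    "\<And>x. x \<in> carrier M \<Longrightarrow> g x = h x" for g h :: "_ \<Rightarrow> 'a"
    using that by (rule extensionalityI)
  have add: "g \<oplus>\<^bsub>dual k M\<^esub> h = (\<lambda>x\<in>carrier M. g x \<oplus>\<^bsub>k\<^esub> h x)" for g h by (simp add: dual_def)
  have sm: "r \<odot>\<^bsub>dual k M\<^esub> h = (\<lambda>x\<in>carrier M. r \<otimes>\<^bsub>k\<^esub> h x)" for r h by (simp add: dual_def)
  have zero: "\<zero>\<^bsub>dual k M\<^esub> = (\<lambda>x\<in>carrier M. \<zero>\<^bsub>k\<^esub>)" by (simp add: dual_def)
  note ops = add sm zero
  have addc: "g \<oplus>\<^bsub>dual k M\<^esub> h \<in> carrier (dual k M)"
    if "g \<in> carrier (dual k M)" "h \<in> carrier (dual k M)" for g h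
    unfolding ops using that
    by (intro dualI linI) (auto simp: s dc da ds M.R.r_distr M.R.a_ac)
  have smc: "r \<odot>\<^bsub>dual k M\<^esub> h \<in> carrier (dual k M)"
    if "h \<in> carrier (dual k M)" "r \<in> carrier k" for r h
    unfolding ops using that
    by (intro dualI linI) (auto simp: s dc da ds M.R.r_distr M.R.m_ac)
  have zc: "\<zero>\<^bsub>dual k M\<^esub> \<in> carrier (dual k M)"
    unfolding ops by (intro dualI linI) (auto simp: s)
  show ?thesis
  proof (rule moduleI)
    show "abelian_group (dual k M)"
    proof (rule abelian_groupI)
      fix h assume h: "h \<in> carrier (dual k M)"
      have "(\<lambda>x\<in>carrier M. \<ominus>\<^bsub>k\<^esub> h x) \<in> carrier (dual k M)"
        using h by (intro dualI linI) (auto simp: s dc da ds M.R.minus_add M.R.r_minus)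
      moreover have "(\<lambda>x\<in>carrier M. \<ominus>\<^bsub>k\<^esub> h x) \<oplus>\<^bsub>dual k M\<^esub> h = \<zero>\<^bsub>dual k M\<^esub>"
        unfolding ops by (rule eqI) (auto simp: dc[OF h] M.R.l_neg)
      ultimately show "\<exists>y\<in>carrier (dual k M). y \<oplus>\<^bsub>dual k M\<^esub> h = \<zero>\<^bsub>dual k M\<^esub>" by blast
      show "\<zero>\<^bsub>dual k M\<^esub> \<oplus>\<^bsub>dual k M\<^esub> h = h"
        unfolding ops by (rule eqI) (auto simp: dc[OF h] dualD[OF h])
    next
      fix g h l assume "g \<in> carrier (dual k M)" "h \<in> carrier (dual k M)" "l \<in> carrier (dual k M)"
      then show "g \<oplus>\<^bsub>dual k M\<^esub> h \<oplus>\<^bsub>dual k M\<^esub> l = g \<oplus>\<^bsub>dual k M\<^esub> (h \<oplus>\<^bsub>dual k M\<^esub> l)"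
        unfolding ops by (intro eqI) (auto simp: dc M.R.a_assoc)
    next
      fix g h assume "g \<in> carrier (dual k M)" "h \<in> carrier (dual k M)"
      then show "g \<oplus>\<^bsub>dual k M\<^esub> h = h \<oplus>\<^bsub>dual k M\<^esub> g"
        unfolding ops by (intro eqI) (auto simp: dc M.R.a_comm)
    qed (rule addc zc; assumption)+
  next
    fix h assume "h \<in> carrier (dual k M)"
    then show "\<one>\<^bsub>k\<^esub> \<odot>\<^bsub>dual k M\<^esub> h = h"
      unfolding ops by (intro eqI) (auto simp: dc dualD)
  qed (auto simp: addc smc M.R.is_cring intro: eqI,
      (auto simp: ops dc M.R.l_distr M.R.r_distr M.R.m_assoc intro!: eqI))
qed

section \<open>Free modules\<close>

lemma free_module_carrierD:
  assumes "u \<in> carrier (free_module k I)"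
  shows "u i \<in> carrier k" "finite {i. u i \<noteq> \<zero>\<^bsub>k\<^esub>}" "{i. u i \<noteq> \<zero>\<^bsub>k\<^esub>} \<subseteq> I"
  using assms by (auto simp: free_module_def)

lemma free_module_module:
  assumes "cring k"
  shows "module k (free_module k I)"
proof -
  interpret cring k by fact
  let ?F = "free_module k I"
  \<comment> \<open>Cancellation and zero divisors may shrink a support, so membership is tested
    with any finite \<open>J\<close> that covers it.\<close>
  have FI: "u \<in> carrier ?F" if "\<And>i. u i \<in> carrier k" "finite J" "J \<subseteq> I"
    "\<And>i. i \<notin> J \<Longrightarrow> u i = \<zero>\<^bsub>k\<^esub>" for u J
  proof -
    have "{i. u i \<noteq> \<zero>\<^bsub>k\<^esub>} \<subseteq> J" using that(4) by auto
    then show ?thesis using that(1,2,3) by (auto simp: free_module_def dest: finite_subset)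
  qed
  note FD = free_module_carrierD
  have ops: "u \<oplus>\<^bsub>?F\<^esub> v = (\<lambda>i. u i \<oplus>\<^bsub>k\<^esub> v i)" "r \<odot>\<^bsub>?F\<^esub> u = (\<lambda>i. r \<otimes>\<^bsub>k\<^esub> u i)"
    "\<zero>\<^bsub>?F\<^esub> = (\<lambda>i. \<zero>\<^bsub>k\<^esub>)" for u v r
    by (simp_all add: free_module_def)
  show ?thesis
  proof (rule moduleI)
    show "abelian_group ?F"
    proof (rule abelian_groupI)
      fix u v assume "u \<in> carrier ?F" "v \<in> carrier ?F"
      then show "u \<oplus>\<^bsub>?F\<^esub> v \<in> carrier ?F"
        unfolding ops
        by (intro FI[where J = "{i. u i \<noteq> \<zero>\<^bsub>k\<^esub>} \<union> {i. v i \<noteq> \<zero>\<^bsub>k\<^esub>}"]) (auto simp: FD dest: FD(3))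
    next
      fix u assume u: "u \<in> carrier ?F"
      then have "(\<lambda>i. \<ominus>\<^bsub>k\<^esub> u i) \<in> carrier ?F"
        by (intro FI[where J = "{i. u i \<noteq> \<zero>\<^bsub>k\<^esub>}"]) (auto simp: FD dest: FD(3))
      then show "\<exists>v\<in>carrier ?F. v \<oplus>\<^bsub>?F\<^esub> u = \<zero>\<^bsub>?F\<^esub>"
        using FD(1)[OF u] by (intro bexI[of _ "\<lambda>i. \<ominus>\<^bsub>k\<^esub> u i"]) (auto simp: ops l_neg)
    next
      show "\<zero>\<^bsub>?F\<^esub> \<in> carrier ?F" by (rule FI[of _ "{}"]) (auto simp: ops)
    qed (auto simp: ops FD(1) a_ac)
  next
    fix r u assume "r \<in> carrier k" "u \<in> carrier ?F"
    then show "r \<odot>\<^bsub>?F\<^esub> u \<in> carrier ?F"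
      unfolding ops
      by (intro FI[where J = "{i. u i \<noteq> \<zero>\<^bsub>k\<^esub>}"]) (auto simp: FD dest: FD(3))
  qed (auto simp: ops FD(1) l_distr r_distr m_assoc intro: assms)
qed

lemma free_gen_closed:
  assumes "cring k" "i \<in> I"
  shows "free_gen k i \<in> carrier (free_module k I)"
proof -
  interpret cring k by fact
  have "{j. free_gen k i j \<noteq> \<zero>\<^bsub>k\<^esub>} \<subseteq> {i}" by (auto simp: free_gen_def)
  then show ?thesis using assms(2) by (auto simp: free_module_def free_gen_def dest: finite_subset)
qed

text \<open>This is the sum inside \<open>tlift\<close> with the representative made explicit, so
  the freedom to choose a representative becomes a statement about the kernel of this map.\<close>

definition free_lift ::
  "('k, 'r) ring_scheme \<Rightarrow> ('k, 'p, 'z) module_scheme \<Rightarrow> ('i \<Rightarrow> 'p) \<Rightarrow> ('i \<Rightarrow> 'k) \<Rightarrow> 'p"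
  where "free_lift k P f u = (\<Oplus>\<^bsub>P\<^esub>z\<in>{z. u z \<noteq> \<zero>\<^bsub>k\<^esub>}. u z \<odot>\<^bsub>P\<^esub> f z)"

text \<open>Terms outside the support vanish. Additivity needs this, because the supports of u, v
  and their sum differ and the three sums must be taken over one index set.\<close>

lemma free_lift_superset:
  assumes "module k P" "f \<in> I \<rightarrow> carrier P" "u \<in> carrier (free_module k I)"
    "finite J" "J \<subseteq> I" "{i. u i \<noteq> \<zero>\<^bsub>k\<^esub>} \<subseteq> J"
  shows "free_lift k P f u = (\<Oplus>\<^bsub>P\<^esub>z\<in>J. u z \<odot>\<^bsub>P\<^esub> f z)"
proof -
  interpret P: module k P by fact
  have "f i \<in> carrier P" if "i \<in> J" for i
    using that assms(2,5) by auto
  then show ?thesis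
    unfolding free_lift_def
    using assms(4,6) free_module_carrierD(1)[OF assms(3)]
    by (intro P.add.finprod_mono_neutral_cong_left) auto
qed

lemma free_lift_lin:
  assumes "module k P" "f \<in> I \<rightarrow> carrier P"
  shows "free_lift k P f \<in> lin k (free_module k I) P"
proof -
  interpret P: module k P by fact
  interpret F: module k "free_module k I" by (rule free_module_module) (rule P.R.is_cring)
  note FD = free_module_carrierD
  note ss = free_lift_superset[OF assms]
  have f: "i \<in> I \<Longrightarrow> f i \<in> carrier P" for i using assms(2) by auto
  have ops: "u \<oplus>\<^bsub>free_module k I\<^esub> v = (\<lambda>i. u i \<oplus>\<^bsub>k\<^esub> v i)"
    "r \<odot>\<^bsub>free_module k I\<^esub> u = (\<lambda>i. r \<otimes>\<^bsub>k\<^esub> u i)" for u v r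
    by (simp_all add: free_module_def)
  show ?thesis
  proof (rule linI)
    fix u assume u: "u \<in> carrier (free_module k I)"
    have J: "finite {i. u i \<noteq> \<zero>\<^bsub>k\<^esub>}" "{i. u i \<noteq> \<zero>\<^bsub>k\<^esub>} \<subseteq> I" using FD[OF u] by auto
    show "free_lift k P f u \<in> carrier P"
      unfolding free_lift_def using FD(1)[OF u] J f by (intro P.finsum_closed) auto
    fix r assume r: "r \<in> carrier k"
    have "free_lift k P f (r \<odot>\<^bsub>free_module k I\<^esub> u) =
        (\<Oplus>\<^bsub>P\<^esub>z\<in>{i. u i \<noteq> \<zero>\<^bsub>k\<^esub>}. (r \<otimes>\<^bsub>k\<^esub> u z) \<odot>\<^bsub>P\<^esub> f z)"
      using r J F.smult_closed[OF r u]
      by (subst ss[where J = "{i. u i \<noteq> \<zero>\<^bsub>k\<^esub>}"]) (auto simp: ops)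
    also have "\<dots> = (\<Oplus>\<^bsub>P\<^esub>z\<in>{i. u i \<noteq> \<zero>\<^bsub>k\<^esub>}. r \<odot>\<^bsub>P\<^esub> (u z \<odot>\<^bsub>P\<^esub> f z))"
      using J r FD(1)[OF u] f by (intro P.finsum_cong') (auto simp: P.smult_assoc1)
    also have "\<dots> = r \<odot>\<^bsub>P\<^esub> free_lift k P f u"
      unfolding free_lift_def using J r FD(1)[OF u] f
      by (intro P.finsum_smult_ldistr[symmetric]) auto
    finally show "free_lift k P f (r \<odot>\<^bsub>free_module k I\<^esub> u) = r \<odot>\<^bsub>P\<^esub> free_lift k P f u" .
  next
    fix u v assume uv: "u \<in> carrier (free_module k I)" "v \<in> carrier (free_module k I)"
    define J where "J = {i. u i \<noteq> \<zero>\<^bsub>k\<^esub>} \<union> {i. v i \<noteq> \<zero>\<^bsub>k\<^esub>}"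
    have J: "finite J" "J \<subseteq> I" using FD[OF uv(1)] FD[OF uv(2)] by (auto simp: J_def)
    have "free_lift k P f (u \<oplus>\<^bsub>free_module k I\<^esub> v) = (\<Oplus>\<^bsub>P\<^esub>z\<in>J. (u z \<oplus>\<^bsub>k\<^esub> v z) \<odot>\<^bsub>P\<^esub> f z)"
      using F.a_closed[OF uv] J by (subst ss[where J = J]) (auto simp: ops J_def)
    also have "\<dots> = (\<Oplus>\<^bsub>P\<^esub>z\<in>J. u z \<odot>\<^bsub>P\<^esub> f z \<oplus>\<^bsub>P\<^esub> v z \<odot>\<^bsub>P\<^esub> f z)"
      using J FD(1)[OF uv(1)] FD(1)[OF uv(2)] f
      by (intro P.finsum_cong') (auto simp: P.smult_l_distr)
    also have "\<dots> = (\<Oplus>\<^bsub>P\<^esub>z\<in>J. u z \<odot>\<^bsub>P\<^esub> f z) \<oplus>\<^bsub>P\<^esub> (\<Oplus>\<^bsub>P\<^esub>z\<in>J. v z \<odot>\<^bsub>P\<^esub> f z)"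
      using J FD(1)[OF uv(1)] FD(1)[OF uv(2)] f by (intro P.finsum_addf) auto
    also have "\<dots> = free_lift k P f u \<oplus>\<^bsub>P\<^esub> free_lift k P f v"
      using uv J by (simp add: ss[where J = J] J_def)
    finally show "free_lift k P f (u \<oplus>\<^bsub>free_module k I\<^esub> v) =
      free_lift k P f u \<oplus>\<^bsub>P\<^esub> free_lift k P f v" .
  qed
qed

lemma free_lift_gen:
  assumes "module k P" "f \<in> I \<rightarrow> carrier P" "i \<in> I"
  shows "free_lift k P f (free_gen k i) = f i"
proof -
  interpret P: module k P by fact
  show ?thesis
    using assms(3) funcset_mem[OF assms(2,3)]
    by (subst free_lift_superset[OF assms(1,2) free_gen_closed[OF P.R.is_cring assms(3)],
          where J = "{i}"]) (auto simp: free_gen_def Pi_iff)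
qed

text \<open>Induction on a finite set covering the support; one coordinate is split off at a time.
  Scaled generators are the base case, so no separate step for scalar multiples arises.\<close>

lemma free_module_induct [consumes 2, case_names gen add zero]:
  assumes "cring k" "u \<in> carrier (free_module k I)"
    and gen: "\<And>r i. r \<in> carrier k \<Longrightarrow> i \<in> I \<Longrightarrow> P (r \<odot>\<^bsub>free_module k I\<^esub> free_gen k i)"
    and add: "\<And>u v. u \<in> carrier (free_module k I) \<Longrightarrow> v \<in> carrier (free_module k I) \<Longrightarrow>
      P u \<Longrightarrow> P v \<Longrightarrow> P (u \<oplus>\<^bsub>free_module k I\<^esub> v)"
    and zero: "P \<zero>\<^bsub>free_module k I\<^esub>"
  shows "P u"
proof -
  interpret cring k by fact
  interpret F: module k "free_module k I" by (rule free_module_module) fact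
  note FD = free_module_carrierD
  have "P u" if "finite J" "u \<in> carrier (free_module k I)" "{i. u i \<noteq> \<zero>\<^bsub>k\<^esub>} \<subseteq> J" for J u
    using that
  proof (induction J arbitrary: u rule: finite_induct)
    case empty
    then have "u = \<zero>\<^bsub>free_module k I\<^esub>" by (auto simp: free_module_def)
    then show ?case using zero by simp
  next
    case (insert j J)
    note u = FD[OF insert.prems(1)]
    \<comment> \<open>\<open>v\<close> is \<open>u\<close> with the coordinate \<open>j\<close>
      erased, hence covered by the smaller set; \<open>u\<close> is recovered by adding back the
      multiple \<open>u j\<close> of the generator at \<open>j\<close>.\<close>
    define v where "v = u(j := \<zero>\<^bsub>k\<^esub>)"
    have "{i. v i \<noteq> \<zero>\<^bsub>k\<^esub>} \<subseteq> {i. u i \<noteq> \<zero>\<^bsub>k\<^esub>}" by (auto simp: v_def)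
    then have "finite {i. v i \<noteq> \<zero>\<^bsub>k\<^esub>}" "{i. v i \<noteq> \<zero>\<^bsub>k\<^esub>} \<subseteq> I"
      using u(2,3) by (auto dest: finite_subset)
    then have v: "v \<in> carrier (free_module k I)" using u(1) by (auto simp: free_module_def v_def)
    have "{i. v i \<noteq> \<zero>\<^bsub>k\<^esub>} \<subseteq> J" using insert.prems(2) by (auto simp: v_def)
    with insert.IH v have Pv: "P v" by blast
    show ?case
    proof (cases "u j = \<zero>\<^bsub>k\<^esub>")
      case True
      then have "v = u" by (auto simp: v_def)
      with Pv show ?thesis by simp
    next
      case False
      then have j: "j \<in> I" using u(3) by auto
      have eq: "v \<oplus>\<^bsub>free_module k I\<^esub> (u j \<odot>\<^bsub>free_module k I\<^esub> free_gen k j) = u"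
        using u(1) by (auto simp: free_module_def v_def free_gen_def)
      have "u j \<odot>\<^bsub>free_module k I\<^esub> free_gen k j \<in> carrier (free_module k I)"
        using free_gen_closed[OF assms(1) j] u(1) by simp
      from add[OF v this Pv gen[OF u(1) j]] show ?thesis unfolding eq .
    qed
  qed
  then show ?thesis using FD(2)[OF assms(2)] assms(2) by blast
qed

section \<open>Spans and kernels as submodules\<close>

lemma module_span_submodule:
  assumes "module k M" "S \<subseteq> carrier M"
  shows "submodule (module_span k M S) k M" "S \<subseteq> module_span k M S"
proof -
  interpret M: module k M by fact
  \<comment> \<open>The whole module belongs to the family, which keeps the intersection inside the
    carrier.\<close>
  have c: "carrier M \<in> {H. submodule H k M \<and> S \<subseteq> H}"
    using assms(2) M.carrier_is_submodule by simp
  note E = M.submoduleE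
  have z: "\<zero>\<^bsub>M\<^esub> \<in> H" if "submodule H k M" for H
    using submodule.axioms(1)[OF that] subgroup.one_closed by fastforce
  show "submodule (module_span k M S) k M"
  proof (rule M.submoduleI)
    show "module_span k M S \<subseteq> carrier M" using c unfolding module_span_def by blast
  qed (auto simp: module_span_def z E)
  show "S \<subseteq> module_span k M S" unfolding module_span_def by blast
qed

lemma module_span_minimal:
  "submodule H k M \<Longrightarrow> S \<subseteq> H \<Longrightarrow> module_span k M S \<subseteq> H"
  unfolding module_span_def by blast

lemma submodule_kernel:
  assumes "module k M" "module k N" "f \<in> lin k M N"
  shows "submodule {x \<in> carrier M. f x = \<zero>\<^bsub>N\<^esub>} k M"
proof -
  interpret M: module k M by fact
  interpret N: module k N by fact
  show ?thesis
    using lin_zero[OF assms] lin_a_inv[OF assms] linD[OF assms(3)]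
    by (intro M.submoduleI) auto
qed

section \<open>Quotient modules\<close>

lemma submodule_abelian_subgroup:
  assumes "module k M" "submodule H k M"
  shows "abelian_subgroup H M"
proof -
  interpret M: module k M by fact
  show ?thesis
    by (rule abelian_subgroupI3[OF additive_subgroupI[OF submodule.axioms(1)[OF assms(2)]]
          M.abelian_group_axioms])
qed

lemma quotient_module_carrier:
  "carrier (quotient_module M H) = (\<lambda>x. H +>\<^bsub>M\<^esub> x) ` carrier M"
  by (auto simp: quotient_module_def A_RCOSETS_def')

lemma quotient_module_add:
  assumes "module k M" "submodule H k M" "x \<in> carrier M" "y \<in> carrier M"
  shows "(H +>\<^bsub>M\<^esub> x) \<oplus>\<^bsub>quotient_module M H\<^esub> (H +>\<^bsub>M\<^esub> y) = H +>\<^bsub>M\<^esub> (x \<oplus>\<^bsub>M\<^esub> y)"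
proof -
  interpret abelian_subgroup H M by (rule submodule_abelian_subgroup) fact+
  show ?thesis using a_rcos_sum[OF assms(3,4)] by (simp add: quotient_module_def)
qed

text \<open>The scalar multiple of a coset is defined as a union over all its representatives. Two
  representatives differ by an element of H, and so do their multiples; hence all members of the
  union are one and the same coset.\<close>

lemma quotient_module_smult:
  assumes "module k M" "submodule H k M" "x \<in> carrier M" "r \<in> carrier k"
  shows "r \<odot>\<^bsub>quotient_module M H\<^esub> (H +>\<^bsub>M\<^esub> x) = H +>\<^bsub>M\<^esub> (r \<odot>\<^bsub>M\<^esub> x)"
proof -
  interpret M: module k M by fact
  interpret H: abelian_subgroup H M by (rule submodule_abelian_subgroup) fact+
  have "H +>\<^bsub>M\<^esub> (r \<odot>\<^bsub>M\<^esub> y) = H +>\<^bsub>M\<^esub> (r \<odot>\<^bsub>M\<^esub> x)" if "y \<in> H +>\<^bsub>M\<^esub> x" for y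
  proof -
    from that obtain h where h: "h \<in> H" "y = h \<oplus>\<^bsub>M\<^esub> x" by (auto simp: a_r_coset_def')
    then have "r \<odot>\<^bsub>M\<^esub> y = r \<odot>\<^bsub>M\<^esub> h \<oplus>\<^bsub>M\<^esub> r \<odot>\<^bsub>M\<^esub> x"
      using assms(3,4) H.a_subset by (auto simp: M.smult_r_distr)
    moreover have "r \<odot>\<^bsub>M\<^esub> h \<in> H"
      using assms(2,4) h by (auto dest: submodule.smult_closed)
    ultimately have "r \<odot>\<^bsub>M\<^esub> y \<in> H +>\<^bsub>M\<^esub> (r \<odot>\<^bsub>M\<^esub> x)" by (auto simp: a_r_coset_def')
    from M.a_repr_independence[OF this M.smult_closed[OF assms(4,3)] H.a_subgroup]
    show ?thesis by simp
  qed
  then have "(\<Union>y\<in>H +>\<^bsub>M\<^esub> x. H +>\<^bsub>M\<^esub> (r \<odot>\<^bsub>M\<^esub> y)) = (\<Union>y\<in>H +>\<^bsub>M\<^esub> x. H +>\<^bsub>M\<^esub> (r \<odot>\<^bsub>M\<^esub> x))"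
    by (rule SUP_cong[OF refl])
  \<comment> \<open>The union of equal cosets is that coset only if its index set is
    inhabited.\<close>
  moreover have "x \<in> H +>\<^bsub>M\<^esub> x" by (rule H.a_rcos_self) fact
  ultimately show ?thesis by (auto simp: quotient_module_def)
qed

lemma quotient_module_module:
  assumes "module k M" "submodule H k M"
  shows "module k (quotient_module M H)"
proof -
  interpret M: module k M by fact
  interpret H: abelian_subgroup H M by (rule submodule_abelian_subgroup) fact+
  note add = quotient_module_add[OF assms] and smult = quotient_module_smult[OF assms]
  note c = quotient_module_carrier
  have zero: "\<zero>\<^bsub>quotient_module M H\<^esub> = H +>\<^bsub>M\<^esub> \<zero>\<^bsub>M\<^esub>"
    using H.a_subset by (simp add: quotient_module_def)
  show ?thesis
  proof (rule moduleI)
    show "abelian_group (quotient_module M H)"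
    proof (rule abelian_groupI)
      fix X assume "X \<in> carrier (quotient_module M H)"
      then obtain x where "x \<in> carrier M" "X = H +>\<^bsub>M\<^esub> x" by (auto simp: c)
      then show "\<exists>Y\<in>carrier (quotient_module M H).
          Y \<oplus>\<^bsub>quotient_module M H\<^esub> X = \<zero>\<^bsub>quotient_module M H\<^esub>"
        by (auto simp: c zero add M.l_neg intro!: bexI[of _ "\<ominus>\<^bsub>M\<^esub> x"])
    qed (auto simp: c zero add M.a_ac)
  qed (auto simp: c add smult M.smult_l_distr M.smult_r_distr M.smult_assoc1 intro: M.R.is_cring)
qed

section \<open>Tensor products\<close>

lemma tensor_kernel_submodule:
  assumes "module k M" "module k N"
  shows "submodule (tensor_kernel k M N) k (free_module k (carrier M \<times> carrier N))"
    and "tensor_relations k M N \<subseteq> tensor_kernel k M N"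
proof -
  interpret M: module k M by fact
  interpret N: module k N by fact
  interpret F: module k "free_module k (carrier M \<times> carrier N)"
    by (rule free_module_module) (rule M.R.is_cring)
  have "tensor_relations k M N \<subseteq> carrier (free_module k (carrier M \<times> carrier N))"
    unfolding tensor_relations_def Let_def
    by (auto intro!: free_gen_closed M.R.is_cring F.minus_closed F.a_closed F.smult_closed)
  from module_span_submodule[OF F.module_axioms this]
  show "submodule (tensor_kernel k M N) k (free_module k (carrier M \<times> carrier N))"
    and "tensor_relations k M N \<subseteq> tensor_kernel k M N"
    by (simp_all add: tensor_kernel_def)
qed

lemma tensor_module:
  assumes "module k M" "module k N"
  shows "module k (M \<Otimes>\<^bsub>k\<^esub> N)"
  unfolding tensor_def
  by (rule quotient_module_module[OF free_module_module tensor_kernel_submodule(1)])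
    (auto intro: assms module.axioms(1)[OF assms(1)])

lemma tensor_carrier:
  "carrier (M \<Otimes>\<^bsub>k\<^esub> N) =
    (\<lambda>u. tensor_kernel k M N +>\<^bsub>free_module k (carrier M \<times> carrier N)\<^esub> u) `
      carrier (free_module k (carrier M \<times> carrier N))"
  by (simp add: tensor_def quotient_module_carrier)

text \<open>Each of the four families of generating relations yields one of the four bilinearity
  laws, since two elements of the free module whose difference lies in the kernel have the same
  coset.\<close>

lemma tens_bilin:
  assumes "module k M" "module k N"
  shows "tens k M N \<in> bilin k M N (M \<Otimes>\<^bsub>k\<^esub> N)"
proof -
  interpret M: module k M by fact
  interpret N: module k N by fact
  let ?F = "free_module k (carrier M \<times> carrier N)" and ?K = "tensor_kernel k M N"
  interpret F: module k ?F by (rule free_module_module) (rule M.R.is_cring)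
  note K = tensor_kernel_submodule[OF assms]
  interpret K: abelian_subgroup ?K ?F by (rule submodule_abelian_subgroup[OF F.module_axioms K(1)])
  have e: "free_gen k (x, y) \<in> carrier ?F" if "x \<in> carrier M" "y \<in> carrier N" for x y
    using that by (intro free_gen_closed M.R.is_cring) auto
  have coset_eq: "?K +>\<^bsub>?F\<^esub> u = ?K +>\<^bsub>?F\<^esub> v"
    if "u \<ominus>\<^bsub>?F\<^esub> v \<in> tensor_relations k M N" "u \<in> carrier ?F" "v \<in> carrier ?F" for u v
  proof -
    have "u \<in> ?K +>\<^bsub>?F\<^esub> v"
      using that K(2) by (auto simp: K.a_rcos_module[OF that(3,2)] a_minus_def)
    from F.a_repr_independence[OF this that(3) K.a_subgroup] show ?thesis by simp
  qed
  have rel: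
    "x \<in> carrier M \<Longrightarrow> x' \<in> carrier M \<Longrightarrow> y \<in> carrier N \<Longrightarrow>
      free_gen k (x \<oplus>\<^bsub>M\<^esub> x', y) \<ominus>\<^bsub>?F\<^esub> (free_gen k (x, y) \<oplus>\<^bsub>?F\<^esub> free_gen k (x', y)) \<in> tensor_relations k M N"
    "x \<in> carrier M \<Longrightarrow> y \<in> carrier N \<Longrightarrow> y' \<in> carrier N \<Longrightarrow>
      free_gen k (x, y \<oplus>\<^bsub>N\<^esub> y') \<ominus>\<^bsub>?F\<^esub> (free_gen k (x, y) \<oplus>\<^bsub>?F\<^esub> free_gen k (x, y')) \<in> tensor_relations k M N"
    "r \<in> carrier k \<Longrightarrow> x \<in> carrier M \<Longrightarrow> y \<in> carrier N \<Longrightarrow>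
      free_gen k (r \<odot>\<^bsub>M\<^esub> x, y) \<ominus>\<^bsub>?F\<^esub> (r \<odot>\<^bsub>?F\<^esub> free_gen k (x, y)) \<in> tensor_relations k M N"
    "r \<in> carrier k \<Longrightarrow> x \<in> carrier M \<Longrightarrow> y \<in> carrier N \<Longrightarrow>
      free_gen k (x, r \<odot>\<^bsub>N\<^esub> y) \<ominus>\<^bsub>?F\<^esub> (r \<odot>\<^bsub>?F\<^esub> free_gen k (x, y)) \<in> tensor_relations k M N"
    for x x' y y' r
    unfolding tensor_relations_def Let_def by blast+
  note add = quotient_module_add[OF F.module_axioms K(1), folded tensor_def]
    and smult = quotient_module_smult[OF F.module_axioms K(1), folded tensor_def]
  show ?thesis
  proof (intro bilinI linI)
    fix x y assume x: "x \<in> carrier M" and y: "y \<in> carrier N"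
    from e[OF x y] show "tens k M N x y \<in> carrier (M \<Otimes>\<^bsub>k\<^esub> N)"
      and "tens k M N x y \<in> carrier (M \<Otimes>\<^bsub>k\<^esub> N)"
      by (auto simp: tens_def tensor_carrier)
    {
      fix x' assume x': "x' \<in> carrier M"
      with x y show "tens k M N (x \<oplus>\<^bsub>M\<^esub> x') y = tens k M N x y \<oplus>\<^bsub>M \<Otimes>\<^bsub>k\<^esub> N\<^esub> tens k M N x' y"
        using coset_eq[of "free_gen k (x \<oplus>\<^bsub>M\<^esub> x', y)"
            "free_gen k (x, y) \<oplus>\<^bsub>?F\<^esub> free_gen k (x', y)"]
        by (simp add: tens_def add e rel)
    }
    {
      fix y' assume y': "y' \<in> carrier N"
      with x y show "tens k M N x (y \<oplus>\<^bsub>N\<^esub> y') = tens k M N x y \<oplus>\<^bsub>M \<Otimes>\<^bsub>k\<^esub> N\<^esub> tens k M N x y'"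
        using coset_eq[of "free_gen k (x, y \<oplus>\<^bsub>N\<^esub> y')"
            "free_gen k (x, y) \<oplus>\<^bsub>?F\<^esub> free_gen k (x, y')"]
        by (simp add: tens_def add e rel)
    }
    fix r assume r: "r \<in> carrier k"
    with x y show "tens k M N (r \<odot>\<^bsub>M\<^esub> x) y = r \<odot>\<^bsub>M \<Otimes>\<^bsub>k\<^esub> N\<^esub> tens k M N x y"
      and "tens k M N x (r \<odot>\<^bsub>N\<^esub> y) = r \<odot>\<^bsub>M \<Otimes>\<^bsub>k\<^esub> N\<^esub> tens k M N x y"
      using coset_eq[of "free_gen k (r \<odot>\<^bsub>M\<^esub> x, y)" "r \<odot>\<^bsub>?F\<^esub> free_gen k (x, y)"]
        coset_eq[of "free_gen k (x, r \<odot>\<^bsub>N\<^esub> y)" "r \<odot>\<^bsub>?F\<^esub> free_gen k (x, y)"]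
      by (simp_all add: tens_def smult e rel)
  qed
qed

lemma tens_closed:
  "module k M \<Longrightarrow> module k N \<Longrightarrow> x \<in> carrier M \<Longrightarrow> y \<in> carrier N \<Longrightarrow>
    tens k M N x y \<in> carrier (M \<Otimes>\<^bsub>k\<^esub> N)"
  by (rule bilin_closed[OF tens_bilin])

text \<open>Pure tensors generate the tensor product already under addition: a scalar is absorbed
  into the left factor, and zero is 0 \<otimes> 0. This is why neither has a case of its
  own.\<close>

lemma tensor_induct [consumes 3, case_names tens add]:
  assumes "module k M" "module k N" "t \<in> carrier (M \<Otimes>\<^bsub>k\<^esub> N)"
    and tens: "\<And>x y. x \<in> carrier M \<Longrightarrow> y \<in> carrier N \<Longrightarrow> P (tens k M N x y)"
    and add: "\<And>s t. s \<in> carrier (M \<Otimes>\<^bsub>k\<^esub> N) \<Longrightarrow> t \<in> carrier (M \<Otimes>\<^bsub>k\<^esub> N) \<Longrightarrow> P s \<Longrightarrow> P t \<Longrightarrow>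
      P (s \<oplus>\<^bsub>M \<Otimes>\<^bsub>k\<^esub> N\<^esub> t)"
  shows "P t"
proof -
  interpret M: module k M by fact
  interpret N: module k N by fact
  let ?F = "free_module k (carrier M \<times> carrier N)" and ?K = "tensor_kernel k M N"
  interpret F: module k ?F by (rule free_module_module) (rule M.R.is_cring)
  note K = tensor_kernel_submodule[OF assms(1,2)]
  note qadd = quotient_module_add[OF F.module_axioms K(1), folded tensor_def]
    and qsmult = quotient_module_smult[OF F.module_axioms K(1), folded tensor_def]
  note b = linD[OF bilin_lin_l[OF tens_bilin[OF assms(1,2)]]]
  have P_gen: "P (?K +>\<^bsub>?F\<^esub> (r \<odot>\<^bsub>?F\<^esub> free_gen k (x, y)))"
    if "r \<in> carrier k" "x \<in> carrier M" "y \<in> carrier N" for r x y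
  proof -
    have "?K +>\<^bsub>?F\<^esub> (r \<odot>\<^bsub>?F\<^esub> free_gen k (x, y)) = tens k M N (r \<odot>\<^bsub>M\<^esub> x) y"
      using that b(3)[of y r x] by (simp add: tens_def qsmult free_gen_closed M.R.is_cring)
    then show ?thesis using that tens by simp
  qed
  from assms(3) obtain u where u: "u \<in> carrier ?F" "t = ?K +>\<^bsub>?F\<^esub> u"
    by (auto simp: tensor_carrier)
  have "P (?K +>\<^bsub>?F\<^esub> u)"
    using M.R.is_cring u(1)
  proof (induction u rule: free_module_induct)
    case (gen r i)
    then show ?case using P_gen[of r] by (cases i) auto
  next
    case (add u v)
    then show ?case
      using assms(5)[of "?K +>\<^bsub>?F\<^esub> u" "?K +>\<^bsub>?F\<^esub> v"] by (auto simp: qadd tensor_carrier)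
  next
    case zero
    have "\<zero>\<^bsub>k\<^esub> \<odot>\<^bsub>?F\<^esub> free_gen k (\<zero>\<^bsub>M\<^esub>, \<zero>\<^bsub>N\<^esub>) = \<zero>\<^bsub>?F\<^esub>"
      by (simp add: free_gen_closed M.R.is_cring)
    then show ?case using P_gen[of "\<zero>\<^bsub>k\<^esub>" "\<zero>\<^bsub>M\<^esub>" "\<zero>\<^bsub>N\<^esub>"] by simp
  qed
  then show ?thesis using u(2) by simp
qed

text \<open>The substitute for Sweedler notation. Whenever an argument is not visibly a sum of pure
  tensors, such as \<open>\<psi> (tens k C A c b)\<close> or \<open>\<Delta> c\<close>, both sides
  are first read as linear maps in that argument.\<close>

lemma lin_tensor_eqI:
  assumes "module k M" "module k N"
    and "f \<in> lin k (M \<Otimes>\<^bsub>k\<^esub> N) P" "g \<in> lin k (M \<Otimes>\<^bsub>k\<^esub> N) P"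
    and "\<And>x y. x \<in> carrier M \<Longrightarrow> y \<in> carrier N \<Longrightarrow> f (tens k M N x y) = g (tens k M N x y)"
    and "t \<in> carrier (M \<Otimes>\<^bsub>k\<^esub> N)"
  shows "f t = g t"
  using assms(1,2,6)
  by (induction t rule: tensor_induct) (simp_all add: assms(5) lin_add[OF assms(3)] lin_add[OF assms(4)])

text \<open>The representative selected by \<open>SOME\<close> differs from \<open>u\<close> by an
  element of \<open>tensor_kernel\<close>. A bilinear map sends the generating relations to zero,
  and the kernel of its free lift is a submodule, so it contains their span and the difference does
  not change the value.\<close>

lemma tlift_coset:
  assumes "module k M" "module k N" "module k P" "f \<in> bilin k M N P"
    and "u \<in> carrier (free_module k (carrier M \<times> carrier N))"
  shows "tlift k P f (tensor_kernel k M N +>\<^bsub>free_module k (carrier M \<times> carrier N)\<^esub> u) =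
    free_lift k P (\<lambda>z. f (fst z) (snd z)) u"
proof -
  interpret M: module k M by fact
  interpret N: module k N by fact
  interpret P: module k P by fact
  let ?F = "free_module k (carrier M \<times> carrier N)" and ?K = "tensor_kernel k M N"
  interpret F: module k ?F by (rule free_module_module) (rule M.R.is_cring)
  note K = tensor_kernel_submodule[OF assms(1,2)]
  interpret K: abelian_subgroup ?K ?F by (rule submodule_abelian_subgroup[OF F.module_axioms K(1)])
  define h where "h = (\<lambda>z. f (fst z) (snd z))"
  have h: "h \<in> carrier M \<times> carrier N \<rightarrow> carrier P"
    using bilin_closed[OF assms(4)] by (auto simp: h_def)
  note L = free_lift_lin[OF assms(3) h]
  have e: "free_gen k (x, y) \<in> carrier ?F" if "x \<in> carrier M" "y \<in> carrier N" for x y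
    using that by (intro free_gen_closed M.R.is_cring) auto
  have Le: "free_lift k P h (free_gen k (x, y)) = f x y"
    if "x \<in> carrier M" "y \<in> carrier N" for x y
    using free_lift_gen[OF assms(3) h, of "(x, y)"] that by (simp add: h_def)
  note simps = lin_minus[OF F.module_axioms assms(3) L] linD[OF L] e Le
    linD[OF bilin_lin_l[OF assms(4)]] linD[OF bilin_lin_r[OF assms(4)]] P.r_neg a_minus_def[of P]
  have "tensor_relations k M N \<subseteq> {u \<in> carrier ?F. free_lift k P h u = \<zero>\<^bsub>P\<^esub>}"
    unfolding tensor_relations_def Let_def by (auto simp: simps)
  then have ker: "?K \<subseteq> {u \<in> carrier ?F. free_lift k P h u = \<zero>\<^bsub>P\<^esub>}"
    unfolding tensor_kernel_def
    by (rule module_span_minimal[OF submodule_kernel[OF F.module_axioms assms(3) L]])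
  define v where "v = (SOME v. v \<in> ?K +>\<^bsub>?F\<^esub> u)"
  have "v \<in> ?K +>\<^bsub>?F\<^esub> u"
    unfolding v_def by (rule someI[of _ u]) (rule K.a_rcos_self[OF assms(5)])
  then obtain w where w: "w \<in> ?K" "v = w \<oplus>\<^bsub>?F\<^esub> u" by (auto simp: a_r_coset_def')
  then have "free_lift k P h v = free_lift k P h u"
    using ker assms(5) by (auto simp: linD[OF L])
  then show ?thesis
    by (simp add: tlift_def v_def[symmetric] Let_def free_lift_def h_def)
qed

lemma tlift_tens:
  assumes "module k M" "module k N" "module k P" "f \<in> bilin k M N P"
    and "x \<in> carrier M" "y \<in> carrier N"
  shows "tlift k P f (tens k M N x y) = f x y"
proof -
  interpret M: module k M by fact
  have h: "(\<lambda>z. f (fst z) (snd z)) \<in> carrier M \<times> carrier N \<rightarrow> carrier P"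
    using bilin_closed[OF assms(4)] by auto
  have xy: "(x, y) \<in> carrier M \<times> carrier N" using assms(5,6) by simp
  show ?thesis
    unfolding tens_def tlift_coset[OF assms(1-4) free_gen_closed[OF M.R.is_cring xy]]
    using free_lift_gen[OF assms(3) h xy] by simp
qed

lemma tlift_lin:
  assumes "module k M" "module k N" "module k P" "f \<in> bilin k M N P"
  shows "tlift k P f \<in> lin k (M \<Otimes>\<^bsub>k\<^esub> N) P"
proof -
  interpret M: module k M by fact
  let ?F = "free_module k (carrier M \<times> carrier N)"
  interpret F: module k ?F by (rule free_module_module) (rule M.R.is_cring)
  note K = tensor_kernel_submodule[OF assms(1,2)]
  note qadd = quotient_module_add[OF F.module_axioms K(1), folded tensor_def]
    and qsmult = quotient_module_smult[OF F.module_axioms K(1), folded tensor_def]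
  have h: "(\<lambda>z. f (fst z) (snd z)) \<in> carrier M \<times> carrier N \<rightarrow> carrier P"
    using bilin_closed[OF assms(4)] by auto
  show ?thesis
    by (rule linI)
      (auto simp: tensor_carrier qadd qsmult tlift_coset[OF assms] linD[OF free_lift_lin[OF assms(3) h]])
qed

text \<open>Needed for nested lifts: while the inner tensor factors are being lifted, the outer
  variable is a parameter, and the outer lift then requires linearity in it. On pure tensors this is
  an assumption, and it is preserved by addition.\<close>

lemma tlift_lin_param:
  assumes "module k M" "module k N" "module k P" "module k Q"
    and "\<And>z. z \<in> carrier Q \<Longrightarrow> f z \<in> bilin k M N P"
    and "\<And>x y. x \<in> carrier M \<Longrightarrow> y \<in> carrier N \<Longrightarrow> (\<lambda>z. f z x y) \<in> lin k Q P"
    and "t \<in> carrier (M \<Otimes>\<^bsub>k\<^esub> N)"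
  shows "(\<lambda>z. tlift k P (f z) t) \<in> lin k Q P"
  using assms(1,2,7)
proof (induction t rule: tensor_induct)
  case (tens x y)
  then have "tlift k P (f z) (tens k M N x y) = f z x y" if "z \<in> carrier Q" for z
    using that tlift_tens[OF assms(1-3) assms(5)] by blast
  then show ?case
    using lin_cong[OF assms(4), of "\<lambda>z. tlift k P (f z) (tens k M N x y)" "\<lambda>z. f z x y"]
      assms(6)[OF tens] by blast
next
  case (add s t)
  interpret P: module k P by fact
  interpret Q: module k Q by fact
  note l = linD[OF tlift_lin[OF assms(1-3) assms(5)]]
  note 1 = linD[OF add(3)] and 2 = linD[OF add(4)]
  show ?case
    using add(1,2) by (intro linI) (auto simp: l 1 2 P.a_ac P.smult_r_distr)
qed

section \<open>Functoriality, associativity and unit of the tensor product\<close>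

lemma bilin_comp:
  assumes "f \<in> bilin k P Q R" "g \<in> lin k M P" "h \<in> lin k N Q"
  shows "(\<lambda>x y. f (g x) (h y)) \<in> bilin k M N R"
  using linD[OF assms(2)] linD[OF assms(3)] linD[OF bilin_lin_l[OF assms(1)]]
    linD[OF bilin_lin_r[OF assms(1)]]
  by (auto intro!: bilinI linI)

lemma lin_bilin_comp:
  assumes "f \<in> bilin k M N P" "g \<in> lin k P Q"
  shows "(\<lambda>x y. g (f x y)) \<in> bilin k M N Q"
  using lin_comp[OF bilin_lin_l[OF assms(1)] assms(2)] lin_comp[OF bilin_lin_r[OF assms(1)] assms(2)]
  by (auto intro!: bilinI)

lemma tmap:
  assumes "module k M" "module k N" "module k P" "module k Q"
    and "f \<in> lin k M P" "g \<in> lin k N Q"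
  shows tmap_lin: "tmap k P Q f g \<in> lin k (M \<Otimes>\<^bsub>k\<^esub> N) (P \<Otimes>\<^bsub>k\<^esub> Q)"
    and tmap_tens: "x \<in> carrier M \<Longrightarrow> y \<in> carrier N \<Longrightarrow>
      tmap k P Q f g (tens k M N x y) = tens k P Q (f x) (g y)"
proof -
  note b = bilin_comp[OF tens_bilin[OF assms(3,4)] assms(5,6)]
  note m = tensor_module[OF assms(3,4)]
  show "tmap k P Q f g \<in> lin k (M \<Otimes>\<^bsub>k\<^esub> N) (P \<Otimes>\<^bsub>k\<^esub> Q)"
    unfolding tmap_def by (rule tlift_lin[OF assms(1,2) m b])
  show "x \<in> carrier M \<Longrightarrow> y \<in> carrier N \<Longrightarrow>
      tmap k P Q f g (tens k M N x y) = tens k P Q (f x) (g y)"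
    unfolding tmap_def by (rule tlift_tens[OF assms(1,2) m b])
qed

lemma tassoc:
  assumes "module k M" "module k N" "module k P"
  shows tassoc_lin: "tassoc k M N P \<in> lin k ((M \<Otimes>\<^bsub>k\<^esub> N) \<Otimes>\<^bsub>k\<^esub> P) (M \<Otimes>\<^bsub>k\<^esub> (N \<Otimes>\<^bsub>k\<^esub> P))"
    and tassoc_tens: "x \<in> carrier M \<Longrightarrow> y \<in> carrier N \<Longrightarrow> z \<in> carrier P \<Longrightarrow>
      tassoc k M N P (tens k (M \<Otimes>\<^bsub>k\<^esub> N) P (tens k M N x y) z) =
        tens k M (N \<Otimes>\<^bsub>k\<^esub> P) x (tens k N P y z)"
proof -
  note NP = tensor_module[OF assms(2,3)]
  note MN = tensor_module[OF assms(1,2)]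
  note T = tensor_module[OF assms(1) NP]
  note bNP = tens_bilin[OF assms(2,3)] and bT = tens_bilin[OF assms(1) NP]
  \<comment> \<open>The third variable comes first because it is the parameter of the inner lift
    over M \<otimes> N.\<close>
  define F where "F = (\<lambda>z x y. tens k M (N \<Otimes>\<^bsub>k\<^esub> P) x (tens k N P y z))"
  have F: "F z \<in> bilin k M N (M \<Otimes>\<^bsub>k\<^esub> (N \<Otimes>\<^bsub>k\<^esub> P))" if "z \<in> carrier P" for z
    unfolding F_def by (rule bilin_comp[OF bT _ bilin_lin_l[OF bNP that], of "\<lambda>x. x"])
      (auto intro: linI)
  have Fz: "(\<lambda>z. F z x y) \<in> lin k P (M \<Otimes>\<^bsub>k\<^esub> (N \<Otimes>\<^bsub>k\<^esub> P))"
    if "x \<in> carrier M" "y \<in> carrier N" for x y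
    unfolding F_def by (rule lin_comp[OF bilin_lin_r[OF bNP that(2)] bilin_lin_r[OF bT that(1)]])
  have b: "(\<lambda>s z. tlift k (M \<Otimes>\<^bsub>k\<^esub> (N \<Otimes>\<^bsub>k\<^esub> P)) (F z) s) \<in>
      bilin k (M \<Otimes>\<^bsub>k\<^esub> N) P (M \<Otimes>\<^bsub>k\<^esub> (N \<Otimes>\<^bsub>k\<^esub> P))"
  proof (rule bilinI)
    fix s assume "s \<in> carrier (M \<Otimes>\<^bsub>k\<^esub> N)"
    then show "(\<lambda>z. tlift k (M \<Otimes>\<^bsub>k\<^esub> (N \<Otimes>\<^bsub>k\<^esub> P)) (F z) s) \<in> lin k P (M \<Otimes>\<^bsub>k\<^esub> (N \<Otimes>\<^bsub>k\<^esub> P))"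
      by (intro tlift_lin_param[OF assms(1,2) T assms(3)] F Fz)
  next
    fix z assume "z \<in> carrier P"
    then show "tlift k (M \<Otimes>\<^bsub>k\<^esub> (N \<Otimes>\<^bsub>k\<^esub> P)) (F z) \<in> lin k (M \<Otimes>\<^bsub>k\<^esub> N) (M \<Otimes>\<^bsub>k\<^esub> (N \<Otimes>\<^bsub>k\<^esub> P))"
      by (intro tlift_lin[OF assms(1,2) T] F)
  qed
  have d: "tassoc k M N P =
      tlift k (M \<Otimes>\<^bsub>k\<^esub> (N \<Otimes>\<^bsub>k\<^esub> P)) (\<lambda>s z. tlift k (M \<Otimes>\<^bsub>k\<^esub> (N \<Otimes>\<^bsub>k\<^esub> P)) (F z) s)"
    by (simp add: tassoc_def F_def)
  show "tassoc k M N P \<in> lin k ((M \<Otimes>\<^bsub>k\<^esub> N) \<Otimes>\<^bsub>k\<^esub> P) (M \<Otimes>\<^bsub>k\<^esub> (N \<Otimes>\<^bsub>k\<^esub> P))"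
    unfolding d by (rule tlift_lin[OF MN assms(3) T b])
  show "tassoc k M N P (tens k (M \<Otimes>\<^bsub>k\<^esub> N) P (tens k M N x y) z) =
        tens k M (N \<Otimes>\<^bsub>k\<^esub> P) x (tens k N P y z)"
    if xyz: "x \<in> carrier M" "y \<in> carrier N" "z \<in> carrier P"
    unfolding d
    by (simp add: xyz tlift_tens[OF MN assms(3) T b] tens_closed[OF assms(1,2)]
        tlift_tens[OF assms(1,2) T F]) (simp add: F_def)
qed

lemma tassoc_inv:
  assumes "module k M" "module k N" "module k P"
  shows tassoc_inv_lin:
      "tassoc_inv k M N P \<in> lin k (M \<Otimes>\<^bsub>k\<^esub> (N \<Otimes>\<^bsub>k\<^esub> P)) ((M \<Otimes>\<^bsub>k\<^esub> N) \<Otimes>\<^bsub>k\<^esub> P)"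
    and tassoc_inv_tens: "x \<in> carrier M \<Longrightarrow> y \<in> carrier N \<Longrightarrow> z \<in> carrier P \<Longrightarrow>
      tassoc_inv k M N P (tens k M (N \<Otimes>\<^bsub>k\<^esub> P) x (tens k N P y z)) =
        tens k (M \<Otimes>\<^bsub>k\<^esub> N) P (tens k M N x y) z"
proof -
  note NP = tensor_module[OF assms(2,3)]
  note MN = tensor_module[OF assms(1,2)]
  note T = tensor_module[OF MN assms(3)]
  note bMN = tens_bilin[OF assms(1,2)] and bT = tens_bilin[OF MN assms(3)]
  \<comment> \<open>Here the inner lift runs over N \<otimes> P, so the parameter is
    \<open>x\<close>.\<close>
  define F where "F = (\<lambda>x y z. tens k (M \<Otimes>\<^bsub>k\<^esub> N) P (tens k M N x y) z)"
  have F: "F x \<in> bilin k N P ((M \<Otimes>\<^bsub>k\<^esub> N) \<Otimes>\<^bsub>k\<^esub> P)" if "x \<in> carrier M" for x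
    unfolding F_def by (rule bilin_comp[OF bT bilin_lin_r[OF bMN that], of "\<lambda>x. x"])
      (auto intro: linI)
  have Fx: "(\<lambda>x. F x y z) \<in> lin k M ((M \<Otimes>\<^bsub>k\<^esub> N) \<Otimes>\<^bsub>k\<^esub> P)"
    if "y \<in> carrier N" "z \<in> carrier P" for y z
    unfolding F_def by (rule lin_comp[OF bilin_lin_l[OF bMN that(1)] bilin_lin_l[OF bT that(2)]])
  have b: "(\<lambda>x s. tlift k ((M \<Otimes>\<^bsub>k\<^esub> N) \<Otimes>\<^bsub>k\<^esub> P) (F x) s) \<in>
      bilin k M (N \<Otimes>\<^bsub>k\<^esub> P) ((M \<Otimes>\<^bsub>k\<^esub> N) \<Otimes>\<^bsub>k\<^esub> P)"
  proof (rule bilinI)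
    fix s assume "s \<in> carrier (N \<Otimes>\<^bsub>k\<^esub> P)"
    then show "(\<lambda>x. tlift k ((M \<Otimes>\<^bsub>k\<^esub> N) \<Otimes>\<^bsub>k\<^esub> P) (F x) s) \<in> lin k M ((M \<Otimes>\<^bsub>k\<^esub> N) \<Otimes>\<^bsub>k\<^esub> P)"
      by (intro tlift_lin_param[OF assms(2,3) T assms(1)] F Fx)
  next
    fix x assume "x \<in> carrier M"
    then show "(\<lambda>s. tlift k ((M \<Otimes>\<^bsub>k\<^esub> N) \<Otimes>\<^bsub>k\<^esub> P) (F x) s) \<in>
        lin k (N \<Otimes>\<^bsub>k\<^esub> P) ((M \<Otimes>\<^bsub>k\<^esub> N) \<Otimes>\<^bsub>k\<^esub> P)"
      by (intro tlift_lin[OF assms(2,3) T] F)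
  qed
  have d: "tassoc_inv k M N P =
      tlift k ((M \<Otimes>\<^bsub>k\<^esub> N) \<Otimes>\<^bsub>k\<^esub> P) (\<lambda>x s. tlift k ((M \<Otimes>\<^bsub>k\<^esub> N) \<Otimes>\<^bsub>k\<^esub> P) (F x) s)"
    by (simp add: tassoc_inv_def F_def)
  show "tassoc_inv k M N P \<in> lin k (M \<Otimes>\<^bsub>k\<^esub> (N \<Otimes>\<^bsub>k\<^esub> P)) ((M \<Otimes>\<^bsub>k\<^esub> N) \<Otimes>\<^bsub>k\<^esub> P)"
    unfolding d by (rule tlift_lin[OF assms(1) NP T b])
  show "tassoc_inv k M N P (tens k M (N \<Otimes>\<^bsub>k\<^esub> P) x (tens k N P y z)) =
        tens k (M \<Otimes>\<^bsub>k\<^esub> N) P (tens k M N x y) z"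
    if xyz: "x \<in> carrier M" "y \<in> carrier N" "z \<in> carrier P"
    unfolding d
    by (simp add: xyz tlift_tens[OF assms(1) NP T b] tens_closed[OF assms(2,3)]
        tlift_tens[OF assms(2,3) T F]) (simp add: F_def)
qed

lemma tunit_r:
  assumes "module k M"
  shows tunit_r_lin: "tunit_r k M \<in> lin k (M \<Otimes>\<^bsub>k\<^esub> self_module k) M"
    and tunit_r_tens: "x \<in> carrier M \<Longrightarrow> r \<in> carrier k \<Longrightarrow>
      tunit_r k M (tens k M (self_module k) x r) = r \<odot>\<^bsub>M\<^esub> x"
proof -
  interpret M: module k M by fact
  note s = self_module_module[OF M.R.is_cring]
  show "tunit_r k M \<in> lin k (M \<Otimes>\<^bsub>k\<^esub> self_module k) M"
    unfolding tunit_r_def by (rule tlift_lin[OF assms s assms bilin_smult(2)[OF assms]])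
  show "x \<in> carrier M \<Longrightarrow> r \<in> carrier k \<Longrightarrow>
      tunit_r k M (tens k M (self_module k) x r) = r \<odot>\<^bsub>M\<^esub> x"
    unfolding tunit_r_def by (rule tlift_tens[OF assms s assms bilin_smult(2)[OF assms]])
      (auto simp: self_module_def)
qed

section \<open>Dual bases\<close>

text \<open>Projectivity embeds M as a summand of a free module whose basis \<open>I\<close> may be
  infinite. The finitely many generators of M involve only a finite set \<open>J\<close> of
  coordinates, and then so does every element. The dual basis consists of the images under
  \<open>p\<close> of the basis vectors in \<open>J\<close>, together with the coordinate functions
  of \<open>i\<close>.\<close>

lemma dual_basis_exists:
  fixes M :: "('k, 'm, 'x) module_scheme"
  assumes "module k M" "finitely_generated k M" "projective k M"
  obtains n a a' where "dual_basis k M n a a'"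
proof -
  interpret M: module k M by fact
  from assms(2) obtain S where S: "finite S" "S \<subseteq> carrier M" "module_span k M S = carrier M"
    by (auto simp: finitely_generated_def)
  from assms(3) obtain I :: "'m set" and i p where i: "i \<in> lin k M (free_module k I)"
    and p: "p \<in> lin k (free_module k I) M" and pi: "\<And>x. x \<in> carrier M \<Longrightarrow> p (i x) = x"
    by (auto simp: projective_def)
  interpret F: module k "free_module k I" by (rule free_module_module) (rule M.R.is_cring)
  note FD = free_module_carrierD[OF lin_closed[OF i]]
  have ops: "u \<oplus>\<^bsub>free_module k I\<^esub> v = (\<lambda>i. u i \<oplus>\<^bsub>k\<^esub> v i)"
    "r \<odot>\<^bsub>free_module k I\<^esub> u = (\<lambda>i. r \<otimes>\<^bsub>k\<^esub> u i)" "\<zero>\<^bsub>free_module k I\<^esub> = (\<lambda>i. \<zero>\<^bsub>k\<^esub>)" for u v r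
    by (simp_all add: free_module_def)
  define J where "J = (\<Union>x\<in>S. {j. i x j \<noteq> \<zero>\<^bsub>k\<^esub>})"
  have J: "finite J" "J \<subseteq> I"
    using S(1,2) FD(2,3) by (auto simp: J_def)
  let ?H = "{x \<in> carrier M. \<forall>j. j \<notin> J \<longrightarrow> i x j = \<zero>\<^bsub>k\<^esub>}"
  \<comment> \<open>The elements with coordinates in \<open>J\<close> form a submodule containing
    the generators, hence all of M.\<close>
  have "submodule ?H k M"
  proof (rule M.submoduleI)
    fix x assume x: "x \<in> ?H"
    have "\<ominus>\<^bsub>M\<^esub> x = (\<ominus>\<^bsub>k\<^esub> \<one>\<^bsub>k\<^esub>) \<odot>\<^bsub>M\<^esub> x" using x by (simp add: M.smult_l_minus)
    then show "\<ominus>\<^bsub>M\<^esub> x \<in> ?H" using x by (auto simp: lin_smult[OF i] ops)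
  qed (auto simp: lin_zero[OF assms(1) F.module_axioms i] linD[OF i] ops)
  then have "module_span k M S \<subseteq> ?H"
    using S(2) by (rule_tac module_span_minimal) (auto simp: J_def)
  then have supp: "{j. i x j \<noteq> \<zero>\<^bsub>k\<^esub>} \<subseteq> J" if "x \<in> carrier M" for x
    using that S(3) by auto
  \<comment> \<open>\<open>dual_basis\<close> is indexed by an initial segment of the naturals, so
    \<open>J\<close> is enumerated.\<close>
  obtain e where e: "bij_betw e {..<card J} J"
    using ex_bij_betw_nat_finite[OF J(1)] by (auto simp: atLeast0LessThan)
  define a where "a = (\<lambda>m. p (free_gen k (e m)))"
  define a' where "a' = (\<lambda>m. \<lambda>x\<in>carrier M. i x (e m))"
  have gc: "free_gen k j \<in> carrier (free_module k I)" if "j \<in> J" for j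
    using that J(2) by (intro free_gen_closed M.R.is_cring) auto
  have eJ: "e m \<in> J" if "m < card J" for m using e that by (auto dest: bij_betwE)
  have "dual_basis k M (card J) a a'"
    unfolding dual_basis_def
  proof (intro conjI allI impI ballI)
    fix m assume m: "m < card J"
    show "a m \<in> carrier M" unfolding a_def by (rule lin_closed[OF p gc[OF eJ[OF m]]])
    have "(\<lambda>x. i x (e m)) \<in> lin k M (self_module k)"
      by (rule linI) (auto simp: self_module_def linD[OF i] ops FD)
    then show "a' m \<in> carrier (dual k M)"
      unfolding a'_def
      by (simp add: dual_def lin_cong[OF assms(1), of "restrict _ (carrier M)" "\<lambda>x. i x (e m)"])
  next
    fix x assume x: "x \<in> carrier M"
    let ?g = "\<lambda>j. i x j \<odot>\<^bsub>free_module k I\<^esub> free_gen k j"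
    have g: "?g \<in> J \<rightarrow> carrier (free_module k I)" using gc FD(1)[OF x] by auto
    have "i x = (\<Oplus>\<^bsub>free_module k I\<^esub>j\<in>J. ?g j)"
    proof -
      \<comment> \<open>Partial sums of the expansion of \<open>i x\<close> in basis vectors; for
        \<open>K = J\<close> nothing of \<open>i x\<close> is cut off, by
        \<open>supp\<close>.\<close>
      have "(\<Oplus>\<^bsub>free_module k I\<^esub>j\<in>K. ?g j) = (\<lambda>j. if j \<in> K then i x j else \<zero>\<^bsub>k\<^esub>)"
        if "finite K" "K \<subseteq> J" for K
        using that
      proof (induction K rule: finite_induct)
        case empty
        show ?case by (simp add: ops)
      next
        case (insert j K)
        then have "?g \<in> K \<rightarrow> carrier (free_module k I)" "?g j \<in> carrier (free_module k I)"
          using g by auto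
        then show ?case
          using insert FD(1)[OF x] by (auto simp: ops free_gen_def)
      qed
      from this[OF J(1)] show ?thesis using supp[OF x] by (auto simp: fun_eq_iff)
    qed
    then have "x = p (\<Oplus>\<^bsub>free_module k I\<^esub>j\<in>J. ?g j)" using pi[OF x] by simp
    also have "\<dots> = (\<Oplus>\<^bsub>M\<^esub>j\<in>J. p (?g j))"
      by (rule lin_finsum[OF F.module_axioms assms(1) p J(1) g])
    also have "\<dots> = (\<Oplus>\<^bsub>M\<^esub>j\<in>e ` {..<card J}. p (?g j))"
      using bij_betw_imp_surj_on[OF e] by simp
    also have "\<dots> = (\<Oplus>\<^bsub>M\<^esub>m\<in>{..<card J}. p (?g (e m)))"
      using g lin_closed[OF p] eJ bij_betw_imp_inj_on[OF e] by (intro M.finsum_reindex) auto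
    also have "\<dots> = (\<Oplus>\<^bsub>M\<^esub>m\<in>{..<card J}. a' m x \<odot>\<^bsub>M\<^esub> a m)"
      using x gc[OF eJ] FD(1)[OF x] linD[OF p]
      by (intro M.finsum_cong') (auto simp: a_def a'_def)
    finally show "x = (\<Oplus>\<^bsub>M\<^esub>m\<in>{..<card J}. a' m x \<odot>\<^bsub>M\<^esub> a m)" .
  qed
  then show ?thesis by (rule that)
qed

text \<open>Existence makes the choice inside \<open>coev\<close> meaningful. The later formulas
  work with the very triple that \<open>coev\<close> selects.\<close>

lemma coev_dual_basis:
  assumes "module k A" "finitely_generated k A" "projective k A"
    and "(SOME (n, a, a'). dual_basis k A n a a') = (n, a, a')"
  shows "dual_basis k A n a a'"
proof -
  obtain m b b' where "dual_basis k A m b b'" by (rule dual_basis_exists[OF assms(1-3)])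
  then have "\<exists>x. case x of (n, a, a') \<Rightarrow> dual_basis k A n a a'" by auto
  from someI_ex[OF this] show ?thesis unfolding assms(4) by simp
qed

text \<open>Under the identification of V with k \<otimes> V the scalar is 1, so \<open>coev\<close>
  contributes exactly the sum of the tensors of dual basis pairs. Attaching \<open>v\<close> and
  reassociating is linear in that sum and passes to its terms.\<close>

lemma coev_tensor_sum:
  assumes "module k A" "finitely_generated k A" "projective k A"
    and naa: "(SOME (n, a, a'). dual_basis k A n a a') = (n, a, a')"
    and V: "module k V" and v: "v \<in> carrier V"
  shows "coev_tensor k A V v = (\<Oplus>\<^bsub>A \<Otimes>\<^bsub>k\<^esub> (dual k A \<Otimes>\<^bsub>k\<^esub> V)\<^esub>i\<in>{..<n}.
      tens k A (dual k A \<Otimes>\<^bsub>k\<^esub> V) (a i) (tens k (dual k A) V (a' i) v))"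
proof -
  interpret A: module k A by fact
  note s = self_module_module[OF A.R.is_cring]
  note D = dual_module[OF assms(1)]
  note AD = tensor_module[OF assms(1) D]
  interpret AD: module k "A \<Otimes>\<^bsub>k\<^esub> dual k A" by (rule AD)
  have carrier_self: "carrier (self_module k) = carrier k" by (simp add: self_module_def)
  have a: "a i \<in> carrier A" "a' i \<in> carrier (dual k A)" if "i < n" for i
    using coev_dual_basis[OF assms(1-4)] that by (auto simp: dual_basis_def)
  define S where "S = (\<Oplus>\<^bsub>A \<Otimes>\<^bsub>k\<^esub> dual k A\<^esub>i\<in>{..<n}. tens k A (dual k A) (a i) (a' i))"
  have t: "(\<lambda>i. tens k A (dual k A) (a i) (a' i)) \<in> {..<n} \<rightarrow> carrier (A \<Otimes>\<^bsub>k\<^esub> dual k A)"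
    using a by (auto intro!: tens_closed assms(1) D)
  then have S: "S \<in> carrier (A \<Otimes>\<^bsub>k\<^esub> dual k A)" unfolding S_def by (rule AD.finsum_closed)
  have coev: "coev k A = (\<lambda>r. r \<odot>\<^bsub>A \<Otimes>\<^bsub>k\<^esub> dual k A\<^esub> S)"
    by (rule ext) (simp add: coev_def naa S_def)
  have cl: "coev k A \<in> lin k (self_module k) (A \<Otimes>\<^bsub>k\<^esub> dual k A)"
    unfolding coev by (rule bilin_lin_l[OF bilin_smult(1)[OF AD] S])
  note DV = tensor_module[OF D V] and ADV = tensor_module[OF AD V]
  note T = tensor_module[OF assms(1) DV]
  interpret T: module k "A \<Otimes>\<^bsub>k\<^esub> (dual k A \<Otimes>\<^bsub>k\<^esub> V)" by (rule T)
  let ?f = "\<lambda>s. tassoc k A (dual k A) V (tens k (A \<Otimes>\<^bsub>k\<^esub> dual k A) V s v)"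
  have f: "?f \<in> lin k (A \<Otimes>\<^bsub>k\<^esub> dual k A) (A \<Otimes>\<^bsub>k\<^esub> (dual k A \<Otimes>\<^bsub>k\<^esub> V))"
    by (rule lin_comp[OF bilin_lin_l[OF tens_bilin[OF AD V] v] tassoc_lin[OF assms(1) D V]])
  have "coev_tensor k A V v = ?f S"
    using S v tmap_tens[OF s V AD V cl lin_id, of "\<one>\<^bsub>k\<^esub>" v]
    by (simp add: coev_tensor_def tunit_l_inv_def carrier_self coev)
  also have "\<dots> = (\<Oplus>\<^bsub>A \<Otimes>\<^bsub>k\<^esub> (dual k A \<Otimes>\<^bsub>k\<^esub> V)\<^esub>i\<in>{..<n}. ?f (tens k A (dual k A) (a i) (a' i)))"
    unfolding S_def by (rule lin_finsum[OF AD T f finite_lessThan t])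
  also have "\<dots> = (\<Oplus>\<^bsub>A \<Otimes>\<^bsub>k\<^esub> (dual k A \<Otimes>\<^bsub>k\<^esub> V)\<^esub>i\<in>{..<n}.
      tens k A (dual k A \<Otimes>\<^bsub>k\<^esub> V) (a i) (tens k (dual k A) V (a' i) v))"
    using a v by (intro T.finsum_cong')
      (auto simp: tassoc_tens[OF assms(1) D V] intro!: tens_closed assms(1) D V DV)
  finally show ?thesis .
qed

text \<open>The form in which the cointegral conditions are evaluated: everything that follows
  \<open>coev_tensor\<close> in a composite is collected in one linear map \<open>F\<close>, and
  only its values on dual basis terms remain to be computed.\<close>

lemma lin_coev_tensor_sum:
  assumes "module k A" "finitely_generated k A" "projective k A"
    and naa: "(SOME (n, a, a'). dual_basis k A n a a') = (n, a, a')"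
    and V: "module k V" and v: "v \<in> carrier V"
    and P: "module k P" and F: "F \<in> lin k (A \<Otimes>\<^bsub>k\<^esub> (dual k A \<Otimes>\<^bsub>k\<^esub> V)) P"
  shows "F (coev_tensor k A V v) = (\<Oplus>\<^bsub>P\<^esub>i\<in>{..<n}.
      F (tens k A (dual k A \<Otimes>\<^bsub>k\<^esub> V) (a i) (tens k (dual k A) V (a' i) v)))"
proof -
  note D = dual_module[OF assms(1)]
  note DV = tensor_module[OF D V]
  note T = tensor_module[OF assms(1) DV]
  have "a i \<in> carrier A" "a' i \<in> carrier (dual k A)" if "i < n" for i
    using coev_dual_basis[OF assms(1-4)] that by (auto simp: dual_basis_def)
  then show ?thesis
    unfolding coev_tensor_sum[OF assms(1-4) V v]
    by (intro lin_finsum[OF T P F]) (auto intro!: tens_closed assms(1) D V DV v)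
qed

lemma coev_tensor_lin:
  assumes "module k A" "finitely_generated k A" "projective k A" and V: "module k V"
  shows "coev_tensor k A V \<in> lin k V (A \<Otimes>\<^bsub>k\<^esub> (dual k A \<Otimes>\<^bsub>k\<^esub> V))"
proof -
  note D = dual_module[OF assms(1)]
  note DV = tensor_module[OF D V]
  obtain n a a' where naa: "(SOME (n, a, a'). dual_basis k A n a a') = (n, a, a')"
    by (metis prod_cases3)
  let ?s = "\<lambda>v. \<Oplus>\<^bsub>A \<Otimes>\<^bsub>k\<^esub> (dual k A \<Otimes>\<^bsub>k\<^esub> V)\<^esub>i\<in>{..<n}.
      tens k A (dual k A \<Otimes>\<^bsub>k\<^esub> V) (a i) (tens k (dual k A) V (a' i) v)"
  have "a i \<in> carrier A" "a' i \<in> carrier (dual k A)" if "i < n" for i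
    using coev_dual_basis[OF assms(1-3) naa] that by (auto simp: dual_basis_def)
  then have "?s \<in> lin k V (A \<Otimes>\<^bsub>k\<^esub> (dual k A \<Otimes>\<^bsub>k\<^esub> V))"
    by (intro lin_finsum_fun tensor_module assms(1) D V)
      (auto intro!: lin_comp[OF bilin_lin_r[OF tens_bilin[OF D V]] bilin_lin_r[OF tens_bilin[OF assms(1) DV]]])
  then show ?thesis
    using lin_cong[OF V, of "coev_tensor k A V" "?s"] coev_tensor_sum[OF assms(1-3) naa V]
    by blast
qed

section \<open>Cointegral maps in terms of a dual basis\<close>

lemma bilin_finsum:
  assumes "module k M" "module k N" "module k P" "finite S"
    and "\<And>i. i \<in> S \<Longrightarrow> f i \<in> bilin k M N P"
  shows "(\<lambda>x y. \<Oplus>\<^bsub>P\<^esub>i\<in>S. f i x y) \<in> bilin k M N P"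
  using assms by (intro bilinI lin_finsum_fun) (auto dest: bilin_lin_l bilin_lin_r)

text \<open>The intended family is \<open>h i c = \<phi> (a\<^sub>i\<^sup>* \<otimes> c)\<close> for a dual basis \<open>a\<^sub>i, a\<^sub>i\<^sup>*\<close>, but averaging
  uses only these three properties of \<open>\<Sum>\<^sub>i a i \<otimes> h i c\<close>.\<close>
locale cointegral_family = entwining_structure k A C \<Delta> \<epsilon> \<psi>
  for k :: "('k, 'r) ring_scheme" and A :: "('k, 'a, 'x) module_scheme"
    and C :: "('k, 'c, 'y) module_scheme" and \<Delta> \<epsilon> \<psi> +
  fixes n :: nat and a :: "nat \<Rightarrow> 'a" and h :: "nat \<Rightarrow> 'c \<Rightarrow> 'a"
  assumes family_closed: "i < n \<Longrightarrow> a i \<in> carrier A"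
    and family_lin: "i < n \<Longrightarrow> h i \<in> lin k C A"
    and family_colinear: "c \<in> carrier C \<Longrightarrow>
      tlift k (A \<Otimes>\<^bsub>k\<^esub> (A \<Otimes>\<^bsub>k\<^esub> C)) (\<lambda>d e. \<Oplus>\<^bsub>A \<Otimes>\<^bsub>k\<^esub> (A \<Otimes>\<^bsub>k\<^esub> C)\<^esub>i\<in>{..<n}.
        tmap k A (A \<Otimes>\<^bsub>k\<^esub> C) id \<psi> (tassoc k A C A
          (tens k (A \<Otimes>\<^bsub>k\<^esub> C) A (\<psi> (tens k C A d (a i))) (h i e)))) (\<Delta> c) =
      (\<Oplus>\<^bsub>A \<Otimes>\<^bsub>k\<^esub> (A \<Otimes>\<^bsub>k\<^esub> C)\<^esub>i\<in>{..<n}. tens k A (A \<Otimes>\<^bsub>k\<^esub> C) (a i) (tmap k A C (h i) id (\<Delta> c)))"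
    and family_linear: "c \<in> carrier C \<Longrightarrow> b \<in> carrier A \<Longrightarrow>
      (\<Oplus>\<^bsub>A \<Otimes>\<^bsub>k\<^esub> A\<^esub>i\<in>{..<n}. tens k A A (a i) (h i c \<otimes>\<^bsub>A\<^esub> b)) =
      tlift k (A \<Otimes>\<^bsub>k\<^esub> A) (\<lambda>p d. \<Oplus>\<^bsub>A \<Otimes>\<^bsub>k\<^esub> A\<^esub>i\<in>{..<n}. tens k A A (p \<otimes>\<^bsub>A\<^esub> a i) (h i d))
        (\<psi> (tens k C A c b))"
    and family_normalised: "c \<in> carrier C \<Longrightarrow>
      (\<Oplus>\<^bsub>A\<^esub>i\<in>{..<n}. a i \<otimes>\<^bsub>A\<^esub> h i c) = \<epsilon> c \<odot>\<^bsub>A\<^esub> \<one>\<^bsub>A\<^esub>"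

lemma product_bilin:
  assumes "unital_algebra k A"
  shows "mult A \<in> bilin k A A A"
proof -
  interpret unital_algebra k A by fact
  show ?thesis
    by (intro bilinI linI) (simp_all add: smult_mult_l smult_mult_r l_distr r_distr)
qed

lemma product_map:
  assumes "unital_algebra k A"
  shows product_map_lin: "product_map k A \<in> lin k (A \<Otimes>\<^bsub>k\<^esub> A) A"
    and product_map_tens: "x \<in> carrier A \<Longrightarrow> y \<in> carrier A \<Longrightarrow>
      product_map k A (tens k A A x y) = x \<otimes>\<^bsub>A\<^esub> y"
proof -
  note A = unital_algebra.axioms(1)[OF assms] and b = product_bilin[OF assms]
  show "product_map k A \<in> lin k (A \<Otimes>\<^bsub>k\<^esub> A) A"
    unfolding product_map_def by (rule tlift_lin[OF A A A b])
  show "x \<in> carrier A \<Longrightarrow> y \<in> carrier A \<Longrightarrow> product_map k A (tens k A A x y) = x \<otimes>\<^bsub>A\<^esub> y"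
    unfolding product_map_def by (rule tlift_tens[OF A A A b])
qed

text \<open>In each of the three conditions \<phi> is preceded by a coevaluation whose dual leg
  feeds it, so after expansion \<phi> occurs only in the combinations \<open>h i\<close>. The
  conditions then become the three laws of the family, obtained below in the order normalisation,
  linearity, colinearity.\<close>

lemma cointegral_family_exists:
  fixes A :: "('k, 'a, 'x) module_scheme" and C :: "('k, 'c, 'y) module_scheme"
  assumes "entwining_structure k A C \<Delta> \<epsilon> \<psi>" "finitely_generated k A" "projective k A"
    and "normalised_cointegral k A C \<Delta> \<epsilon> \<psi> \<phi>"
  obtains n a h where "cointegral_family k A C \<Delta> \<epsilon> \<psi> n a h"
proof -
  have A: "module k A" and C: "module k C"
    using assms(1) by (simp_all add: entwining_structure_def unital_algebra_def coalgebra_def)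
  interpret A: module k A by (rule A)
  interpret entwining_structure k A C \<Delta> \<epsilon> \<psi> by fact
  note D = dual_module[OF A]
  have alg: "unital_algebra k A" by unfold_locales
  note mb = product_bilin[OF alg]
  have \<phi>: "\<phi> \<in> lin k (dual k A \<Otimes>\<^bsub>k\<^esub> C) A"
    and c1: "\<And>c. c \<in> carrier C \<Longrightarrow>
        tmap k A (A \<Otimes>\<^bsub>k\<^esub> C) id \<psi> (tassoc k A C A (tmap k (A \<Otimes>\<^bsub>k\<^esub> C) A \<psi> \<phi>
          (tassoc_inv k C A (dual k A \<Otimes>\<^bsub>k\<^esub> C)
          (tmap k C (A \<Otimes>\<^bsub>k\<^esub> (dual k A \<Otimes>\<^bsub>k\<^esub> C)) id (coev_tensor k A C) (\<Delta> c))))) =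
        tmap k A (A \<Otimes>\<^bsub>k\<^esub> C) id (tmap k A C \<phi> id \<circ> tassoc_inv k (dual k A) C C)
          (coev_tensor k A (C \<Otimes>\<^bsub>k\<^esub> C) (\<Delta> c))"
    and c2: "\<And>t. t \<in> carrier (C \<Otimes>\<^bsub>k\<^esub> A) \<Longrightarrow>
        tmap k A A id (product_map k A \<circ> tmap k A A \<phi> id \<circ> tassoc_inv k (dual k A) C A)
          (coev_tensor k A (C \<Otimes>\<^bsub>k\<^esub> A) t) =
        tmap k A A (product_map k A) \<phi> (tassoc_inv k A A (dual k A \<Otimes>\<^bsub>k\<^esub> C)
          (tmap k A (A \<Otimes>\<^bsub>k\<^esub> (dual k A \<Otimes>\<^bsub>k\<^esub> C)) id (coev_tensor k A C) (\<psi> t)))"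
    and c3: "\<And>c. c \<in> carrier C \<Longrightarrow>
        product_map k A (tmap k A A id \<phi> (coev_tensor k A C c)) = \<epsilon> c \<odot>\<^bsub>A\<^esub> \<one>\<^bsub>A\<^esub>"
    using assms(4) by (auto simp: normalised_cointegral_def)
  obtain n a a' where naa: "(SOME (n, a, a'). dual_basis k A n a a') = (n, a, a')"
    by (metis prod_cases3)
  note coev = coev_tensor_sum[OF A assms(2,3) naa]
  have a: "a i \<in> carrier A" "a' i \<in> carrier (dual k A)" if "i < n" for i
    using coev_dual_basis[OF A assms(2,3) naa] that by (auto simp: dual_basis_def)
  define h where "h = (\<lambda>i c. \<phi> (tens k (dual k A) C (a' i) c))"
  have hd: "\<phi> (tens k (dual k A) C (a' i) c) = h i c" for i c by (simp add: h_def)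
  note \<psi> = entwining_lin
  note m[simp] = A C D and tm[simp] = tensor_module and cl[simp] = tens_closed
  have h: "h i \<in> lin k C A" if "i < n" for i
    unfolding h_def by (rule lin_comp[OF bilin_lin_r[OF tens_bilin[OF D C] a(2)[OF that]] \<phi>])
  note sum = lin_coev_tensor_sum[OF A assms(2,3) naa]
  note cvl = coev_tensor_lin[OF A assms(2,3) C]
  note pm = product_map_lin[OF alg] and pmt = product_map_tens[OF alg]
  have hc: "h i c \<in> carrier A" if "i < n" "c \<in> carrier C" for i c
    using lin_closed[OF h] that by simp
  have \<psi>c: "\<psi> (tens k C A c b) \<in> carrier (A \<Otimes>\<^bsub>k\<^esub> C)" if "c \<in> carrier C" "b \<in> carrier A" for b c
    using that by (intro lin_closed[OF \<psi>]) simp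
  have "cointegral_family k A C \<Delta> \<epsilon> \<psi> n a h"
  proof unfold_locales
    fix c assume c: "c \<in> carrier C"
    have F: "(\<lambda>x. product_map k A (tmap k A A id \<phi> x)) \<in> lin k (A \<Otimes>\<^bsub>k\<^esub> (dual k A \<Otimes>\<^bsub>k\<^esub> C)) A"
      by (rule lin_comp[OF tmap_lin[OF A _ A A lin_id \<phi>] pm]) simp
    have "(\<Oplus>\<^bsub>A\<^esub>i\<in>{..<n}. a i \<otimes>\<^bsub>A\<^esub> h i c) = (\<Oplus>\<^bsub>A\<^esub>i\<in>{..<n}. product_map k A (tmap k A A id \<phi>
        (tens k A (dual k A \<Otimes>\<^bsub>k\<^esub> C) (a i) (tens k (dual k A) C (a' i) c))))"
      using c a hc by (intro A.finsum_cong')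
        (auto simp: tmap_tens[OF A _ A A lin_id \<phi>] pmt hd)
    also have "\<dots> = product_map k A (tmap k A A id \<phi> (coev_tensor k A C c))"
      by (rule sum[OF C c A F, symmetric])
    also have "\<dots> = \<epsilon> c \<odot>\<^bsub>A\<^esub> \<one>\<^bsub>A\<^esub>" by (rule c3[OF c])
    finally show "(\<Oplus>\<^bsub>A\<^esub>i\<in>{..<n}. a i \<otimes>\<^bsub>A\<^esub> h i c) = \<epsilon> c \<odot>\<^bsub>A\<^esub> \<one>\<^bsub>A\<^esub>" .
  next
    fix c b assume c: "c \<in> carrier C" and b: "b \<in> carrier A"
    let ?\<Phi> = "product_map k A \<circ> tmap k A A \<phi> id \<circ> tassoc_inv k (dual k A) C A"
    have \<Phi>: "?\<Phi> \<in> lin k (dual k A \<Otimes>\<^bsub>k\<^esub> (C \<Otimes>\<^bsub>k\<^esub> A)) A"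
      unfolding comp_def
      by (rule lin_comp[OF lin_comp[OF tassoc_inv_lin[OF D C A] tmap_lin[OF _ A A A \<phi> lin_id]] pm]) simp
    have \<Phi>t: "?\<Phi> (tens k (dual k A) (C \<Otimes>\<^bsub>k\<^esub> A) (a' i) (tens k C A c b)) = h i c \<otimes>\<^bsub>A\<^esub> b"
      if "i < n" for i
      using that b c a hc by (simp add: tassoc_inv_tens[OF D C A] tmap_tens[OF _ A A A \<phi> lin_id]
          hd pmt)
    have hcb: "h i c \<otimes>\<^bsub>A\<^esub> b \<in> carrier A" if "i < n" for i
      using bilin_closed[OF mb hc[OF that c] b] .
    interpret AA: module k "A \<Otimes>\<^bsub>k\<^esub> A" by simp
    have "(\<Oplus>\<^bsub>A \<Otimes>\<^bsub>k\<^esub> A\<^esub>i\<in>{..<n}. tens k A A (a i) (h i c \<otimes>\<^bsub>A\<^esub> b)) =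
        (\<Oplus>\<^bsub>A \<Otimes>\<^bsub>k\<^esub> A\<^esub>i\<in>{..<n}. tmap k A A id ?\<Phi> (tens k A (dual k A \<Otimes>\<^bsub>k\<^esub> (C \<Otimes>\<^bsub>k\<^esub> A)) (a i)
          (tens k (dual k A) (C \<Otimes>\<^bsub>k\<^esub> A) (a' i) (tens k C A c b))))"
      using b c a by (intro AA.finsum_cong')
        (auto simp only: tmap_tens[OF A _ A A lin_id \<Phi>] tm m cl \<Phi>t id_apply
          hcb lessThan_iff)
    also have "\<dots> = tmap k A A id ?\<Phi> (coev_tensor k A (C \<Otimes>\<^bsub>k\<^esub> A) (tens k C A c b))"
      using b c by (intro sum[symmetric] tmap_lin lin_id \<Phi>) simp_all
    also have "\<dots> = tmap k A A (product_map k A) \<phi> (tassoc_inv k A A (dual k A \<Otimes>\<^bsub>k\<^esub> C)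
          (tmap k A (A \<Otimes>\<^bsub>k\<^esub> (dual k A \<Otimes>\<^bsub>k\<^esub> C)) id (coev_tensor k A C) (\<psi> (tens k C A c b))))"
      using b c by (intro c2) simp
    also have "\<dots> = tlift k (A \<Otimes>\<^bsub>k\<^esub> A) (\<lambda>p d. \<Oplus>\<^bsub>A \<Otimes>\<^bsub>k\<^esub> A\<^esub>i\<in>{..<n}. tens k A A (p \<otimes>\<^bsub>A\<^esub> a i) (h i d))
        (\<psi> (tens k C A c b))"
    \<comment> \<open>The second coevaluation acts behind \<psi>, whose value is no pure tensor; the
      two sides are compared as linear maps on A \<otimes> C.\<close>
    proof (rule lin_tensor_eqI[OF A C, where P = "A \<Otimes>\<^bsub>k\<^esub> A"])
      let ?G = "\<lambda>w. tmap k A A (product_map k A) \<phi> (tassoc_inv k A A (dual k A \<Otimes>\<^bsub>k\<^esub> C) w)"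
      have G: "?G \<in> lin k (A \<Otimes>\<^bsub>k\<^esub> (A \<Otimes>\<^bsub>k\<^esub> (dual k A \<Otimes>\<^bsub>k\<^esub> C))) (A \<Otimes>\<^bsub>k\<^esub> A)"
        by (rule lin_comp[OF tassoc_inv_lin tmap_lin[OF _ _ _ _ pm \<phi>]]) simp_all
      note cv = tmap_lin[OF A C A _ lin_id cvl]
      have bil: "(\<lambda>p d. \<Oplus>\<^bsub>A \<Otimes>\<^bsub>k\<^esub> A\<^esub>i\<in>{..<n}. tens k A A (p \<otimes>\<^bsub>A\<^esub> a i) (h i d))
          \<in> bilin k A C (A \<Otimes>\<^bsub>k\<^esub> A)"
        by (intro bilin_finsum bilin_comp[OF tens_bilin[OF A A]] bilin_lin_l[OF mb] a h) simp_all
      show "(\<lambda>t. ?G (tmap k A (A \<Otimes>\<^bsub>k\<^esub> (dual k A \<Otimes>\<^bsub>k\<^esub> C)) id (coev_tensor k A C) t))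
          \<in> lin k (A \<Otimes>\<^bsub>k\<^esub> C) (A \<Otimes>\<^bsub>k\<^esub> A)"
        by (rule lin_comp[OF cv G]) simp
      show "tlift k (A \<Otimes>\<^bsub>k\<^esub> A) (\<lambda>p d. \<Oplus>\<^bsub>A \<Otimes>\<^bsub>k\<^esub> A\<^esub>i\<in>{..<n}. tens k A A (p \<otimes>\<^bsub>A\<^esub> a i) (h i d))
          \<in> lin k (A \<Otimes>\<^bsub>k\<^esub> C) (A \<Otimes>\<^bsub>k\<^esub> A)"
        by (intro tlift_lin bil) simp_all
      show "\<psi> (tens k C A c b) \<in> carrier (A \<Otimes>\<^bsub>k\<^esub> C)" by (rule \<psi>c[OF c b])
      fix p d assume p: "p \<in> carrier A" and d: "d \<in> carrier C"
      have "?G (tmap k A (A \<Otimes>\<^bsub>k\<^esub> (dual k A \<Otimes>\<^bsub>k\<^esub> C)) id (coev_tensor k A C) (tens k A C p d)) =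
          ?G (tens k A (A \<Otimes>\<^bsub>k\<^esub> (dual k A \<Otimes>\<^bsub>k\<^esub> C)) p (coev_tensor k A C d))"
        using p d by (simp add: tmap_tens[OF A C A _ lin_id cvl])
      also have "\<dots> = (\<Oplus>\<^bsub>A \<Otimes>\<^bsub>k\<^esub> A\<^esub>i\<in>{..<n}. ?G (tens k A (A \<Otimes>\<^bsub>k\<^esub> (dual k A \<Otimes>\<^bsub>k\<^esub> C)) p
          (tens k A (dual k A \<Otimes>\<^bsub>k\<^esub> C) (a i) (tens k (dual k A) C (a' i) d))))"
        using p by (intro sum[OF C d] lin_comp[OF bilin_lin_r[OF tens_bilin] G]) simp_all
      also have "\<dots> = (\<Oplus>\<^bsub>A \<Otimes>\<^bsub>k\<^esub> A\<^esub>i\<in>{..<n}. tens k A A (p \<otimes>\<^bsub>A\<^esub> a i) (h i d))"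
        using p d a hc by (intro AA.finsum_cong')
          (auto simp: tassoc_inv_tens tmap_tens[OF _ _ _ _ pm \<phi>] pmt hd)
      also have "\<dots> = tlift k (A \<Otimes>\<^bsub>k\<^esub> A) (\<lambda>p d. \<Oplus>\<^bsub>A \<Otimes>\<^bsub>k\<^esub> A\<^esub>i\<in>{..<n}. tens k A A (p \<otimes>\<^bsub>A\<^esub> a i) (h i d))
          (tens k A C p d)"
        by (rule tlift_tens[OF A C _ bil p d, symmetric]) simp
      finally show "?G (tmap k A (A \<Otimes>\<^bsub>k\<^esub> (dual k A \<Otimes>\<^bsub>k\<^esub> C)) id (coev_tensor k A C) (tens k A C p d)) =
        tlift k (A \<Otimes>\<^bsub>k\<^esub> A) (\<lambda>p d. \<Oplus>\<^bsub>A \<Otimes>\<^bsub>k\<^esub> A\<^esub>i\<in>{..<n}. tens k A A (p \<otimes>\<^bsub>A\<^esub> a i) (h i d)) (tens k A C p d)" .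
    qed
    finally show "(\<Oplus>\<^bsub>A \<Otimes>\<^bsub>k\<^esub> A\<^esub>i\<in>{..<n}. tens k A A (a i) (h i c \<otimes>\<^bsub>A\<^esub> b)) =
      tlift k (A \<Otimes>\<^bsub>k\<^esub> A) (\<lambda>p d. \<Oplus>\<^bsub>A \<Otimes>\<^bsub>k\<^esub> A\<^esub>i\<in>{..<n}. tens k A A (p \<otimes>\<^bsub>A\<^esub> a i) (h i d))
        (\<psi> (tens k C A c b))" .
  next
    fix c assume c: "c \<in> carrier C"
    have \<Delta>c: "\<Delta> c \<in> carrier (C \<Otimes>\<^bsub>k\<^esub> C)" by (rule lin_closed[OF coproduct_lin c])
    let ?T = "A \<Otimes>\<^bsub>k\<^esub> (A \<Otimes>\<^bsub>k\<^esub> C)"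
    interpret T: module k ?T by simp
    define L where "L = (\<lambda>i d e. tmap k A (A \<Otimes>\<^bsub>k\<^esub> C) id \<psi> (tassoc k A C A
          (tens k (A \<Otimes>\<^bsub>k\<^esub> C) A (\<psi> (tens k C A d (a i))) (h i e))))"
    have H: "(\<lambda>x. tmap k A (A \<Otimes>\<^bsub>k\<^esub> C) id \<psi> (tassoc k A C A x)) \<in> lin k ((A \<Otimes>\<^bsub>k\<^esub> C) \<Otimes>\<^bsub>k\<^esub> A) ?T"
      by (rule lin_comp[OF tassoc_lin tmap_lin[OF _ _ _ _ lin_id \<psi>]]) simp_all
    have Lb: "L i \<in> bilin k C C ?T" if "i < n" for i
      unfolding L_def
      by (intro lin_bilin_comp[OF bilin_comp[OF tens_bilin _ h] H]
          lin_comp[OF bilin_lin_l[OF tens_bilin] \<psi>] a that) simp_all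
    have bil: "(\<lambda>d e. \<Oplus>\<^bsub>?T\<^esub>i\<in>{..<n}. L i d e) \<in> bilin k C C ?T"
      by (intro bilin_finsum Lb) simp_all
    let ?\<Phi> = "tmap k A C \<phi> id \<circ> tassoc_inv k (dual k A) C C"
    have \<Phi>: "?\<Phi> \<in> lin k (dual k A \<Otimes>\<^bsub>k\<^esub> (C \<Otimes>\<^bsub>k\<^esub> C)) (A \<Otimes>\<^bsub>k\<^esub> C)"
      unfolding comp_def
      by (rule lin_comp[OF tassoc_inv_lin[OF D C C] tmap_lin[OF _ C A C \<phi> lin_id]]) simp
    have "tlift k ?T (\<lambda>d e. \<Oplus>\<^bsub>?T\<^esub>i\<in>{..<n}. L i d e) (\<Delta> c) =
       tmap k A (A \<Otimes>\<^bsub>k\<^esub> C) id \<psi> (tassoc k A C A (tmap k (A \<Otimes>\<^bsub>k\<^esub> C) A \<psi> \<phi>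
          (tassoc_inv k C A (dual k A \<Otimes>\<^bsub>k\<^esub> C)
          (tmap k C (A \<Otimes>\<^bsub>k\<^esub> (dual k A \<Otimes>\<^bsub>k\<^esub> C)) id (coev_tensor k A C) (\<Delta> c)))))"
    \<comment> \<open>This rewriting of the left side of the condition holds on all of C \<otimes>
      C; only the subsequent use of \<open>c1\<close> requires the argument to be
      \<Delta>(c).\<close>
    proof (rule lin_tensor_eqI[OF C C, where P = ?T])
      let ?G = "\<lambda>w. tmap k A (A \<Otimes>\<^bsub>k\<^esub> C) id \<psi> (tassoc k A C A (tmap k (A \<Otimes>\<^bsub>k\<^esub> C) A \<psi> \<phi>
          (tassoc_inv k C A (dual k A \<Otimes>\<^bsub>k\<^esub> C) w)))"
      have G: "?G \<in> lin k (C \<Otimes>\<^bsub>k\<^esub> (A \<Otimes>\<^bsub>k\<^esub> (dual k A \<Otimes>\<^bsub>k\<^esub> C))) ?T"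
        by (rule lin_comp[OF lin_comp[OF tassoc_inv_lin tmap_lin[OF _ _ _ _ \<psi> \<phi>]] H]) simp_all
      note cv = tmap_lin[OF C C C _ lin_id cvl]
      show "(\<lambda>t. ?G (tmap k C (A \<Otimes>\<^bsub>k\<^esub> (dual k A \<Otimes>\<^bsub>k\<^esub> C)) id (coev_tensor k A C) t))
          \<in> lin k (C \<Otimes>\<^bsub>k\<^esub> C) ?T"
        by (rule lin_comp[OF cv G]) simp
      show "tlift k ?T (\<lambda>d e. \<Oplus>\<^bsub>?T\<^esub>i\<in>{..<n}. L i d e) \<in> lin k (C \<Otimes>\<^bsub>k\<^esub> C) ?T"
        by (intro tlift_lin bil) simp_all
      show "\<Delta> c \<in> carrier (C \<Otimes>\<^bsub>k\<^esub> C)" by (rule \<Delta>c)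
      fix d e assume d: "d \<in> carrier C" and e: "e \<in> carrier C"
      have "?G (tmap k C (A \<Otimes>\<^bsub>k\<^esub> (dual k A \<Otimes>\<^bsub>k\<^esub> C)) id (coev_tensor k A C) (tens k C C d e)) =
          ?G (tens k C (A \<Otimes>\<^bsub>k\<^esub> (dual k A \<Otimes>\<^bsub>k\<^esub> C)) d (coev_tensor k A C e))"
        using d e by (simp add: tmap_tens[OF C C C _ lin_id cvl])
      also have "\<dots> = (\<Oplus>\<^bsub>?T\<^esub>i\<in>{..<n}. ?G (tens k C (A \<Otimes>\<^bsub>k\<^esub> (dual k A \<Otimes>\<^bsub>k\<^esub> C)) d
          (tens k A (dual k A \<Otimes>\<^bsub>k\<^esub> C) (a i) (tens k (dual k A) C (a' i) e))))"
        using d by (intro sum[OF C e] lin_comp[OF bilin_lin_r[OF tens_bilin] G]) simp_all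
      also have "\<dots> = (\<Oplus>\<^bsub>?T\<^esub>i\<in>{..<n}. L i d e)"
        using d e a hc bilin_closed[OF Lb] by (intro T.finsum_cong')
          (auto simp: tassoc_inv_tens tmap_tens[OF _ _ _ _ \<psi> \<phi>] hd L_def)
      also have "\<dots> = tlift k ?T (\<lambda>d e. \<Oplus>\<^bsub>?T\<^esub>i\<in>{..<n}. L i d e) (tens k C C d e)"
        by (rule tlift_tens[OF C C _ bil d e, symmetric]) simp
      finally show "tlift k ?T (\<lambda>d e. \<Oplus>\<^bsub>?T\<^esub>i\<in>{..<n}. L i d e) (tens k C C d e) =
        ?G (tmap k C (A \<Otimes>\<^bsub>k\<^esub> (dual k A \<Otimes>\<^bsub>k\<^esub> C)) id (coev_tensor k A C) (tens k C C d e))" ..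
    qed
    also have "\<dots> = tmap k A (A \<Otimes>\<^bsub>k\<^esub> C) id ?\<Phi> (coev_tensor k A (C \<Otimes>\<^bsub>k\<^esub> C) (\<Delta> c))"
      by (rule c1[OF c])
    also have "\<dots> = (\<Oplus>\<^bsub>?T\<^esub>i\<in>{..<n}. tmap k A (A \<Otimes>\<^bsub>k\<^esub> C) id ?\<Phi> (tens k A (dual k A \<Otimes>\<^bsub>k\<^esub> (C \<Otimes>\<^bsub>k\<^esub> C)) (a i)
        (tens k (dual k A) (C \<Otimes>\<^bsub>k\<^esub> C) (a' i) (\<Delta> c))))"
      by (intro sum tmap_lin lin_id \<Phi> \<Delta>c) simp_all
    also have "\<dots> = (\<Oplus>\<^bsub>?T\<^esub>i\<in>{..<n}. tens k A (A \<Otimes>\<^bsub>k\<^esub> C) (a i) (tmap k A C (h i) id (\<Delta> c)))"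
    proof (intro T.finsum_cong' refl)
      show "(\<lambda>i. tens k A (A \<Otimes>\<^bsub>k\<^esub> C) (a i) (tmap k A C (h i) id (\<Delta> c))) \<in> {..<n} \<rightarrow> carrier ?T"
        using a lin_closed[OF tmap_lin[OF C C A C h lin_id]] \<Delta>c by auto
      fix i assume "i \<in> {..<n}"
      then have i: "i < n" by simp
      \<comment> \<open>On the right side the coevaluation is attached to \<Delta>(c) as a whole.
        After reassociation \<phi> takes the dual basis element with the first leg of \<Delta>(c)
        and leaves the second leg alone.\<close>
      have "?\<Phi> (tens k (dual k A) (C \<Otimes>\<^bsub>k\<^esub> C) (a' i) t) = tmap k A C (h i) id t"
        if "t \<in> carrier (C \<Otimes>\<^bsub>k\<^esub> C)" for t
        using _ _ _ _ _ that
      proof (rule lin_tensor_eqI)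
        show "(\<lambda>t. ?\<Phi> (tens k (dual k A) (C \<Otimes>\<^bsub>k\<^esub> C) (a' i) t)) \<in> lin k (C \<Otimes>\<^bsub>k\<^esub> C) (A \<Otimes>\<^bsub>k\<^esub> C)"
          by (rule lin_comp[OF bilin_lin_r[OF tens_bilin] \<Phi>]) (simp_all add: a i)
        show "tmap k A C (h i) id \<in> lin k (C \<Otimes>\<^bsub>k\<^esub> C) (A \<Otimes>\<^bsub>k\<^esub> C)"
          by (rule tmap_lin[OF C C A C h[OF i] lin_id])
      qed (simp_all only: comp_apply m tm cl a i tassoc_inv_tens tmap_tens[OF _ _ _ _ \<phi> lin_id]
          tmap_tens[OF C C A C h[OF i] lin_id] hd)
      then show "tmap k A (A \<Otimes>\<^bsub>k\<^esub> C) id ?\<Phi> (tens k A (dual k A \<Otimes>\<^bsub>k\<^esub> (C \<Otimes>\<^bsub>k\<^esub> C)) (a i)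
        (tens k (dual k A) (C \<Otimes>\<^bsub>k\<^esub> C) (a' i) (\<Delta> c))) = tens k A (A \<Otimes>\<^bsub>k\<^esub> C) (a i) (tmap k A C (h i) id (\<Delta> c))"
        using \<Delta>c i a by (simp only: tmap_tens[OF A _ A _ lin_id \<Phi>] m tm cl id_apply)
    qed
    finally show "tlift k ?T (\<lambda>d e. \<Oplus>\<^bsub>?T\<^esub>i\<in>{..<n}.
        tmap k A (A \<Otimes>\<^bsub>k\<^esub> C) id \<psi> (tassoc k A C A
          (tens k (A \<Otimes>\<^bsub>k\<^esub> C) A (\<psi> (tens k C A d (a i))) (h i e)))) (\<Delta> c) =
      (\<Oplus>\<^bsub>?T\<^esub>i\<in>{..<n}. tens k A (A \<Otimes>\<^bsub>k\<^esub> C) (a i) (tmap k A C (h i) id (\<Delta> c)))"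
      unfolding L_def .
  qed (simp_all add: a h)
  then show ?thesis by (rule that)
qed

section \<open>Entwined modules\<close>

lemma act_bilin:
  assumes "right_module k A M act"
  shows "act \<in> bilin k M A M"
proof -
  interpret right_module k A M act by fact
  show ?thesis by (rule bilinI[OF act_lin_r act_lin_l])
qed

text \<open>The part of the compatibility condition that comes after \<psi>: x and b \<otimes> c go
  to x \<cdot> b \<otimes> c. The second argument is a whole tensor, so that
  \<open>\<psi> (tens k C A c b)\<close> can be inserted.\<close>

definition diag_act where
  "diag_act k A C M act x t =
     tmap k M C (tlift k M act) id (tassoc_inv k M A C (tens k M (A \<Otimes>\<^bsub>k\<^esub> C) x t))"

text \<open>The right-hand side of the compatibility condition: \<open>x \<otimes> c\<close> and \<open>b\<close> are sent to
  \<open>x \<cdot> b\<^sub>\<alpha> \<otimes> c\<^sup>\<alpha>\<close>.\<close>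
definition twist_act where
  "twist_act k A C \<psi> M act s b =
     (tmap k M C (tlift k M act) id \<circ> tassoc_inv k M A C \<circ> tmap k M (A \<Otimes>\<^bsub>k\<^esub> C) id \<psi> \<circ>
        tassoc k M C A) (tens k (M \<Otimes>\<^bsub>k\<^esub> C) A s b)"

lemma diag_act:
  assumes "right_module k A M act" "module k C"
  shows diag_act_bilin: "diag_act k A C M act \<in> bilin k M (A \<Otimes>\<^bsub>k\<^esub> C) (M \<Otimes>\<^bsub>k\<^esub> C)"
    and diag_act_tens: "x \<in> carrier M \<Longrightarrow> b \<in> carrier A \<Longrightarrow> c \<in> carrier C \<Longrightarrow>
      diag_act k A C M act x (tens k A C b c) = tens k M C (act x b) c"
proof -
  have m: "module k A" "module k M" "module k C"
    using assms by (simp_all add: right_module_def unital_algebra_def)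
  note b = act_bilin[OF assms(1)]
  note l = tlift_lin[OF m(2,1,2) b]
  note MA = tensor_module[OF m(2,1)] and MC = tensor_module[OF m(2,3)] and AC = tensor_module[OF m(1,3)]
  have "(\<lambda>x t. tmap k M C (tlift k M act) id (tassoc_inv k M A C (tens k M (A \<Otimes>\<^bsub>k\<^esub> C) x t)))
      \<in> bilin k M (A \<Otimes>\<^bsub>k\<^esub> C) (M \<Otimes>\<^bsub>k\<^esub> C)"
    by (rule lin_bilin_comp[OF tens_bilin[OF m(2) AC]
          lin_comp[OF tassoc_inv_lin[OF m(2,1,3)] tmap_lin[OF MA m(3) m(2,3) l lin_id]]])
  then show "diag_act k A C M act \<in> bilin k M (A \<Otimes>\<^bsub>k\<^esub> C) (M \<Otimes>\<^bsub>k\<^esub> C)"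
    by (simp add: diag_act_def[abs_def])
  show "diag_act k A C M act x (tens k A C b c) = tens k M C (act x b) c"
    if "x \<in> carrier M" "b \<in> carrier A" "c \<in> carrier C"
    using that by (simp add: diag_act_def tassoc_inv_tens[OF m(2,1,3)] tens_closed[OF m(2,1)]
        tmap_tens[OF MA m(3) m(2,3) l lin_id] tlift_tens[OF m(2,1,2) b])
qed

lemma twist_act:
  assumes "right_module k A M act" "module k C" "\<psi> \<in> lin k (C \<Otimes>\<^bsub>k\<^esub> A) (A \<Otimes>\<^bsub>k\<^esub> C)"
  shows twist_act_bilin: "twist_act k A C \<psi> M act \<in> bilin k (M \<Otimes>\<^bsub>k\<^esub> C) A (M \<Otimes>\<^bsub>k\<^esub> C)"
    and twist_act_tens: "x \<in> carrier M \<Longrightarrow> c \<in> carrier C \<Longrightarrow> b \<in> carrier A \<Longrightarrow>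
      twist_act k A C \<psi> M act (tens k M C x c) b = diag_act k A C M act x (\<psi> (tens k C A c b))"
proof -
  have m: "module k A" "module k M" "module k C"
    using assms by (simp_all add: right_module_def unital_algebra_def)
  note b = act_bilin[OF assms(1)]
  note l = tlift_lin[OF m(2,1,2) b]
  note MA = tensor_module[OF m(2,1)] and MC = tensor_module[OF m(2,3)] and AC = tensor_module[OF m(1,3)]
    and CA = tensor_module[OF m(3,1)]
  have "(\<lambda>s b. tmap k M C (tlift k M act) id (tassoc_inv k M A C (tmap k M (A \<Otimes>\<^bsub>k\<^esub> C) id \<psi>
      (tassoc k M C A (tens k (M \<Otimes>\<^bsub>k\<^esub> C) A s b))))) \<in> bilin k (M \<Otimes>\<^bsub>k\<^esub> C) A (M \<Otimes>\<^bsub>k\<^esub> C)"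
    by (rule lin_bilin_comp[OF tens_bilin[OF MC m(1)] lin_comp[OF tassoc_lin[OF m(2,3,1)]
          lin_comp[OF tmap_lin[OF m(2) CA m(2) AC lin_id assms(3)]
          lin_comp[OF tassoc_inv_lin[OF m(2,1,3)] tmap_lin[OF MA m(3) m(2,3) l lin_id]]]]])
  then show "twist_act k A C \<psi> M act \<in> bilin k (M \<Otimes>\<^bsub>k\<^esub> C) A (M \<Otimes>\<^bsub>k\<^esub> C)"
    by (simp add: twist_act_def[abs_def])
  show "twist_act k A C \<psi> M act (tens k M C x c) b = diag_act k A C M act x (\<psi> (tens k C A c b))"
    if "x \<in> carrier M" "c \<in> carrier C" "b \<in> carrier A"
    using that by (simp add: twist_act_def diag_act_def tassoc_tens[OF m(2,3,1)] tens_closed[OF m(3,1)]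
        tmap_tens[OF m(2) CA m(2) AC lin_id assms(3)])
qed

section \<open>Averaging a colinear map\<close>

text \<open>The morphism to be split is not fixed here. A section and a retraction of a morphism
  from N to M both go from M to N, so one construction on a colinear \<open>g\<close> serves
  both.\<close>

locale averaging =
  fixes k :: "('k, 'r) ring_scheme"
    and A :: "('k, 'a, 'u) module_scheme" and C :: "('k, 'c, 'v) module_scheme"
    and \<Delta> \<epsilon> \<psi> n a h
    and M :: "('k, 'm, 'w) module_scheme" and act\<^sub>M \<rho>\<^sub>M
    and N :: "('k, 'n, 'z) module_scheme" and act\<^sub>N \<rho>\<^sub>N
    and g
  assumes family: "cointegral_family k A C \<Delta> \<epsilon> \<psi> n a h"
    and M_entwined: "entwined_module k A C \<Delta> \<epsilon> \<psi> M act\<^sub>M \<rho>\<^sub>M"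
    and N_entwined: "entwined_module k A C \<Delta> \<epsilon> \<psi> N act\<^sub>N \<rho>\<^sub>N"
    and g_colinear: "g \<in> comodule_hom k C M \<rho>\<^sub>M N \<rho>\<^sub>N"
begin

lemma modules [simp]: "module k A" "module k C" "module k M" "module k N"
  using M_entwined N_entwined
  by (simp_all add: entwined_module_def right_module_def unital_algebra_def right_comodule_def coalgebra_def)

lemma right_modules: "right_module k A M act\<^sub>M" "right_module k A N act\<^sub>N"
  using M_entwined N_entwined by (simp_all add: entwined_module_def)

lemma comodules: "right_comodule k C \<Delta> \<epsilon> M \<rho>\<^sub>M" "right_comodule k C \<Delta> \<epsilon> N \<rho>\<^sub>N"
  using M_entwined N_entwined by (simp_all add: entwined_module_def)

lemma alg: "unital_algebra k A" and coalg: "coalgebra k C \<Delta> \<epsilon>"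
  and entw: "entwining_structure k A C \<Delta> \<epsilon> \<psi>"
  using M_entwined by (simp_all add: entwined_module_def entwining_structure_def)

lemmas \<psi> = entwining_structure.entwining_lin[OF entw]
lemmas \<Delta> = coalgebra.coproduct_lin[OF coalg]
lemmas \<epsilon> = coalgebra.counit_lin[OF coalg]
lemmas \<rho>M = right_comodule.coaction_lin[OF comodules(1)]
lemmas \<rho>N = right_comodule.coaction_lin[OF comodules(2)]
lemmas actM = act_bilin[OF right_modules(1)]
lemmas actN = act_bilin[OF right_modules(2)]
lemmas mb = product_bilin[OF alg]
lemmas a = cointegral_family.family_closed[OF family]
lemmas h = cointegral_family.family_lin[OF family]
lemmas [simp] = tensor_module tens_closed

lemma g: "g \<in> lin k M N" and g_coact: "x \<in> carrier M \<Longrightarrow> \<rho>\<^sub>N (g x) = tmap k N C g id (\<rho>\<^sub>M x)"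
  using g_colinear by (auto simp: comodule_hom_def)

lemma coact_act:
  "x \<in> carrier M \<Longrightarrow> b \<in> carrier A \<Longrightarrow> \<rho>\<^sub>M (act\<^sub>M x b) = twist_act k A C \<psi> M act\<^sub>M (\<rho>\<^sub>M x) b"
  "y \<in> carrier N \<Longrightarrow> b \<in> carrier A \<Longrightarrow> \<rho>\<^sub>N (act\<^sub>N y b) = twist_act k A C \<psi> N act\<^sub>N (\<rho>\<^sub>N y) b"
  using entwined_module.compatible[OF M_entwined] entwined_module.compatible[OF N_entwined]
  by (simp_all add: twist_act_def)

lemmas closed [simp] = bilin_closed[OF actM] bilin_closed[OF actN] bilin_closed[OF mb] a
  lin_closed[OF h] lin_closed[OF g] lin_closed[OF \<psi>] lin_closed[OF \<Delta>] lin_closed[OF \<rho>M] lin_closed[OF \<rho>N]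

text \<open>The average before the coaction is inserted. Having it on all of M \<otimes> C makes its
  properties checkable on pure tensors.\<close>

definition avg_map where
  "avg_map = tlift k N (\<lambda>x c. \<Oplus>\<^bsub>N\<^esub>i\<in>{..<n}. act\<^sub>N (g (act\<^sub>M x (a i))) (h i c))"

definition avg where "avg x = avg_map (\<rho>\<^sub>M x)"

lemma avg_bilin: "(\<lambda>x c. \<Oplus>\<^bsub>N\<^esub>i\<in>{..<n}. act\<^sub>N (g (act\<^sub>M x (a i))) (h i c)) \<in> bilin k M C N"
  by (intro bilin_finsum bilin_comp[OF actN] lin_comp[OF bilin_lin_l[OF actM] g] a h) simp_all

lemma avg_map_lin: "avg_map \<in> lin k (M \<Otimes>\<^bsub>k\<^esub> C) N"
  unfolding avg_map_def by (rule tlift_lin[OF _ _ _ avg_bilin]) simp_all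

lemma avg_map_tens:
  "x \<in> carrier M \<Longrightarrow> c \<in> carrier C \<Longrightarrow>
    avg_map (tens k M C x c) = (\<Oplus>\<^bsub>N\<^esub>i\<in>{..<n}. act\<^sub>N (g (act\<^sub>M x (a i))) (h i c))"
  unfolding avg_map_def by (rule tlift_tens[OF _ _ _ avg_bilin]) simp_all

lemma avg_lin: "avg \<in> lin k M N"
  using lin_comp[OF \<rho>M avg_map_lin] by (simp add: avg_def[abs_def])

section \<open>Linearity of the average over A\<close>

lemmas act_assoc = right_module.act_mult[OF right_modules(1)] right_module.act_mult[OF right_modules(2)]

text \<open>Evaluated at \<theta>(c) this gives the value of \<open>avg_map\<close> at x \<otimes>
  c. It carries identities of A \<otimes> A, such as the linearity law of the family, over to
  N.\<close>

definition fold_act where "fold_act x = tlift k N (\<lambda>p q. act\<^sub>N (g (act\<^sub>M x p)) q)"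

lemma fold_act_bilin: "x \<in> carrier M \<Longrightarrow> (\<lambda>p q. act\<^sub>N (g (act\<^sub>M x p)) q) \<in> bilin k A A N"
  using bilin_comp[OF actN lin_comp[OF bilin_lin_r[OF actM] g] lin_id] by simp

lemma fold_act:
  assumes "x \<in> carrier M"
  shows fold_act_lin: "fold_act x \<in> lin k (A \<Otimes>\<^bsub>k\<^esub> A) N"
    and fold_act_tens: "p \<in> carrier A \<Longrightarrow> q \<in> carrier A \<Longrightarrow>
      fold_act x (tens k A A p q) = act\<^sub>N (g (act\<^sub>M x p)) q"
  unfolding fold_act_def
  by (rule tlift_lin[OF _ _ _ fold_act_bilin[OF assms]], simp_all)
    (rule tlift_tens[OF _ _ _ fold_act_bilin[OF assms]], simp_all)

text \<open>Since acting by p and then by \<open>a i\<close> is acting by their product, moving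
  \<open>x\<close> by the A-leg of \<open>t\<close> multiplies the first legs of \<theta> from the
  left. The argument of \<open>fold_act x\<close> is the right side of \<open>family_linear\<close>,
  with \<open>t\<close> in place of \<open>\<psi> (tens k C A c b)\<close>.\<close>

lemma avg_map_diag_act:
  assumes x: "x \<in> carrier M" and t: "t \<in> carrier (A \<Otimes>\<^bsub>k\<^esub> C)"
  shows "avg_map (diag_act k A C M act\<^sub>M x t) = fold_act x
    (tlift k (A \<Otimes>\<^bsub>k\<^esub> A) (\<lambda>p d. \<Oplus>\<^bsub>A \<Otimes>\<^bsub>k\<^esub> A\<^esub>i\<in>{..<n}. tens k A A (p \<otimes>\<^bsub>A\<^esub> a i) (h i d)) t)"
  using _ _ _ _ _ t
proof (rule lin_tensor_eqI[where P = N])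
  interpret N: module k N by simp
  have bil: "(\<lambda>p d. \<Oplus>\<^bsub>A \<Otimes>\<^bsub>k\<^esub> A\<^esub>i\<in>{..<n}. tens k A A (p \<otimes>\<^bsub>A\<^esub> a i) (h i d)) \<in> bilin k A C (A \<Otimes>\<^bsub>k\<^esub> A)"
    by (intro bilin_finsum bilin_comp[OF tens_bilin] bilin_lin_l[OF mb] a h) simp_all
  show "(\<lambda>t. avg_map (diag_act k A C M act\<^sub>M x t)) \<in> lin k (A \<Otimes>\<^bsub>k\<^esub> C) N"
    by (rule lin_comp[OF bilin_lin_r[OF diag_act_bilin[OF right_modules(1)] x] avg_map_lin]) simp
  show "(\<lambda>t. fold_act x (tlift k (A \<Otimes>\<^bsub>k\<^esub> A)
      (\<lambda>p d. \<Oplus>\<^bsub>A \<Otimes>\<^bsub>k\<^esub> A\<^esub>i\<in>{..<n}. tens k A A (p \<otimes>\<^bsub>A\<^esub> a i) (h i d)) t)) \<in> lin k (A \<Otimes>\<^bsub>k\<^esub> C) N"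
    by (rule lin_comp[OF tlift_lin[OF _ _ _ bil] fold_act_lin[OF x]]) simp_all
  fix p d assume p: "p \<in> carrier A" and d: "d \<in> carrier C"
  have "fold_act x (tlift k (A \<Otimes>\<^bsub>k\<^esub> A)
      (\<lambda>p d. \<Oplus>\<^bsub>A \<Otimes>\<^bsub>k\<^esub> A\<^esub>i\<in>{..<n}. tens k A A (p \<otimes>\<^bsub>A\<^esub> a i) (h i d)) (tens k A C p d)) =
    fold_act x (\<Oplus>\<^bsub>A \<Otimes>\<^bsub>k\<^esub> A\<^esub>i\<in>{..<n}. tens k A A (p \<otimes>\<^bsub>A\<^esub> a i) (h i d))"
    using tlift_tens[OF _ _ _ bil p d] by simp
  also have "\<dots> = (\<Oplus>\<^bsub>N\<^esub>i\<in>{..<n}. fold_act x (tens k A A (p \<otimes>\<^bsub>A\<^esub> a i) (h i d)))"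
    by (rule lin_finsum[OF _ _ fold_act_lin[OF x]]) (simp_all add: Pi_iff p d)
  also have "\<dots> = (\<Oplus>\<^bsub>N\<^esub>i\<in>{..<n}. act\<^sub>N (g (act\<^sub>M (act\<^sub>M x p) (a i))) (h i d))"
    using x p d by (intro N.finsum_cong') (auto simp: fold_act_tens act_assoc)
  also have "\<dots> = avg_map (diag_act k A C M act\<^sub>M x (tens k A C p d))"
    using x p d by (simp add: diag_act_tens[OF right_modules(1)] avg_map_tens)
  finally show "avg_map (diag_act k A C M act\<^sub>M x (tens k A C p d)) = fold_act x (tlift k (A \<Otimes>\<^bsub>k\<^esub> A)
      (\<lambda>p d. \<Oplus>\<^bsub>A \<Otimes>\<^bsub>k\<^esub> A\<^esub>i\<in>{..<n}. tens k A A (p \<otimes>\<^bsub>A\<^esub> a i) (h i d)) (tens k A C p d))" ..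
qed simp_all

text \<open>On x \<otimes> c, \<open>avg_map_diag_act\<close> turns the left side into
  \<open>fold_act x\<close> of b\<open>\<^sub>\<alpha>\<close> \<cdot>
  \<theta>(c\<open>\<^sup>\<alpha>\<close>). The linearity law replaces this by \<theta>(c) \<cdot>
  b, and associativity of the action on N pulls b out of the sum.\<close>

lemma avg_map_twist_act:
  assumes b: "b \<in> carrier A" and s: "s \<in> carrier (M \<Otimes>\<^bsub>k\<^esub> C)"
  shows "avg_map (twist_act k A C \<psi> M act\<^sub>M s b) = act\<^sub>N (avg_map s) b"
  using _ _ _ _ _ s
proof (rule lin_tensor_eqI[where P = N])
  interpret N: module k N by simp
  note tw = twist_act_bilin[OF right_modules(1) modules(2) \<psi>]
  show "(\<lambda>s. avg_map (twist_act k A C \<psi> M act\<^sub>M s b)) \<in> lin k (M \<Otimes>\<^bsub>k\<^esub> C) N"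
    by (rule lin_comp[OF bilin_lin_l[OF tw b] avg_map_lin])
  show "(\<lambda>s. act\<^sub>N (avg_map s) b) \<in> lin k (M \<Otimes>\<^bsub>k\<^esub> C) N"
    by (rule lin_comp[OF avg_map_lin bilin_lin_l[OF actN b]])
  fix x c assume x: "x \<in> carrier M" and c: "c \<in> carrier C"
  have "avg_map (twist_act k A C \<psi> M act\<^sub>M (tens k M C x c) b) =
      fold_act x (\<Oplus>\<^bsub>A \<Otimes>\<^bsub>k\<^esub> A\<^esub>i\<in>{..<n}. tens k A A (a i) (h i c \<otimes>\<^bsub>A\<^esub> b))"
    using x c b by (simp add: twist_act_tens[OF right_modules(1) modules(2) \<psi>] avg_map_diag_act
        cointegral_family.family_linear[OF family])
  also have "\<dots> = (\<Oplus>\<^bsub>N\<^esub>i\<in>{..<n}. fold_act x (tens k A A (a i) (h i c \<otimes>\<^bsub>A\<^esub> b)))"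
    by (rule lin_finsum[OF _ _ fold_act_lin[OF x]]) (simp_all add: Pi_iff b c)
  also have "\<dots> = (\<Oplus>\<^bsub>N\<^esub>i\<in>{..<n}. act\<^sub>N (act\<^sub>N (g (act\<^sub>M x (a i))) (h i c)) b)"
    using x b c by (intro N.finsum_cong') (auto simp: fold_act_tens act_assoc)
  also have "\<dots> = act\<^sub>N (\<Oplus>\<^bsub>N\<^esub>i\<in>{..<n}. act\<^sub>N (g (act\<^sub>M x (a i))) (h i c)) b"
    by (rule lin_finsum[OF _ _ bilin_lin_l[OF actN b], symmetric]) (simp_all add: Pi_iff x c)
  also have "\<dots> = act\<^sub>N (avg_map (tens k M C x c)) b" by (simp add: avg_map_tens x c)
  finally show "avg_map (twist_act k A C \<psi> M act\<^sub>M (tens k M C x c) b) =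
      act\<^sub>N (avg_map (tens k M C x c)) b" .
qed simp_all

lemma avg_right_module_hom: "avg \<in> right_module_hom k A M act\<^sub>M N act\<^sub>N"
  by (simp add: right_module_hom_def avg_lin) (simp add: avg_def coact_act avg_map_twist_act)

text \<open>Counterpart of \<open>fold_act\<close> with a further C-leg, used for colinearity: p
  \<otimes> (q \<otimes> c) goes to g(x \<cdot> p) \<cdot> q \<otimes> c.\<close>

definition spread where
  "spread x = tlift k (N \<Otimes>\<^bsub>k\<^esub> C) (\<lambda>p t. diag_act k A C N act\<^sub>N (g (act\<^sub>M x p)) t)"

lemma spread_bilin:
  "x \<in> carrier M \<Longrightarrow>
    (\<lambda>p t. diag_act k A C N act\<^sub>N (g (act\<^sub>M x p)) t) \<in> bilin k A (A \<Otimes>\<^bsub>k\<^esub> C) (N \<Otimes>\<^bsub>k\<^esub> C)"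
  using bilin_comp[OF diag_act_bilin[OF right_modules(2) modules(2)]
      lin_comp[OF bilin_lin_r[OF actM] g] lin_id] by simp

lemma spread_lin: "x \<in> carrier M \<Longrightarrow> spread x \<in> lin k (A \<Otimes>\<^bsub>k\<^esub> (A \<Otimes>\<^bsub>k\<^esub> C)) (N \<Otimes>\<^bsub>k\<^esub> C)"
  unfolding spread_def by (rule tlift_lin[OF _ _ _ spread_bilin]) simp_all

lemma spread_tens:
  "x \<in> carrier M \<Longrightarrow> p \<in> carrier A \<Longrightarrow> t \<in> carrier (A \<Otimes>\<^bsub>k\<^esub> C) \<Longrightarrow>
    spread x (tens k A (A \<Otimes>\<^bsub>k\<^esub> C) p t) = diag_act k A C N act\<^sub>N (g (act\<^sub>M x p)) t"
  unfolding spread_def by (rule tlift_tens[OF _ _ _ spread_bilin]) simp_all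

text \<open>For fixed \<open>v\<close> the tensor \<open>L v\<close> is arbitrary, so linearity in
  \<open>x\<close> is that of a lift depending on a parameter.\<close>

lemma spread_bilin':
  assumes "L \<in> lin k V (A \<Otimes>\<^bsub>k\<^esub> (A \<Otimes>\<^bsub>k\<^esub> C))"
  shows "(\<lambda>x v. spread x (L v)) \<in> bilin k M V (N \<Otimes>\<^bsub>k\<^esub> C)"
proof (rule bilinI)
  fix x assume "x \<in> carrier M"
  then show "(\<lambda>v. spread x (L v)) \<in> lin k V (N \<Otimes>\<^bsub>k\<^esub> C)"
    by (rule lin_comp[OF assms spread_lin])
next
  fix v assume "v \<in> carrier V"
  then have v: "L v \<in> carrier (A \<Otimes>\<^bsub>k\<^esub> (A \<Otimes>\<^bsub>k\<^esub> C))" by (rule lin_closed[OF assms])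
  have "(\<lambda>x. diag_act k A C N act\<^sub>N (g (act\<^sub>M x p)) t) \<in> lin k M (N \<Otimes>\<^bsub>k\<^esub> C)"
    if "p \<in> carrier A" "t \<in> carrier (A \<Otimes>\<^bsub>k\<^esub> C)" for p t
    by (rule lin_comp[OF lin_comp[OF bilin_lin_l[OF actM that(1)] g]
          bilin_lin_l[OF diag_act_bilin[OF right_modules(2) modules(2)] that(2)]])
  then show "(\<lambda>x. spread x (L v)) \<in> lin k M (N \<Otimes>\<^bsub>k\<^esub> C)"
    unfolding spread_def using v
    by (intro tlift_lin_param[where M = A and N = "A \<Otimes>\<^bsub>k\<^esub> C"]) (simp_all add: spread_bilin)
qed

text \<open>The two sides of the colinearity condition on the cointegral map, as maps on \<open>C \<otimes> C\<close>.\<close>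
definition col_l where
  "col_l = tlift k (A \<Otimes>\<^bsub>k\<^esub> (A \<Otimes>\<^bsub>k\<^esub> C)) (\<lambda>d e. \<Oplus>\<^bsub>A \<Otimes>\<^bsub>k\<^esub> (A \<Otimes>\<^bsub>k\<^esub> C)\<^esub>i\<in>{..<n}.
     tmap k A (A \<Otimes>\<^bsub>k\<^esub> C) id \<psi> (tassoc k A C A
       (tens k (A \<Otimes>\<^bsub>k\<^esub> C) A (\<psi> (tens k C A d (a i))) (h i e))))"

definition col_r where
  "col_r t = (\<Oplus>\<^bsub>A \<Otimes>\<^bsub>k\<^esub> (A \<Otimes>\<^bsub>k\<^esub> C)\<^esub>i\<in>{..<n}. tens k A (A \<Otimes>\<^bsub>k\<^esub> C) (a i) (tmap k A C (h i) id t))"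

lemma col_eq: "c \<in> carrier C \<Longrightarrow> col_l (\<Delta> c) = col_r (\<Delta> c)"
  using cointegral_family.family_colinear[OF family] by (simp add: col_l_def col_r_def)

lemma shuffle_lin:
  "(\<lambda>s. tmap k A (A \<Otimes>\<^bsub>k\<^esub> C) id \<psi> (tassoc k A C A s))
    \<in> lin k ((A \<Otimes>\<^bsub>k\<^esub> C) \<Otimes>\<^bsub>k\<^esub> A) (A \<Otimes>\<^bsub>k\<^esub> (A \<Otimes>\<^bsub>k\<^esub> C))"
  by (rule lin_comp[OF tassoc_lin tmap_lin[OF _ _ _ _ lin_id \<psi>]]) simp_all

lemma col_l_bilin:
  "(\<lambda>d e. \<Oplus>\<^bsub>A \<Otimes>\<^bsub>k\<^esub> (A \<Otimes>\<^bsub>k\<^esub> C)\<^esub>i\<in>{..<n}. tmap k A (A \<Otimes>\<^bsub>k\<^esub> C) id \<psi> (tassoc k A C A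
       (tens k (A \<Otimes>\<^bsub>k\<^esub> C) A (\<psi> (tens k C A d (a i))) (h i e))))
    \<in> bilin k C C (A \<Otimes>\<^bsub>k\<^esub> (A \<Otimes>\<^bsub>k\<^esub> C))"
  by (intro bilin_finsum lin_bilin_comp[OF bilin_comp[OF tens_bilin _ h] shuffle_lin]
      lin_comp[OF bilin_lin_l[OF tens_bilin] \<psi>] a) simp_all

lemma col_l_lin: "col_l \<in> lin k (C \<Otimes>\<^bsub>k\<^esub> C) (A \<Otimes>\<^bsub>k\<^esub> (A \<Otimes>\<^bsub>k\<^esub> C))"
  unfolding col_l_def by (rule tlift_lin[OF _ _ _ col_l_bilin]) simp_all

lemma col_l_tens:
  "d \<in> carrier C \<Longrightarrow> e \<in> carrier C \<Longrightarrow> col_l (tens k C C d e) = (\<Oplus>\<^bsub>A \<Otimes>\<^bsub>k\<^esub> (A \<Otimes>\<^bsub>k\<^esub> C)\<^esub>i\<in>{..<n}.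
     tmap k A (A \<Otimes>\<^bsub>k\<^esub> C) id \<psi> (tassoc k A C A
       (tens k (A \<Otimes>\<^bsub>k\<^esub> C) A (\<psi> (tens k C A d (a i))) (h i e))))"
  unfolding col_l_def by (rule tlift_tens[OF _ _ _ col_l_bilin]) simp_all

lemma col_r_lin: "col_r \<in> lin k (C \<Otimes>\<^bsub>k\<^esub> C) (A \<Otimes>\<^bsub>k\<^esub> (A \<Otimes>\<^bsub>k\<^esub> C))"
  unfolding col_r_def[abs_def]
  by (intro lin_finsum_fun lin_comp[OF tmap_lin[OF _ _ _ _ h lin_id] bilin_lin_r[OF tens_bilin]] a)
    simp_all

text \<open>For t = p \<otimes> e both sides are g(x \<cdot> p) \<cdot>
  q\<open>\<^sub>\<alpha>\<close> \<otimes> e\<open>\<^sup>\<alpha>\<close>. It is applied with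
  \<open>t\<close> the value of \<psi> at d \<otimes> \<open>a i\<close> and with
  \<open>q = h i e\<close>, which accounts for both occurrences of \<psi> in a summand of
  \<open>col_l\<close>.\<close>

lemma twist_act_spread:
  assumes x: "x \<in> carrier M" and q: "q \<in> carrier A" and t: "t \<in> carrier (A \<Otimes>\<^bsub>k\<^esub> C)"
  shows "twist_act k A C \<psi> N act\<^sub>N (tmap k N C g id (diag_act k A C M act\<^sub>M x t)) q =
    spread x (tmap k A (A \<Otimes>\<^bsub>k\<^esub> C) id \<psi> (tassoc k A C A (tens k (A \<Otimes>\<^bsub>k\<^esub> C) A t q)))"
  using _ _ _ _ _ t
proof (rule lin_tensor_eqI[where P = "N \<Otimes>\<^bsub>k\<^esub> C"])
  show "(\<lambda>t. twist_act k A C \<psi> N act\<^sub>N (tmap k N C g id (diag_act k A C M act\<^sub>M x t)) q)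
      \<in> lin k (A \<Otimes>\<^bsub>k\<^esub> C) (N \<Otimes>\<^bsub>k\<^esub> C)"
    by (rule lin_comp[OF bilin_lin_r[OF diag_act_bilin[OF right_modules(1)] x]
          lin_comp[OF tmap_lin[OF _ _ _ _ g lin_id]
            bilin_lin_l[OF twist_act_bilin[OF right_modules(2) _ \<psi>] q]]]) simp_all
  show "(\<lambda>t. spread x (tmap k A (A \<Otimes>\<^bsub>k\<^esub> C) id \<psi> (tassoc k A C A (tens k (A \<Otimes>\<^bsub>k\<^esub> C) A t q))))
      \<in> lin k (A \<Otimes>\<^bsub>k\<^esub> C) (N \<Otimes>\<^bsub>k\<^esub> C)"
    by (rule lin_comp[OF bilin_lin_l[OF tens_bilin q] lin_comp[OF shuffle_lin spread_lin[OF x]]])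
      simp_all
  fix p e assume "p \<in> carrier A" "e \<in> carrier C"
  then show "twist_act k A C \<psi> N act\<^sub>N (tmap k N C g id (diag_act k A C M act\<^sub>M x (tens k A C p e))) q =
    spread x (tmap k A (A \<Otimes>\<^bsub>k\<^esub> C) id \<psi>
      (tassoc k A C A (tens k (A \<Otimes>\<^bsub>k\<^esub> C) A (tens k A C p e) q)))"
    using x q by (simp add: diag_act_tens[OF right_modules(1)] tmap_tens[OF _ _ _ _ g lin_id]
        twist_act_tens[OF right_modules(2) modules(2) \<psi>] tassoc_tens
        tmap_tens[OF _ _ _ _ lin_id \<psi>] spread_tens)
qed simp_all

text \<open>Keeping \<open>L\<close> variable lets the two sides of the colinearity condition be
  inserted into the same expression and exchanged there.\<close>

definition expand where
  "expand L = tlift k (N \<Otimes>\<^bsub>k\<^esub> C) (\<lambda>x t. spread x (L t))"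

lemma expand:
  assumes L: "L \<in> lin k (C \<Otimes>\<^bsub>k\<^esub> C) (A \<Otimes>\<^bsub>k\<^esub> (A \<Otimes>\<^bsub>k\<^esub> C))"
  shows expand_lin: "expand L \<in> lin k (M \<Otimes>\<^bsub>k\<^esub> (C \<Otimes>\<^bsub>k\<^esub> C)) (N \<Otimes>\<^bsub>k\<^esub> C)"
    and expand_tens: "x \<in> carrier M \<Longrightarrow> t \<in> carrier (C \<Otimes>\<^bsub>k\<^esub> C) \<Longrightarrow>
      expand L (tens k M (C \<Otimes>\<^bsub>k\<^esub> C) x t) = spread x (L t)"
  unfolding expand_def
  by (rule tlift_lin[OF _ _ _ spread_bilin'[OF L]], simp_all)
    (rule tlift_tens[OF _ _ _ spread_bilin'[OF L]], simp_all)

text \<open>The left side is what the coaction makes of an average once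
  \<open>\<rho>\<^sub>M x\<close> is generalised to \<open>s\<close>. Each summand involves \<psi>
  twice, from acting by \<open>a i\<close> on M and by \<open>h i c\<close> on N; for s = x
  \<otimes> d these assemble to a summand of \<open>col_l\<close> at d \<otimes> c.\<close>

lemma sum_twist_act_expand:
  assumes c: "c \<in> carrier C" and s: "s \<in> carrier (M \<Otimes>\<^bsub>k\<^esub> C)"
  shows "(\<Oplus>\<^bsub>N \<Otimes>\<^bsub>k\<^esub> C\<^esub>i\<in>{..<n}. twist_act k A C \<psi> N act\<^sub>N
      (tmap k N C g id (twist_act k A C \<psi> M act\<^sub>M s (a i))) (h i c)) =
    expand col_l (tassoc k M C C (tens k (M \<Otimes>\<^bsub>k\<^esub> C) C s c))"
  using _ _ _ _ _ s
proof (rule lin_tensor_eqI[where P = "N \<Otimes>\<^bsub>k\<^esub> C"])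
  interpret NC: module k "N \<Otimes>\<^bsub>k\<^esub> C" by simp
  note twM = twist_act_bilin[OF right_modules(1) modules(2) \<psi>]
  note twN = twist_act_bilin[OF right_modules(2) modules(2) \<psi>]
  note tg = tmap_lin[OF modules(3,2,4,2) g lin_id]
  show "(\<lambda>s. \<Oplus>\<^bsub>N \<Otimes>\<^bsub>k\<^esub> C\<^esub>i\<in>{..<n}. twist_act k A C \<psi> N act\<^sub>N
      (tmap k N C g id (twist_act k A C \<psi> M act\<^sub>M s (a i))) (h i c)) \<in> lin k (M \<Otimes>\<^bsub>k\<^esub> C) (N \<Otimes>\<^bsub>k\<^esub> C)"
    using c by (intro lin_finsum_fun lin_comp[OF lin_comp[OF bilin_lin_l[OF twM] tg] bilin_lin_l[OF twN]])
      simp_all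
  show "(\<lambda>s. expand col_l (tassoc k M C C (tens k (M \<Otimes>\<^bsub>k\<^esub> C) C s c))) \<in> lin k (M \<Otimes>\<^bsub>k\<^esub> C) (N \<Otimes>\<^bsub>k\<^esub> C)"
    by (rule lin_comp[OF bilin_lin_l[OF tens_bilin c] lin_comp[OF tassoc_lin expand_lin[OF col_l_lin]]])
      simp_all
  fix x d assume x: "x \<in> carrier M" and d: "d \<in> carrier C"
  let ?w = "\<lambda>i. tmap k A (A \<Otimes>\<^bsub>k\<^esub> C) id \<psi> (tassoc k A C A
       (tens k (A \<Otimes>\<^bsub>k\<^esub> C) A (\<psi> (tens k C A d (a i))) (h i c)))"
  have w: "?w i \<in> carrier (A \<Otimes>\<^bsub>k\<^esub> (A \<Otimes>\<^bsub>k\<^esub> C))" if "i < n" for i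
    using that c d by (intro lin_closed[OF shuffle_lin]) simp
  have "(\<Oplus>\<^bsub>N \<Otimes>\<^bsub>k\<^esub> C\<^esub>i\<in>{..<n}. twist_act k A C \<psi> N act\<^sub>N
      (tmap k N C g id (twist_act k A C \<psi> M act\<^sub>M (tens k M C x d) (a i))) (h i c)) =
    (\<Oplus>\<^bsub>N \<Otimes>\<^bsub>k\<^esub> C\<^esub>i\<in>{..<n}. spread x (?w i))"
    using x d c w by (intro NC.finsum_cong')
      (auto simp: twist_act_tens[OF right_modules(1) modules(2) \<psi>] twist_act_spread
        intro!: lin_closed[OF spread_lin])
  also have "\<dots> = spread x (\<Oplus>\<^bsub>A \<Otimes>\<^bsub>k\<^esub> (A \<Otimes>\<^bsub>k\<^esub> C)\<^esub>i\<in>{..<n}. ?w i)"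
    using w by (intro lin_finsum[OF _ _ spread_lin[OF x], symmetric]) (auto simp: Pi_iff)
  also have "\<dots> = expand col_l (tassoc k M C C (tens k (M \<Otimes>\<^bsub>k\<^esub> C) C (tens k M C x d) c))"
    using x d c by (simp add: tassoc_tens expand_tens[OF col_l_lin] col_l_tens)
  finally show "(\<Oplus>\<^bsub>N \<Otimes>\<^bsub>k\<^esub> C\<^esub>i\<in>{..<n}. twist_act k A C \<psi> N act\<^sub>N
      (tmap k N C g id (twist_act k A C \<psi> M act\<^sub>M (tens k M C x d) (a i))) (h i c)) =
    expand col_l (tassoc k M C C (tens k (M \<Otimes>\<^bsub>k\<^esub> C) C (tens k M C x d) c))" .
qed simp_all

text \<open>Compatibility is used for N, where \<open>h i c\<close> acts, and for M, where
  \<open>a i\<close> acts; between the two, colinearity of \<open>g\<close> exchanges the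
  coactions.\<close>

lemma coact_avg_map:
  assumes s: "s \<in> carrier (M \<Otimes>\<^bsub>k\<^esub> C)"
  shows "\<rho>\<^sub>N (avg_map s) = expand col_l (tassoc k M C C (tmap k (M \<Otimes>\<^bsub>k\<^esub> C) C \<rho>\<^sub>M id s))"
  using _ _ _ _ _ s
proof (rule lin_tensor_eqI[where P = "N \<Otimes>\<^bsub>k\<^esub> C"])
  interpret NC: module k "N \<Otimes>\<^bsub>k\<^esub> C" by simp
  show "(\<lambda>s. \<rho>\<^sub>N (avg_map s)) \<in> lin k (M \<Otimes>\<^bsub>k\<^esub> C) (N \<Otimes>\<^bsub>k\<^esub> C)"
    by (rule lin_comp[OF avg_map_lin \<rho>N])
  show "(\<lambda>s. expand col_l (tassoc k M C C (tmap k (M \<Otimes>\<^bsub>k\<^esub> C) C \<rho>\<^sub>M id s))) \<in> lin k (M \<Otimes>\<^bsub>k\<^esub> C) (N \<Otimes>\<^bsub>k\<^esub> C)"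
    by (rule lin_comp[OF tmap_lin[OF _ _ _ _ \<rho>M lin_id]
          lin_comp[OF tassoc_lin expand_lin[OF col_l_lin]]]) simp_all
  fix x c assume x: "x \<in> carrier M" and c: "c \<in> carrier C"
  have cl: "\<rho>\<^sub>N (act\<^sub>N (g (act\<^sub>M x (a i))) (h i c)) \<in> carrier (N \<Otimes>\<^bsub>k\<^esub> C)" if "i < n" for i
    using x c that by simp
  have "\<rho>\<^sub>N (avg_map (tens k M C x c)) = (\<Oplus>\<^bsub>N \<Otimes>\<^bsub>k\<^esub> C\<^esub>i\<in>{..<n}. \<rho>\<^sub>N (act\<^sub>N (g (act\<^sub>M x (a i))) (h i c)))"
    using x c by (simp add: avg_map_tens lin_finsum[OF _ _ \<rho>N] Pi_iff)
  also have "\<dots> = (\<Oplus>\<^bsub>N \<Otimes>\<^bsub>k\<^esub> C\<^esub>i\<in>{..<n}. twist_act k A C \<psi> N act\<^sub>N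
      (tmap k N C g id (twist_act k A C \<psi> M act\<^sub>M (\<rho>\<^sub>M x) (a i))) (h i c))"
    using x c cl by (intro NC.finsum_cong' refl) (simp_all add: Pi_iff coact_act g_coact)
  also have "\<dots> = expand col_l (tassoc k M C C (tens k (M \<Otimes>\<^bsub>k\<^esub> C) C (\<rho>\<^sub>M x) c))"
    using x c by (intro sum_twist_act_expand) simp_all
  also have "\<dots> = expand col_l (tassoc k M C C (tmap k (M \<Otimes>\<^bsub>k\<^esub> C) C \<rho>\<^sub>M id (tens k M C x c)))"
    using x c by (simp add: tmap_tens[OF _ _ _ _ \<rho>M lin_id])
  finally show "\<rho>\<^sub>N (avg_map (tens k M C x c)) =
      expand col_l (tassoc k M C C (tmap k (M \<Otimes>\<^bsub>k\<^esub> C) C \<rho>\<^sub>M id (tens k M C x c)))" .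
qed simp_all

text \<open>With x \<otimes> c as \<open>s\<close>, the last two legs are exactly \<Delta>(c), where
  \<open>col_l\<close> and \<open>col_r\<close> agree.\<close>

lemma expand_col_eq:
  assumes s: "s \<in> carrier (M \<Otimes>\<^bsub>k\<^esub> C)"
  shows "expand col_l (tmap k M (C \<Otimes>\<^bsub>k\<^esub> C) id \<Delta> s) = expand col_r (tmap k M (C \<Otimes>\<^bsub>k\<^esub> C) id \<Delta> s)"
  using _ _ _ _ _ s
proof (rule lin_tensor_eqI[where P = "N \<Otimes>\<^bsub>k\<^esub> C"])
  have "(\<lambda>s. expand L (tmap k M (C \<Otimes>\<^bsub>k\<^esub> C) id \<Delta> s)) \<in> lin k (M \<Otimes>\<^bsub>k\<^esub> C) (N \<Otimes>\<^bsub>k\<^esub> C)"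
    if "L \<in> lin k (C \<Otimes>\<^bsub>k\<^esub> C) (A \<Otimes>\<^bsub>k\<^esub> (A \<Otimes>\<^bsub>k\<^esub> C))" for L
    by (rule lin_comp[OF tmap_lin[OF _ _ _ _ lin_id \<Delta>] expand_lin[OF that]]) simp_all
  from this[OF col_l_lin] this[OF col_r_lin]
  show "(\<lambda>s. expand col_l (tmap k M (C \<Otimes>\<^bsub>k\<^esub> C) id \<Delta> s)) \<in> lin k (M \<Otimes>\<^bsub>k\<^esub> C) (N \<Otimes>\<^bsub>k\<^esub> C)"
    "(\<lambda>s. expand col_r (tmap k M (C \<Otimes>\<^bsub>k\<^esub> C) id \<Delta> s)) \<in> lin k (M \<Otimes>\<^bsub>k\<^esub> C) (N \<Otimes>\<^bsub>k\<^esub> C)" .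
  fix x c assume "x \<in> carrier M" "c \<in> carrier C"
  then show "expand col_l (tmap k M (C \<Otimes>\<^bsub>k\<^esub> C) id \<Delta> (tens k M C x c)) =
      expand col_r (tmap k M (C \<Otimes>\<^bsub>k\<^esub> C) id \<Delta> (tens k M C x c))"
    by (simp add: tmap_tens[OF _ _ _ _ lin_id \<Delta>] expand_tens[OF col_l_lin] expand_tens[OF col_r_lin]
        col_eq)
qed simp_all

text \<open>For s = x \<otimes> d, \<open>col_r\<close> applies the family to d and never touches c.
  The sum therefore rebuilds the average at x \<otimes> d, with c as the new coaction leg.\<close>

lemma expand_col_r:
  assumes c: "c \<in> carrier C" and s: "s \<in> carrier (M \<Otimes>\<^bsub>k\<^esub> C)"
  shows "expand col_r (tassoc k M C C (tens k (M \<Otimes>\<^bsub>k\<^esub> C) C s c)) = tens k N C (avg_map s) c"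
  using _ _ _ _ _ s
proof (rule lin_tensor_eqI[where P = "N \<Otimes>\<^bsub>k\<^esub> C"])
  interpret NC: module k "N \<Otimes>\<^bsub>k\<^esub> C" by simp
  show "(\<lambda>s. expand col_r (tassoc k M C C (tens k (M \<Otimes>\<^bsub>k\<^esub> C) C s c))) \<in> lin k (M \<Otimes>\<^bsub>k\<^esub> C) (N \<Otimes>\<^bsub>k\<^esub> C)"
    by (rule lin_comp[OF bilin_lin_l[OF tens_bilin c] lin_comp[OF tassoc_lin expand_lin[OF col_r_lin]]])
      simp_all
  show "(\<lambda>s. tens k N C (avg_map s) c) \<in> lin k (M \<Otimes>\<^bsub>k\<^esub> C) (N \<Otimes>\<^bsub>k\<^esub> C)"
    by (rule lin_comp[OF avg_map_lin bilin_lin_l[OF tens_bilin c]]) simp_all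
  fix x d assume x: "x \<in> carrier M" and d: "d \<in> carrier C"
  have t: "tmap k A C (h i) id (tens k C C d c) = tens k A C (h i d) c" if "i < n" for i
    using c d that by (simp add: tmap_tens[OF _ _ _ _ h lin_id])
  have "expand col_r (tassoc k M C C (tens k (M \<Otimes>\<^bsub>k\<^esub> C) C (tens k M C x d) c)) =
      spread x (col_r (tens k C C d c))"
    using x c d by (simp add: tassoc_tens expand_tens[OF col_r_lin])
  also have "\<dots> = (\<Oplus>\<^bsub>N \<Otimes>\<^bsub>k\<^esub> C\<^esub>i\<in>{..<n}.
      spread x (tens k A (A \<Otimes>\<^bsub>k\<^esub> C) (a i) (tmap k A C (h i) id (tens k C C d c))))"
    using c d unfolding col_r_def by (intro lin_finsum[OF _ _ spread_lin[OF x]]) (simp_all add: Pi_iff t)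
  also have "\<dots> = (\<Oplus>\<^bsub>N \<Otimes>\<^bsub>k\<^esub> C\<^esub>i\<in>{..<n}. tens k N C (act\<^sub>N (g (act\<^sub>M x (a i))) (h i d)) c)"
    using x c d by (intro NC.finsum_cong') (auto simp: t spread_tens diag_act_tens[OF right_modules(2)])
  also have "\<dots> = tens k N C (\<Oplus>\<^bsub>N\<^esub>i\<in>{..<n}. act\<^sub>N (g (act\<^sub>M x (a i))) (h i d)) c"
    by (rule lin_finsum[OF _ _ bilin_lin_l[OF tens_bilin c], symmetric]) (simp_all add: Pi_iff x d)
  also have "\<dots> = tens k N C (avg_map (tens k M C x d)) c" by (simp add: avg_map_tens x d)
  finally show "expand col_r (tassoc k M C C (tens k (M \<Otimes>\<^bsub>k\<^esub> C) C (tens k M C x d) c)) =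
    tens k N C (avg_map (tens k M C x d)) c" .
qed simp_all

lemma expand_col_r_coact:
  assumes s: "s \<in> carrier (M \<Otimes>\<^bsub>k\<^esub> C)"
  shows "expand col_r (tassoc k M C C (tmap k (M \<Otimes>\<^bsub>k\<^esub> C) C \<rho>\<^sub>M id s)) = tmap k N C avg id s"
  using _ _ _ _ _ s
proof (rule lin_tensor_eqI[where P = "N \<Otimes>\<^bsub>k\<^esub> C"])
  show "(\<lambda>s. expand col_r (tassoc k M C C (tmap k (M \<Otimes>\<^bsub>k\<^esub> C) C \<rho>\<^sub>M id s))) \<in> lin k (M \<Otimes>\<^bsub>k\<^esub> C) (N \<Otimes>\<^bsub>k\<^esub> C)"
    by (rule lin_comp[OF tmap_lin[OF _ _ _ _ \<rho>M lin_id]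
          lin_comp[OF tassoc_lin expand_lin[OF col_r_lin]]]) simp_all
  show "tmap k N C avg id \<in> lin k (M \<Otimes>\<^bsub>k\<^esub> C) (N \<Otimes>\<^bsub>k\<^esub> C)"
    by (rule tmap_lin[OF _ _ _ _ avg_lin lin_id]) simp_all
  fix x c assume "x \<in> carrier M" "c \<in> carrier C"
  then show "expand col_r (tassoc k M C C (tmap k (M \<Otimes>\<^bsub>k\<^esub> C) C \<rho>\<^sub>M id (tens k M C x c))) =
      tmap k N C avg id (tens k M C x c)"
    by (simp add: tmap_tens[OF _ _ _ _ \<rho>M lin_id] tmap_tens[OF _ _ _ _ avg_lin lin_id] expand_col_r)
      (simp add: avg_def)
qed simp_all

text \<open>Coassociativity of M is used twice: to replace (\<rho> \<otimes> C)\<rho>(x) by (M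
  \<otimes> \<Delta>)\<rho>(x), where \<open>col_l\<close> may be exchanged for
  \<open>col_r\<close>, and to return to the iterated coaction, from which the average is read
  off.\<close>

lemma avg_comodule_hom: "avg \<in> comodule_hom k C M \<rho>\<^sub>M N \<rho>\<^sub>N"
proof -
  have "\<rho>\<^sub>N (avg x) = tmap k N C avg id (\<rho>\<^sub>M x)" if x: "x \<in> carrier M" for x
    using x coact_avg_map[of "\<rho>\<^sub>M x"] expand_col_eq[of "\<rho>\<^sub>M x"] expand_col_r_coact[of "\<rho>\<^sub>M x"]
      right_comodule.coaction_coassoc[OF comodules(1) x]
    by (simp add: avg_def)
  then show ?thesis by (simp add: comodule_hom_def avg_lin)
qed

lemma avg_entwined_hom: "avg \<in> entwined_hom k A C M act\<^sub>M \<rho>\<^sub>M N act\<^sub>N \<rho>\<^sub>N"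
  by (simp add: entwined_hom_def avg_right_module_hom avg_comodule_hom)

end

text \<open>Associativity gathers the sum into the action of a single element of A, which
  normalisation identifies as \<epsilon>(c) 1. The module is left general: sections use M and
  retractions use N.\<close>

lemma (in cointegral_family) sum_act_family:
  assumes "right_module k A M act" "x \<in> carrier M" "c \<in> carrier C"
  shows "(\<Oplus>\<^bsub>M\<^esub>i\<in>{..<n}. act (act x (a i)) (h i c)) = \<epsilon> c \<odot>\<^bsub>M\<^esub> x"
proof -
  have m: "module k A" "module k M"
    using assms(1) by (simp_all add: right_module_def unital_algebra_def)
  interpret M: module k M by (rule m)
  interpret MA: right_module k A M act by fact
  note b = act_bilin[OF assms(1)]
  note hc = lin_closed[OF family_lin assms(3)]
  have \<epsilon>c: "\<epsilon> c \<in> carrier k" using lin_closed[OF counit_lin assms(3)] by (simp add: self_module_def)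
  have "(\<Oplus>\<^bsub>M\<^esub>i\<in>{..<n}. act (act x (a i)) (h i c)) = (\<Oplus>\<^bsub>M\<^esub>i\<in>{..<n}. act x (a i \<otimes>\<^bsub>A\<^esub> h i c))"
    using assms(2) family_closed hc by (intro M.finsum_cong')
      (auto simp: MA.act_mult intro!: bilin_closed[OF b] bilin_closed[OF product_bilin] unital_algebra_axioms)
  also have "\<dots> = act x (\<Oplus>\<^bsub>A\<^esub>i\<in>{..<n}. a i \<otimes>\<^bsub>A\<^esub> h i c)"
    using family_closed hc by (intro lin_finsum[OF m bilin_lin_r[OF b assms(2)], symmetric])
      (auto intro!: bilin_closed[OF product_bilin] unital_algebra_axioms)
  also have "\<dots> = \<epsilon> c \<odot>\<^bsub>M\<^esub> x"
    using \<epsilon>c by (simp add: family_normalised assms lin_smult[OF bilin_lin_r[OF b assms(2)]] MA.act_one)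
  finally show ?thesis .
qed

text \<open>Such an \<open>F\<close> agrees on pure tensors with M \<otimes> \<epsilon> followed by
  the identification of M \<otimes> k with M, so the counit axiom applies. A composite of
  \<open>avg_map\<close> with the given morphism will take the place of \<open>F\<close>.\<close>

lemma comodule_counit_sum:
  assumes "right_comodule k C \<Delta> \<epsilon> M \<rho>" "x \<in> carrier M" "F \<in> lin k (M \<Otimes>\<^bsub>k\<^esub> C) M"
    and "\<And>y c. y \<in> carrier M \<Longrightarrow> c \<in> carrier C \<Longrightarrow> F (tens k M C y c) = \<epsilon> c \<odot>\<^bsub>M\<^esub> y"
  shows "F (\<rho> x) = x"
proof -
  interpret right_comodule k C \<Delta> \<epsilon> M \<rho> by fact
  have M: "module k M" and C: "module k C" by unfold_locales
  note s = self_module_module[OF module.axioms(1)[OF M]]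
  have carrier_self: "carrier (self_module k) = carrier k" by (simp add: self_module_def)
  note tm = tmap_lin[OF M C M s lin_id counit_lin]
  have "F (\<rho> x) = tunit_r k M (tmap k M (self_module k) id \<epsilon> (\<rho> x))"
  proof (rule lin_tensor_eqI[OF M C assms(3)])
    show "(\<lambda>s. tunit_r k M (tmap k M (self_module k) id \<epsilon> s)) \<in> lin k (M \<Otimes>\<^bsub>k\<^esub> C) M"
      by (rule lin_comp[OF tm tunit_r_lin[OF M]])
    show "\<rho> x \<in> carrier (M \<Otimes>\<^bsub>k\<^esub> C)" by (rule lin_closed[OF coaction_lin assms(2)])
    fix y c assume "y \<in> carrier M" "c \<in> carrier C"
    then show "F (tens k M C y c) = tunit_r k M (tmap k M (self_module k) id \<epsilon> (tens k M C y c))"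
      using lin_closed[OF counit_lin] carrier_self
      by (simp add: assms(4) tmap_tens[OF M C M s lin_id counit_lin] tunit_r_tens[OF M])
  qed
  then show ?thesis using coaction_counit[OF assms(2)] by simp
qed

section \<open>Averaging preserves sections and retractions\<close>

context averaging
begin

text \<open>By A-linearity \<open>f\<close> passes the outer action and meets \<open>g\<close>
  directly; what remains is the normalised sum in M.\<close>

lemma avg_section:
  assumes f: "f \<in> entwined_hom k A C N act\<^sub>N \<rho>\<^sub>N M act\<^sub>M \<rho>\<^sub>M"
    and fg: "\<And>x. x \<in> carrier M \<Longrightarrow> f (g x) = x" and x: "x \<in> carrier M"
  shows "f (avg x) = x"
proof -
  interpret M: module k M by simp
  have fl: "f \<in> lin k N M" and fa: "\<And>y b. y \<in> carrier N \<Longrightarrow> b \<in> carrier A \<Longrightarrow> f (act\<^sub>N y b) = act\<^sub>M (f y) b"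
    using f by (auto simp: entwined_hom_def right_module_hom_def)
  have "f (avg_map (\<rho>\<^sub>M x)) = x"
  proof (rule comodule_counit_sum[OF comodules(1) x])
    show "(\<lambda>s. f (avg_map s)) \<in> lin k (M \<Otimes>\<^bsub>k\<^esub> C) M" by (rule lin_comp[OF avg_map_lin fl])
    fix y c assume y: "y \<in> carrier M" and c: "c \<in> carrier C"
    have "f (avg_map (tens k M C y c)) = (\<Oplus>\<^bsub>M\<^esub>i\<in>{..<n}. f (act\<^sub>N (g (act\<^sub>M y (a i))) (h i c)))"
      using y c by (simp add: avg_map_tens lin_finsum[OF _ _ fl] Pi_iff)
    also have "\<dots> = (\<Oplus>\<^bsub>M\<^esub>i\<in>{..<n}. act\<^sub>M (act\<^sub>M y (a i)) (h i c))"
      using y c by (intro M.finsum_cong') (auto simp: fa fg)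
    also have "\<dots> = \<epsilon> c \<odot>\<^bsub>M\<^esub> y"
      by (rule cointegral_family.sum_act_family[OF family right_modules(1) y c])
    finally show "f (avg_map (tens k M C y c)) = \<epsilon> c \<odot>\<^bsub>M\<^esub> y" .
  qed
  then show ?thesis by (simp add: avg_def)
qed

text \<open>Here the average is taken at \<open>f y\<close>, so colinearity of \<open>f\<close>
  first replaces the coaction of M at \<open>f y\<close> by that of N at \<open>y\<close>. Then
  A-linearity moves \<open>a i\<close> inside \<open>f\<close>, where \<open>g\<close> cancels it,
  and the normalised sum is formed in N.\<close>

lemma avg_retraction:
  assumes f: "f \<in> entwined_hom k A C N act\<^sub>N \<rho>\<^sub>N M act\<^sub>M \<rho>\<^sub>M"
    and gf: "\<And>y. y \<in> carrier N \<Longrightarrow> g (f y) = y" and y: "y \<in> carrier N"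
  shows "avg (f y) = y"
proof -
  interpret N: module k N by simp
  have fl: "f \<in> lin k N M" and fa: "\<And>y b. y \<in> carrier N \<Longrightarrow> b \<in> carrier A \<Longrightarrow> f (act\<^sub>N y b) = act\<^sub>M (f y) b"
    and fc: "\<And>y. y \<in> carrier N \<Longrightarrow> \<rho>\<^sub>M (f y) = tmap k M C f id (\<rho>\<^sub>N y)"
    using f by (auto simp: entwined_hom_def right_module_hom_def comodule_hom_def)
  have "avg_map (tmap k M C f id (\<rho>\<^sub>N y)) = y"
  proof (rule comodule_counit_sum[OF comodules(2) y])
    show "(\<lambda>s. avg_map (tmap k M C f id s)) \<in> lin k (N \<Otimes>\<^bsub>k\<^esub> C) N"
      by (rule lin_comp[OF tmap_lin[OF _ _ _ _ fl lin_id] avg_map_lin]) simp_all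
    fix z c assume z: "z \<in> carrier N" and c: "c \<in> carrier C"
    have "avg_map (tmap k M C f id (tens k N C z c)) =
        (\<Oplus>\<^bsub>N\<^esub>i\<in>{..<n}. act\<^sub>N (g (act\<^sub>M (f z) (a i))) (h i c))"
      using z c lin_closed[OF fl] by (simp add: avg_map_tens tmap_tens[OF _ _ _ _ fl lin_id])
    also have "\<dots> = (\<Oplus>\<^bsub>N\<^esub>i\<in>{..<n}. act\<^sub>N (act\<^sub>N z (a i)) (h i c))"
      using z c by (intro N.finsum_cong') (auto simp: fa[symmetric] gf)
    also have "\<dots> = \<epsilon> c \<odot>\<^bsub>N\<^esub> z"
      by (rule cointegral_family.sum_act_family[OF family right_modules(2) z c])
    finally show "avg_map (tmap k M C f id (tens k N C z c)) = \<epsilon> c \<odot>\<^bsub>N\<^esub> z" .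
  qed
  then show ?thesis using y by (simp add: avg_def fc)
qed

end

theorem theorem4p6:
  fixes k :: "('k, 'r) ring_scheme"
    and A :: "('k, 'a, 'u) module_scheme" and C :: "('k, 'c, 'v) module_scheme"
    and M :: "('k, 'm, 'w) module_scheme" and N :: "('k, 'n, 'z) module_scheme"
  assumes "entwining_structure k A C \<Delta> \<epsilon> \<psi>"
    and "finitely_generated k A" and "projective k A"
    and "\<exists>\<phi>. normalised_cointegral k A C \<Delta> \<epsilon> \<psi> \<phi>"
    and "entwined_module k A C \<Delta> \<epsilon> \<psi> N act\<^sub>N \<rho>\<^sub>N"
    and "entwined_module k A C \<Delta> \<epsilon> \<psi> M act\<^sub>M \<rho>\<^sub>M"
    and "f \<in> entwined_hom k A C N act\<^sub>N \<rho>\<^sub>N M act\<^sub>M \<rho>\<^sub>M"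
  shows "((\<exists>g \<in> comodule_hom k C M \<rho>\<^sub>M N \<rho>\<^sub>N. \<forall>x\<in>carrier M. f (g x) = x) \<longrightarrow>
      (\<exists>g \<in> entwined_hom k A C M act\<^sub>M \<rho>\<^sub>M N act\<^sub>N \<rho>\<^sub>N. \<forall>x\<in>carrier M. f (g x) = x)) \<and>
    ((\<exists>g \<in> comodule_hom k C M \<rho>\<^sub>M N \<rho>\<^sub>N. \<forall>y\<in>carrier N. g (f y) = y) \<longrightarrow>
      (\<exists>g \<in> entwined_hom k A C M act\<^sub>M \<rho>\<^sub>M N act\<^sub>N \<rho>\<^sub>N. \<forall>y\<in>carrier N. g (f y) = y))"
proof -
  obtain \<phi> where "normalised_cointegral k A C \<Delta> \<epsilon> \<psi> \<phi>" using assms(4) by blast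
  from cointegral_family_exists[OF assms(1-3) this]
  obtain n a h where fam: "cointegral_family k A C \<Delta> \<epsilon> \<psi> n a h" .
  \<comment> \<open>One family serves every colinear \<open>g\<close>, hence both halves of the
    statement.\<close>
  have avg: "averaging k A C \<Delta> \<epsilon> \<psi> n a h M act\<^sub>M \<rho>\<^sub>M N act\<^sub>N \<rho>\<^sub>N g"
    if "g \<in> comodule_hom k C M \<rho>\<^sub>M N \<rho>\<^sub>N" for g
    by (rule averaging.intro[OF fam assms(6,5) that])
  show ?thesis
  proof (intro conjI impI; elim bexE)
    fix g assume g: "g \<in> comodule_hom k C M \<rho>\<^sub>M N \<rho>\<^sub>N" and fg: "\<forall>x\<in>carrier M. f (g x) = x"
    interpret averaging k A C \<Delta> \<epsilon> \<psi> n a h M act\<^sub>M \<rho>\<^sub>M N act\<^sub>N \<rho>\<^sub>N g by (rule avg[OF g])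
    have "\<forall>x\<in>carrier M. f (avg x) = x" using avg_section[OF assms(7)] fg by blast
    then show "\<exists>g \<in> entwined_hom k A C M act\<^sub>M \<rho>\<^sub>M N act\<^sub>N \<rho>\<^sub>N. \<forall>x\<in>carrier M. f (g x) = x"
      by (rule bexI[OF _ avg_entwined_hom])
  next
    fix g assume g: "g \<in> comodule_hom k C M \<rho>\<^sub>M N \<rho>\<^sub>N" and gf: "\<forall>y\<in>carrier N. g (f y) = y"
    interpret averaging k A C \<Delta> \<epsilon> \<psi> n a h M act\<^sub>M \<rho>\<^sub>M N act\<^sub>N \<rho>\<^sub>N g by (rule avg[OF g])
    have "\<forall>y\<in>carrier N. avg (f y) = y" using avg_retraction[OF assms(7)] gf by blast
    then show "\<exists>g \<in> entwined_hom k A C M act\<^sub>M \<rho>\<^sub>M N act\<^sub>N \<rho>\<^sub>N. \<forall>y\<in>carrier N. g (f y) = y"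
      by (rule bexI[OF _ avg_entwined_hom])
  qed
qed

end
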